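(* Let the functions $f$, $G_0$ and $h$ be twice continuously differentiable. Suppose also that every globally optimal solution of problem $(\mathcal{P})$ is nondegenerate, and for any globally optimal solution $x_*\in\Omega_*$ the unique KKT-pair $(x_*,\lambda_* )$ satisfies the second order sufficient optimality condition. Then the penalized augmented Lagrangian function $\mathscr{L}_e$ (defined in the context) is globally exact if and only if there exists $c_0>0$ such that the set $\{(x,\lambda)\in\mathbb{R}^d\times Y^*\mid\mathscr{L}_e(x,\lambda,c_0)<f_*\}$ is either bounded or empty. In particular, if the set $\{x\in\mathbb{R}^d\mid f(x)<f_*+\gamma,\ a(x)>0,\ b(x)>0\}$ is bounded for some $\gamma>0$, then $\mathscr{L}_e$ is globally exact in the sense that for any sufficiently large $c>0$ its points of global minimum in $(x,\lambda)$ are exactly the KKT-pairs of problem $(\mathcal{P})$ corresponding to globally optimal solutions of this problem.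
   Context: Problem $(\mathcal{P})$ (nonlinear semidefinite program): minimize $f(x)$ over $x\in\mathbb{R}^d$ subject to $G_0(x)\preceq 0$, $h(x)=0$, where $f:\mathbb{R}^d\to\mathbb{R}$, $G_0:\mathbb{R}^d\to\mathbb{S}^l$, $h:\mathbb{R}^d\to\mathbb{R}^s$; $\mathbb{S}^l$ is the space of real symmetric $l\times l$ matrices with inner product $\mathrm{Tr}(AB)$, and $G_0(x)\preceq 0$ means negative semidefinite. $\mathbb{S}^l_+$, $\mathbb{S}^l_-$ are the cones of positive, respectively negative, semidefinite matrices, and $[\cdot]_+$ is the projection onto $\mathbb{S}^l_+$. A globally optimal solution is assumed to exist; $\Omega_*$ is the set of globally optimal solutions, $f_*$ the optimal value. Put $Y=Y^*=\mathbb{S}^l\times\mathbb{R}^s$, $K=\mathbb{S}^l_-\times\{0\}$, $G=(G_0,h)$, $K^*=\mathbb{S}^l_+\times\mathbb{R}^s$; $\lambda=(\lambda_0,\mu)\in Y^*$; $L(x,\lambda)=f(x)+\mathrm{Tr}(\lambda_0G_0(x))+\langle\mu,h(x)\rangle$. $(x_*,\lambda_* )$ is a KKT-pair if $G(x_* )\in K$, $\lambda_*\in K^*$, $\langle\lambda_*,G(x_* )\rangle=0$, $D_xL(x_*,\lambda_* )=0$. A locally optimal solution $x_*$ is nondegenerate if $DG(x_* )\mathbb{R}^d+\big(\mathrm{lin}\,T_{\mathbb{S}^l_-}(G_0(x_* ))\times\{0\}\big)=Y$, where $T$ is the contingent cone and $\mathrm{lin}$ is the largest linear subspace contained in a convex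 cone (nondegeneracy implies that there is exactly one $\lambda_*$ such that $(x_*,\lambda_* )$ is a KKT-pair). A KKT-pair $(x_*,\lambda_* )$ satisfies the second order sufficient optimality condition if $\langle v,D^2_{xx}L(x_*,\lambda_* )v\rangle-\sup\{\langle\lambda_*,w\rangle\mid w\in T_K^2(G(x_* ),DG(x_* )v)\}>0$ for all $v\ne 0$ with $DG(x_* )v\in T_K(G(x_* ))$ and $\langle\lambda_*,DG(x_* )v\rangle=0$, where $T^2_K(y,u)=\{w\mid\exists t_n\downarrow 0:\ \mathrm{dist}(y+t_nu+\tfrac12t_n^2w,K)=o(t_n^2)\}$. Fix $\alpha>0$, $\varkappa>1$, and define $a(x)=\alpha-\big(\mathrm{Tr}([G_0(x)]_+^2)\big)^{\varkappa}$, $b(x)=\alpha-\|h(x)\|^2$, $p(x,\lambda)=a(x)/(1+\mathrm{Tr}(\lambda_0^2))$, $q(x,\lambda)=b(x)/(1+\|\mu\|^2)$, $\Omega_\alpha=\{x\in\mathbb{R}^d\mid a(x)>0,\ b(x)>0\}$, $\eta(x,\lambda)=\|D_xL(x,\lambda)\|^2+\mathrm{Tr}(\lambda_0^2G_0(x)^2)$. For $x\in\Omega_\alpha$, $\lambda\in Y^*$, $c>0$ let $$\mathscr{L}_e(x,\lambda,c)=f(x)+\frac{1}{2c\,p(x,\lambda)}\Big(\mathrm{Tr}\big([cG_0(x)+p(x,\lambda)\lambda_0]_+^2\big)-p(x,\lambda)^2\mathrm{Tr}(\lambda_0^2)\Big)+\langle\mu,h(x)\rangle+\frac{c}{2q(x,\lambda)}\|h(x)\|^2+\eta(x,\lambda),$$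 and $\mathscr{L}_e(x,\lambda,c)=+\infty$ for $x\notin\Omega_\alpha$. Globally exact (with respect to $\eta$): there is $c_0>0$ such that for any $c\ge c_0$ the function $\mathscr{L}_e(\cdot,\cdot,c)$ attains a global minimum on $\mathbb{R}^d\times Y^*$, and $(x_*,\lambda_* )$ is a global minimizer if and only if $x_*\in\Omega_*$ and $\eta(x_*,\lambda_* )=0$. *)

theory Defs
  imports "HOL-Analysis.Analysis" "HOL-Library.Landau_Symbols"
begin

definition C2_fun :: "('a::real_normed_vector \<Rightarrow> 'b::real_normed_vector) \<Rightarrow> bool" where
  "C2_fun g \<longleftrightarrow> (\<exists>(g' :: 'a \<Rightarrow> 'a \<Rightarrow>\<^sub>L 'b) (g'' :: 'a \<Rightarrow> 'a \<Rightarrow>\<^sub>L 'a \<Rightarrow>\<^sub>L 'b).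
     (\<forall>x. (g has_derivative blinfun_apply (g' x)) (at x)) \<and>
     (\<forall>x. (g' has_derivative blinfun_apply (g'' x)) (at x)) \<and>
     continuous_on UNIV g'')"

definition gradient :: "(real^'d \<Rightarrow> real) \<Rightarrow> real^'d \<Rightarrow> real^'d" where
  "gradient g x = (\<chi> i. frechet_derivative g (at x) (axis i 1))"

text \<open>Symmetric matrices are treated as a subspace of \<^typ>\<open>real^'l^'l\<close>. The norm of that type is the
  Frobenius norm, i.e. the one induced on symmetric matrices by the inner product
  \<open>trace (A ** B)\<close>, so that the library notions of distance, convergence and
  projection are the intended ones.\<close>

definition sym_mats :: "(real^'l^'l) set" where
  "sym_mats = {A. transpose A = A}"

definition psd_cone :: "(real^'l^'l) set" where
  "psd_cone = {A \<in> sym_mats. \<forall>v. 0 \<le> v \<bullet> (A *v v)}"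

definition nsd_cone :: "(real^'l^'l) set" where
  "nsd_cone = {A \<in> sym_mats. \<forall>v. v \<bullet> (A *v v) \<le> 0}"

definition psd_part :: "real^'l^'l \<Rightarrow> real^'l^'l" where
  "psd_part A = closest_point psd_cone A"

definition Y_space :: "((real^'l^'l) \<times> (real^'s)) set" where
  "Y_space = sym_mats \<times> UNIV"

definition K_cone :: "((real^'l^'l) \<times> (real^'s)) set" where
  "K_cone = nsd_cone \<times> {0}"

definition K_dual :: "((real^'l^'l) \<times> (real^'s)) set" where
  "K_dual = psd_cone \<times> UNIV"

definition pairing :: "(real^'l^'l) \<times> (real^'s) \<Rightarrow> (real^'l^'l) \<times> (real^'s) \<Rightarrow> real" where
  "pairing lam y = trace (fst lam ** fst y) + snd lam \<bullet> snd y"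

text \<open>\<open>t\<^sub>n \<down> 0\<close> is read as positive and tending to zero; passing to a
  subsequence shows that requiring monotonicity would not change the cones below.\<close>

definition contingent_cone :: "'a::real_normed_vector set \<Rightarrow> 'a \<Rightarrow> 'a set" where
  "contingent_cone C y = {u. \<exists>(t :: nat \<Rightarrow> real) w. (\<forall>n. 0 < t n) \<and> t \<longlonglongrightarrow> 0 \<and>
     w \<longlonglongrightarrow> u \<and> (\<forall>n. y + t n *\<^sub>R w n \<in> C)}"

text \<open>If \<open>y\<close> and \<open>u\<close> lie in a closed subspace containing \<open>C\<close>, so does every \<open>w\<close> below;
  hence for \<open>C = K_cone\<close> nothing outside \<open>Y_space\<close> is added.\<close>

definition second_order_tangent_set ::
  "'a::real_normed_vector set \<Rightarrow> 'a \<Rightarrow> 'a \<Rightarrow> 'a set" where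
  "second_order_tangent_set C y u = {w. \<exists>t :: nat \<Rightarrow> real. (\<forall>n. 0 < t n) \<and> t \<longlonglongrightarrow> 0 \<and>
     (\<lambda>n. infdist (y + t n *\<^sub>R u + ((t n)\<^sup>2 / 2) *\<^sub>R w) C) \<in> o(\<lambda>n. (t n)\<^sup>2)}"

definition lineality :: "'a::real_vector set \<Rightarrow> 'a set" where
  "lineality C = (GREATEST V. subspace V \<and> V \<subseteq> C)"

lemma lineality_eq:
  assumes "convex_cone C"
  shows "lineality C = C \<inter> uminus ` C"
  unfolding lineality_def
proof (rule Greatest_equality)
  have "0 \<in> C" and add: "\<And>x y. x \<in> C \<Longrightarrow> y \<in> C \<Longrightarrow> x + y \<in> C"
    and sc: "\<And>c x. 0 \<le> c \<Longrightarrow> x \<in> C \<Longrightarrow> c *\<^sub>R x \<in> C"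
    using assms by (auto simp: convex_cone_iff)
  show "subspace (C \<inter> uminus ` C) \<and> C \<inter> uminus ` C \<subseteq> C"
  proof (intro conjI subspaceI)
    show "0 \<in> C \<inter> uminus ` C"
      using \<open>0 \<in> C\<close> by force
    show "x + y \<in> C \<inter> uminus ` C" if "x \<in> C \<inter> uminus ` C" "y \<in> C \<inter> uminus ` C" for x y
    proof -
      have "- x \<in> C" "- y \<in> C"
        using that by auto
      then have "- (x + y) \<in> C"
        using add[of "- x" "- y"] by simp
      then show ?thesis
        using that add by (auto simp: image_iff intro!: bexI[of _ "- (x + y)"])
    qed
    show "c *\<^sub>R x \<in> C \<inter> uminus ` C" if "x \<in> C \<inter> uminus ` C" for c x
    proof -
      have x: "x \<in> C" "- x \<in> C"
        using that by auto
      have "c *\<^sub>R x \<in> C" "- (c *\<^sub>R x) \<in> C"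
        using sc[of c x] sc[of c "- x"] sc[of "- c" x] sc[of "- c" "- x"] x
        by (cases "0 \<le> c"; simp)+
      then show ?thesis
        by (auto simp: image_iff intro!: bexI[of _ "- (c *\<^sub>R x)"])
    qed
  qed simp
next
  fix V assume V: "subspace V \<and> V \<subseteq> C"
  show "V \<subseteq> C \<inter> uminus ` C"
  proof
    fix x assume "x \<in> V"
    then have "x \<in> C" "- x \<in> C"
      using V subspace_neg by auto
    then show "x \<in> C \<inter> uminus ` C"
      by (auto simp: image_iff intro!: bexI[of _ "- x"])
  qed
qed

definition G_map :: "(real^'d \<Rightarrow> real^'l^'l) \<Rightarrow> (real^'d \<Rightarrow> real^'s) \<Rightarrow>
    real^'d \<Rightarrow> (real^'l^'l) \<times> (real^'s)" where
  "G_map G0 h x = (G0 x, h x)"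

definition DG :: "(real^'d \<Rightarrow> real^'l^'l) \<Rightarrow> (real^'d \<Rightarrow> real^'s) \<Rightarrow>
    real^'d \<Rightarrow> real^'d \<Rightarrow> (real^'l^'l) \<times> (real^'s)" where
  "DG G0 h x = frechet_derivative (G_map G0 h) (at x)"

definition feasible :: "(real^'d \<Rightarrow> real^'l^'l) \<Rightarrow> (real^'d \<Rightarrow> real^'s) \<Rightarrow> (real^'d) set" where
  "feasible G0 h = {x. G_map G0 h x \<in> K_cone}"

definition global_solutions :: "(real^'d \<Rightarrow> real) \<Rightarrow> (real^'d \<Rightarrow> real^'l^'l) \<Rightarrow>
    (real^'d \<Rightarrow> real^'s) \<Rightarrow> (real^'d) set" where
  "global_solutions f G0 h = {x. is_arg_min f (\<lambda>y. y \<in> feasible G0 h) x}"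

definition optimal_value :: "(real^'d \<Rightarrow> real) \<Rightarrow> (real^'d \<Rightarrow> real^'l^'l) \<Rightarrow>
    (real^'d \<Rightarrow> real^'s) \<Rightarrow> real" where
  "optimal_value f G0 h = (INF x \<in> feasible G0 h. f x)"

definition Lagr :: "(real^'d \<Rightarrow> real) \<Rightarrow> (real^'d \<Rightarrow> real^'l^'l) \<Rightarrow> (real^'d \<Rightarrow> real^'s) \<Rightarrow>
    real^'d \<Rightarrow> (real^'l^'l) \<times> (real^'s) \<Rightarrow> real" where
  "Lagr f G0 h x lam = f x + trace (fst lam ** G0 x) + snd lam \<bullet> h x"

definition DxL :: "(real^'d \<Rightarrow> real) \<Rightarrow> (real^'d \<Rightarrow> real^'l^'l) \<Rightarrow> (real^'d \<Rightarrow> real^'s) \<Rightarrow>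
    real^'d \<Rightarrow> (real^'l^'l) \<times> (real^'s) \<Rightarrow> real^'d" where
  "DxL f G0 h x lam = gradient (\<lambda>y. Lagr f G0 h y lam) x"

definition DxxL :: "(real^'d \<Rightarrow> real) \<Rightarrow> (real^'d \<Rightarrow> real^'l^'l) \<Rightarrow> (real^'d \<Rightarrow> real^'s) \<Rightarrow>
    real^'d \<Rightarrow> (real^'l^'l) \<times> (real^'s) \<Rightarrow> real^'d \<Rightarrow> real^'d" where
  "DxxL f G0 h x lam = frechet_derivative (\<lambda>y. DxL f G0 h y lam) (at x)"

definition KKT_pair :: "(real^'d \<Rightarrow> real) \<Rightarrow> (real^'d \<Rightarrow> real^'l^'l) \<Rightarrow> (real^'d \<Rightarrow> real^'s) \<Rightarrow>
    real^'d \<Rightarrow> (real^'l^'l) \<times> (real^'s) \<Rightarrow> bool" where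
  "KKT_pair f G0 h x lam \<longleftrightarrow> G_map G0 h x \<in> K_cone \<and> lam \<in> K_dual \<and>
     pairing lam (G_map G0 h x) = 0 \<and> DxL f G0 h x lam = 0"

definition nondegenerate :: "(real^'d \<Rightarrow> real^'l^'l) \<Rightarrow> (real^'d \<Rightarrow> real^'s) \<Rightarrow>
    real^'d \<Rightarrow> bool" where
  "nondegenerate G0 h x \<longleftrightarrow>
     {u + w | u w. u \<in> range (DG G0 h x) \<and>
                   w \<in> lineality (contingent_cone nsd_cone (G0 x)) \<times> {0}} = Y_space"

text \<open>The supremum is taken in \<^typ>\<open>ereal\<close>, so that it is \<open>-\<infinity>\<close> over the empty set and
  \<open>\<infinity>\<close> when unbounded.\<close>

definition second_order_sufficient :: "(real^'d \<Rightarrow> real) \<Rightarrow> (real^'d \<Rightarrow> real^'l^'l) \<Rightarrow>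
    (real^'d \<Rightarrow> real^'s) \<Rightarrow> real^'d \<Rightarrow> (real^'l^'l) \<times> (real^'s) \<Rightarrow> bool" where
  "second_order_sufficient f G0 h x lam \<longleftrightarrow>
     (\<forall>v. v \<noteq> 0 \<and> DG G0 h x v \<in> contingent_cone K_cone (G_map G0 h x) \<and>
          pairing lam (DG G0 h x v) = 0 \<longrightarrow>
        ereal (v \<bullet> DxxL f G0 h x lam v) -
          (SUP w \<in> second_order_tangent_set K_cone (G_map G0 h x) (DG G0 h x v).
             ereal (pairing lam w)) > 0)"

definition a_fun :: "(real^'d \<Rightarrow> real^'l^'l) \<Rightarrow> real \<Rightarrow> real \<Rightarrow> real^'d \<Rightarrow> real" where
  "a_fun G0 \<alpha> \<kappa> x = \<alpha> - (trace (psd_part (G0 x) ** psd_part (G0 x))) powr \<kappa>"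

definition b_fun :: "(real^'d \<Rightarrow> real^'s) \<Rightarrow> real \<Rightarrow> real^'d \<Rightarrow> real" where
  "b_fun h \<alpha> x = \<alpha> - (norm (h x))\<^sup>2"

definition p_fun :: "(real^'d \<Rightarrow> real^'l^'l) \<Rightarrow> real \<Rightarrow> real \<Rightarrow> real^'d \<Rightarrow>
    (real^'l^'l) \<times> (real^'s) \<Rightarrow> real" where
  "p_fun G0 \<alpha> \<kappa> x lam = a_fun G0 \<alpha> \<kappa> x / (1 + trace (fst lam ** fst lam))"

definition q_fun :: "(real^'d \<Rightarrow> real^'s) \<Rightarrow> real \<Rightarrow> real^'d \<Rightarrow>
    (real^'l^'l) \<times> (real^'s) \<Rightarrow> real" where
  "q_fun h \<alpha> x lam = b_fun h \<alpha> x / (1 + (norm (snd lam))\<^sup>2)"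

definition Omega_alpha :: "(real^'d \<Rightarrow> real^'l^'l) \<Rightarrow> (real^'d \<Rightarrow> real^'s) \<Rightarrow> real \<Rightarrow> real \<Rightarrow>
    (real^'d) set" where
  "Omega_alpha G0 h \<alpha> \<kappa> = {x. a_fun G0 \<alpha> \<kappa> x > 0 \<and> b_fun h \<alpha> x > 0}"

definition eta :: "(real^'d \<Rightarrow> real) \<Rightarrow> (real^'d \<Rightarrow> real^'l^'l) \<Rightarrow> (real^'d \<Rightarrow> real^'s) \<Rightarrow>
    real^'d \<Rightarrow> (real^'l^'l) \<times> (real^'s) \<Rightarrow> real" where
  "eta f G0 h x lam = (norm (DxL f G0 h x lam))\<^sup>2 + trace ((fst lam ** fst lam) ** (G0 x ** G0 x))"

definition pen_aug_Lagr :: "(real^'d \<Rightarrow> real) \<Rightarrow> (real^'d \<Rightarrow> real^'l^'l) \<Rightarrow>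
    (real^'d \<Rightarrow> real^'s) \<Rightarrow> real \<Rightarrow> real \<Rightarrow>
    real^'d \<Rightarrow> (real^'l^'l) \<times> (real^'s) \<Rightarrow> real \<Rightarrow> ereal" where
  "pen_aug_Lagr f G0 h \<alpha> \<kappa> x lam c =
     (if x \<in> Omega_alpha G0 h \<alpha> \<kappa> then
        (let p = p_fun G0 \<alpha> \<kappa> x lam; q = q_fun h \<alpha> x lam;
             P = psd_part (c *\<^sub>R G0 x + p *\<^sub>R fst lam)
         in ereal (f x + 1 / (2 * c * p) * (trace (P ** P) - p\<^sup>2 * trace (fst lam ** fst lam))
              + snd lam \<bullet> h x + c / (2 * q) * (norm (h x))\<^sup>2 + eta f G0 h x lam))
      else \<infinity>)"

definition global_minimizer :: "(real^'d \<Rightarrow> real) \<Rightarrow> (real^'d \<Rightarrow> real^'l^'l) \<Rightarrow>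
    (real^'d \<Rightarrow> real^'s) \<Rightarrow> real \<Rightarrow> real \<Rightarrow> real \<Rightarrow>
    real^'d \<Rightarrow> (real^'l^'l) \<times> (real^'s) \<Rightarrow> bool" where
  "global_minimizer f G0 h \<alpha> \<kappa> c x lam \<longleftrightarrow>
     is_arg_min (\<lambda>(y, \<nu>). pen_aug_Lagr f G0 h \<alpha> \<kappa> y \<nu> c) (\<lambda>(y, \<nu>). \<nu> \<in> Y_space) (x, lam)"

definition globally_exact :: "(real^'d \<Rightarrow> real) \<Rightarrow> (real^'d \<Rightarrow> real^'l^'l) \<Rightarrow>
    (real^'d \<Rightarrow> real^'s) \<Rightarrow> real \<Rightarrow> real \<Rightarrow> bool" where
  "globally_exact f G0 h \<alpha> \<kappa> \<longleftrightarrow>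
     (\<exists>c0>0. \<forall>c\<ge>c0.
        (\<exists>x lam. global_minimizer f G0 h \<alpha> \<kappa> c x lam) \<and>
        (\<forall>x. \<forall>lam\<in>Y_space. global_minimizer f G0 h \<alpha> \<kappa> c x lam \<longleftrightarrow>
           x \<in> global_solutions f G0 h \<and> eta f G0 h x lam = 0))"

end

theory Submission
  imports Defs
begin

text \<open>Write the augmented Lagrangian as a minimum over a slack matrix \<open>Z\<close> in the negative
  semidefinite cone, so that it becomes
  \<open>f x + \<langle>\<lambda>, G x - (Z, 0)\<rangle> + c / (2 p) \<parallel>G0 x - Z\<parallel>\<^sup>2 + c / (2 q) \<parallel>h x\<parallel>\<^sup>2 + \<eta>\<close>. It grows with \<open>c\<close>, and global exactness
  amounts to the emptiness of the set where it is below the optimal value, for some \<open>c\<close>. If these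
  sets stay nonempty, they contain points \<open>(x\<^sub>n, \<lambda>\<^sub>n)\<close> for \<open>c\<^sub>n \<rightarrow> \<infinity>\<close>. Since \<open>p \<parallel>\<lambda>\<^sub>0\<parallel>\<^sup>2\<close> and \<open>q \<parallel>\<mu>\<parallel>\<^sup>2\<close> are at
  most \<open>\<alpha>\<close>, the multiplier terms cost at most \<open>2 \<alpha> / c\<^sub>n\<close>; hence if \<open>x\<^sub>n\<close> is bounded, it clusters at
  an optimal solution \<open>z\<close>, with multiplier \<open>\<lambda>\<^sub>*\<close>. Nondegeneracy makes \<open>\<eta>\<close> control the distance of \<open>\<lambda>\<^sub>n\<close> to
  \<open>\<lambda>\<^sub>*\<close>, up to terms of the order of \<open>x\<^sub>n - z\<close>, so that \<open>\<lambda>\<^sub>n\<close> may be replaced by \<open>\<lambda>\<^sub>*\<close> at a cost \<open>o(\<parallel>x\<^sub>n - z\<parallel>\<^sup>2)\<close>.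
  A second order expansion along the limiting direction of \<open>x\<^sub>n - z\<close>, in which the slack \<open>Z\<close> contributes
  exactly the curvature of the cone, then contradicts the second order sufficient condition.\<close>

section \<open>Semidefinite matrices\<close>

text \<open>The squared norm of \<open>psd_part\<close> is in general not twice differentiable, so
  \<open>pen\<close> has no second order expansion; with the slack kept as an independent sequence,
  only smooth functions are expanded. Two more obstacles shape the estimates. First, only the points
  are assumed bounded, not the multipliers: bounds on \<open>T\<close> must be uniform in the
  multiplier, and half of the quadratic penalty is spent, by Young's inequality, on the term linear
  in the multiplier difference. The cost is a vanishing multiple of \<open>eta\<close> at the
  current multiplier, absorbed by the \<open>eta\<close> already present, plus the same multiple of
  \<open>eta\<close> at the KKT multiplier, which is quadratic in the distance to the solution.
  Second, \<open>eta\<close> does not see the sign of the matrix multiplier. Its zero at a solution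
  is unique by nondegeneracy, but that this zero has the right sign follows only from the existence
  of a KKT pair, which therefore has to be proved. Conversely, once no value lies below the optimal
  one, the strict growth of the penalty in \<open>c\<close> forces minimizers for larger
  \<open>c\<close> to be feasible.\<close>

lemma sym_mats_inner:
  assumes "A \<in> sym_mats"
  shows "(A *v x) \<bullet> y = x \<bullet> (A *v y)"
  using assms dot_lmul_matrix[of x A y] transpose_matrix_vector[of A x]
  by (simp add: sym_mats_def)

lemma sym_matsI:
  assumes "\<And>x y. (A *v x) \<bullet> y = x \<bullet> (A *v y)"
  shows "A \<in> sym_mats"
proof -
  have "transpose A *v x = A *v x" for x
    by (rule vector_eq_ldot[THEN iffD1])
      (metis assms dot_lmul_matrix inner_commute transpose_matrix_vector)
  then have "transpose A = A"
    by (simp add: matrix_eq)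
  then show ?thesis
    by (simp add: sym_mats_def)
qed

lemma subspace_sym_mats: "subspace sym_mats"
  unfolding subspace_def sym_mats_def
  by (auto simp: transpose_def vec_eq_iff)

lemma trace_mult_sym:
  fixes A B :: "real^'n^'n"
  assumes "A \<in> sym_mats"
  shows "trace (A ** B) = A \<bullet> B"
proof -
  have A: "A $ i $ k = A $ k $ i" for i k
    using assms by (auto simp: sym_mats_def transpose_def vec_eq_iff)
  have "trace (A ** B) = (\<Sum>i\<in>UNIV. \<Sum>k\<in>UNIV. A $ k $ i * B $ k $ i)"
    unfolding trace_def matrix_matrix_mult_def by (simp add: A)
  also have "\<dots> = A \<bullet> B"
    unfolding inner_vec_def by (subst sum.swap) simp
  finally show ?thesis .
qed

section \<open>Spectral decomposition of symmetric matrices\<close>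

lemma psd_formD:
  fixes A :: "real^'n^'n"
  assumes A: "A \<in> sym_mats" and S: "subspace S"
    and pos: "\<And>w. w \<in> S \<Longrightarrow> 0 \<le> w \<bullet> (A *v w)"
    and v: "v \<in> S" "v \<bullet> (A *v v) = 0" and w: "w \<in> S"
  shows "w \<bullet> (A *v v) = 0"
proof (rule ccontr)
  assume nz: "w \<bullet> (A *v v) \<noteq> 0"
  define s where "s = w \<bullet> (A *v v)"
  define r where "r = w \<bullet> (A *v w)"
  have r: "0 \<le> r" using pos w r_def by auto
  \<comment> \<open>Up to the 1 that keeps the denominator positive when \<open>r = 0\<close>, this
    is the minimizer of the quadratic \<open>2 * t * s + t\<^sup>2 * r\<close>, which is negative
    there.\<close>
  define t where "t = - s / (1 + r)"
  have "v + t *\<^sub>R w \<in> S"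
    using S v w by (simp add: subspace_add subspace_scale)
  then have "0 \<le> (v + t *\<^sub>R w) \<bullet> (A *v (v + t *\<^sub>R w))"
    by (rule pos)
  also have "\<dots> = 2 * t * s + t\<^sup>2 * r"
    using v sym_mats_inner[OF A, of w v] sym_mats_inner[OF A, of v w]
    by (simp add: matrix_vector_right_distrib scaleR_matrix_vector_assoc[symmetric]
        matrix_vector_mult_scaleR inner_add inner_commute s_def r_def power2_eq_square algebra_simps)
  also have "\<dots> = (s\<^sup>2 / (1 + r)) * (r / (1 + r) - 2)"
  proof -
    have "2 * t * s = - 2 * s\<^sup>2 / (1 + r)" "t\<^sup>2 * r = (s\<^sup>2 / (1 + r)) * (r / (1 + r))"
      by (simp_all add: t_def power2_eq_square)
    then show ?thesis by (simp add: right_diff_distrib diff_divide_distrib mult.commute)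
  qed
  also have "\<dots> < 0"
    using r nz by (intro mult_pos_neg) (auto simp: s_def field_simps)
  finally show False by simp
qed

text \<open>Induction on the dimension with the Rayleigh quotient: a maximizer of the quadratic form
  on the unit sphere of \<open>S\<close> is an eigenvector, and its orthogonal complement inside
  \<open>S\<close> is again invariant.\<close>

lemma sym_eigenbasis_subspace:
  fixes A :: "real^'n^'n"
  assumes A: "A \<in> sym_mats"
  shows "subspace S \<Longrightarrow> (\<And>x. x \<in> S \<Longrightarrow> A *v x \<in> S) \<Longrightarrow>
    \<exists>B ev. finite B \<and> pairwise orthogonal B \<and> (\<forall>b\<in>B. norm b = 1) \<and> span B = S \<and>
      (\<forall>b\<in>B. A *v b = ev b *\<^sub>R b)"
proof (induction "dim S" arbitrary: S rule: less_induct)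
  case less
  note S = less.prems(1) and inv = less.prems(2)
  show ?case
  proof (cases "S = {0}")
    case True
    then show ?thesis by (intro exI[of _ "{}"]) auto
  next
    case False
    have "compact (S \<inter> sphere 0 1)"
      using closed_subspace[OF S] by (simp add: closed_Int_compact)
    moreover obtain x where "x \<in> S" "x \<noteq> 0"
      using False S subspace_0 by blast
    then have "x /\<^sub>R norm x \<in> S \<inter> sphere 0 1"
      using S by (auto simp: subspace_scale)
    then have "S \<inter> sphere 0 1 \<noteq> {}" by blast
    moreover have "continuous_on (S \<inter> sphere 0 1) (\<lambda>v. v \<bullet> (A *v v))"
      by (intro continuous_intros linear_continuous_on matrix_vector_mul_bounded_linear)
    ultimately obtain v where vS: "v \<in> S \<inter> sphere 0 1"
      and vm: "\<forall>w\<in>S \<inter> sphere 0 1. w \<bullet> (A *v w) \<le> v \<bullet> (A *v v)"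
      using continuous_attains_sup[of "S \<inter> sphere 0 1" "\<lambda>v. v \<bullet> (A *v v)"] by blast
    have v: "v \<in> S" "norm v = 1" using vS by auto
    have vmax: "w \<bullet> (A *v w) \<le> v \<bullet> (A *v v)" if "w \<in> S" "norm w = 1" for w
      using vm that by auto
    define m where "m = v \<bullet> (A *v v)"
    \<comment> \<open>By maximality this form is nonnegative on \<open>S\<close> and
      \<open>v\<close> is a null vector of it, so \<open>psd_formD\<close> makes
      \<open>C *v v\<close> orthogonal to \<open>S\<close>; as it also lies in \<open>S\<close>, it
      vanishes.\<close>
    define C where "C = m *\<^sub>R mat 1 - A"
    have Cv: "C *v w = m *\<^sub>R w - A *v w" for w
      by (simp add: C_def matrix_vector_mult_diff_rdistrib scaleR_matrix_vector_assoc[symmetric])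
    have C: "C \<in> sym_mats"
      by (rule sym_matsI) (simp add: Cv inner_diff sym_mats_inner[OF A])
    have pos: "0 \<le> w \<bullet> (C *v w)" if "w \<in> S" for w
    proof (cases "w = 0")
      case False
      have "(w /\<^sub>R norm w) \<bullet> (A *v (w /\<^sub>R norm w)) \<le> m"
        unfolding m_def by (rule vmax) (use that S False in \<open>auto simp: subspace_scale\<close>)
      then have "w \<bullet> (A *v w) \<le> m * (norm w)\<^sup>2"
        using False by (simp add: matrix_vector_mult_scaleR field_simps power2_eq_square)
      then show ?thesis
        by (simp add: Cv inner_diff dot_square_norm)
    qed simp
    have "v \<bullet> (C *v v) = 0"
      using v by (simp add: Cv inner_diff m_def dot_square_norm)
    then have "w \<bullet> (C *v v) = 0" if "w \<in> S" for w
      using psd_formD[OF C S pos] v that by blast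
    moreover have "C *v v \<in> S"
      using v inv S by (simp add: Cv subspace_diff subspace_scale)
    ultimately have "C *v v = 0"
      using inner_eq_zero_iff by blast
    then have Av: "A *v v = m *\<^sub>R v" by (simp add: Cv)
    define S' where "S' = {x \<in> S. v \<bullet> x = 0}"
    have S': "subspace S'"
      using S unfolding S'_def subspace_def by (auto simp: inner_add)
    have inv': "A *v x \<in> S'" if "x \<in> S'" for x
      using that inv sym_mats_inner[OF A, of v x] by (auto simp: S'_def Av)
    have "v \<notin> S'" using v by (simp add: S'_def dot_square_norm)
    moreover have "S' \<subseteq> S" by (auto simp: S'_def)
    ultimately have "S' \<subset> S" using v(1) by blast
    then have "dim S' < dim S"
      using S S' dim_psubset span_eq_iff by metis
    from less.hyps[OF this S' inv'] obtain B ev where B: "finite B" "pairwise orthogonal B"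
      "\<forall>b\<in>B. norm b = 1" "span B = S'" "\<forall>b\<in>B. A *v b = ev b *\<^sub>R b" by blast
    have BS': "B \<subseteq> S'" using B(4) span_superset by blast
    have vB: "v \<notin> B" using BS' v by (auto simp: S'_def dot_square_norm)
    have orth: "pairwise orthogonal (insert v B)"
      unfolding pairwise_insert
      using B(2) BS' by (auto simp: S'_def orthogonal_def inner_commute)
    have "span (insert v B) = S"
    proof
      show "span (insert v B) \<subseteq> S"
        using S BS' v by (intro span_minimal) (auto simp: S'_def)
      show "S \<subseteq> span (insert v B)"
      proof
        fix x assume "x \<in> S"
        then have "x - (v \<bullet> x) *\<^sub>R v \<in> S'"
          using S v by (auto simp: S'_def subspace_diff subspace_scale inner_diff dot_square_norm)
        then have "x - (v \<bullet> x) *\<^sub>R v \<in> span B" by (simp add: B(4))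
        then show "x \<in> span (insert v B)"
          unfolding span_insert by blast
      qed
    qed
    then show ?thesis
      using B orth v Av vB
      by (intro exI[of _ "insert v B"] exI[of _ "ev(v := m)"]) auto
  qed
qed

theorem sym_eigenbasis:
  fixes A :: "real^'n^'n"
  assumes "A \<in> sym_mats"
  obtains B ev where "finite B" "pairwise orthogonal B" "\<And>b. b \<in> B \<Longrightarrow> norm b = 1"
    "span B = UNIV" "\<And>b. b \<in> B \<Longrightarrow> A *v b = ev b *\<^sub>R b"
  using sym_eigenbasis_subspace[OF assms, of UNIV] subspace_UNIV by (metis UNIV_I)

text \<open>The rank one matrix with range spanned by \<open>u\<close>. Its inner product with a
  matrix is a quadratic form, so spectral sums turn matrix inner products into weighted sums of
  quadratic forms.\<close>

definition outer :: "real^'n \<Rightarrow> real^'n^'n" where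
  "outer u = (\<chi> i j. u $ i * u $ j)"

lemma outer_mult_vec: "outer u *v x = (u \<bullet> x) *\<^sub>R u"
  by (simp add: vec_eq_iff outer_def matrix_vector_mult_def inner_vec_def sum_distrib_right
      sum_distrib_left mult_ac)

lemma outer_inner: "outer u \<bullet> Z = u \<bullet> (Z *v u)"
  by (simp add: outer_def matrix_vector_mult_def inner_vec_def sum_distrib_left mult_ac)

lemma matrix_vector_mult_sum_left:
  "finite I \<Longrightarrow> (\<Sum>i\<in>I. c i *\<^sub>R M i) *v x = (\<Sum>i\<in>I. c i *\<^sub>R (M i *v x))"
  for M :: "'i \<Rightarrow> real^'n^'m"
  by (induction I rule: finite_induct)
    (auto simp: matrix_vector_mult_add_rdistrib scaleR_matrix_vector_assoc[symmetric])

lemma eigenbasis_outer_sum: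
  fixes B :: "(real^'n) set"
  assumes B: "finite B" "pairwise orthogonal B" "\<And>b. b \<in> B \<Longrightarrow> norm b = 1" and b: "b \<in> B"
  shows "(\<Sum>b\<in>B. c b *\<^sub>R outer b) *v b = c b *\<^sub>R b"
proof -
  have "(\<Sum>b\<in>B. c b *\<^sub>R outer b) *v b = (\<Sum>a\<in>B. if a = b then c b *\<^sub>R b else 0)"
    unfolding matrix_vector_mult_sum_left[OF B(1)]
    using B b by (intro sum.cong refl)
      (auto simp: outer_mult_vec dot_square_norm pairwise_def orthogonal_def)
  then show ?thesis using B b by simp
qed

lemma matrix_vector_eq_on_spanning:
  fixes A C :: "real^'n^'m"
  assumes "span B = UNIV" "\<And>b. b \<in> B \<Longrightarrow> A *v b = C *v b"
  shows "A *v x = C *v x"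
  by (rule linear_eq_on_span[of "(*v) A" "(*v) C" B]) (use assms in auto)

text \<open>Nonnegativity of the eigenvalues is conditional, so that the same decomposition also
  serves symmetric multipliers of unknown sign.\<close>

lemma sym_decomposition:
  fixes A :: "real^'n^'n"
  assumes A: "A \<in> sym_mats"
  obtains B ev where "finite B" "\<And>b. A \<in> psd_cone \<Longrightarrow> b \<in> B \<Longrightarrow> 0 \<le> ev b"
    "\<And>b. b \<in> B \<Longrightarrow> A *v b = ev b *\<^sub>R b" "(\<Sum>b\<in>B. ev b *\<^sub>R outer b) = A"
    "\<And>Z. A \<bullet> Z = (\<Sum>b\<in>B. ev b * (b \<bullet> (Z *v b)))"
proof -
  obtain B ev where B: "finite B" "pairwise orthogonal B" "\<And>b. b \<in> B \<Longrightarrow> norm b = 1"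
    "span B = UNIV" "\<And>b. b \<in> B \<Longrightarrow> A *v b = ev b *\<^sub>R b"
    using sym_eigenbasis[OF A] by blast
  have ev: "0 \<le> ev b" if "A \<in> psd_cone" "b \<in> B" for b
  proof -
    have "0 \<le> b \<bullet> (A *v b)"
      using that(1) by (simp add: psd_cone_def)
    then show ?thesis
      using B(3,5)[OF that(2)] by (simp add: dot_square_norm)
  qed
  have eq: "A = (\<Sum>b\<in>B. ev b *\<^sub>R outer b)"
    using matrix_vector_eq_on_spanning[OF B(4), of A "\<Sum>b\<in>B. ev b *\<^sub>R outer b"]
      eigenbasis_outer_sum[OF B(1-3)] B(5) by (simp add: matrix_eq)
  have "A \<bullet> Z = (\<Sum>b\<in>B. ev b * (b \<bullet> (Z *v b)))" for Z
    by (subst eq) (simp add: inner_sum_left outer_inner)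
  with B(1,5) ev eq[symmetric] show ?thesis by (intro that)
qed

lemma sym_pseudoinverse:
  fixes G :: "real^'n^'n"
  assumes "G \<in> sym_mats"
  obtains M P where "M \<in> sym_mats" "P \<in> sym_mats" "\<And>y. M *v (G *v y) = y - P *v y"
    "\<And>y. P *v (M *v y) = 0" "\<And>y. G *v (P *v y) = 0"
proof -
  obtain B ev where B: "finite B" "pairwise orthogonal B" "\<And>b. b \<in> B \<Longrightarrow> norm b = 1"
    "span B = UNIV" "\<And>b. b \<in> B \<Longrightarrow> G *v b = ev b *\<^sub>R b"
    using sym_eigenbasis[OF assms] by blast
  \<comment> \<open>Functional calculus on the fixed eigenbasis: \<open>F c\<close> has the
    eigenvalue \<open>c b\<close> at \<open>b\<close>.\<close>
  define F where "F c = (\<Sum>b\<in>B. c b *\<^sub>R outer b)" for c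
  have F: "F c *v b = c b *\<^sub>R b" if "b \<in> B" for c b
    unfolding F_def by (rule eigenbasis_outer_sum[OF B(1-3) that])
  have sym: "F c \<in> sym_mats" for c
    by (rule sym_matsI)
      (simp add: F_def matrix_vector_mult_sum_left B(1) outer_mult_vec inner_sum_left
        inner_sum_right inner_commute mult_ac)
  \<comment> \<open>As \<open>inverse 0 = 0\<close>, \<open>M\<close> vanishes on the kernel of
    \<open>G\<close> and is the Moore-Penrose inverse; \<open>P\<close> is the projector onto that
    kernel.\<close>
  define M where "M = F (\<lambda>b. inverse (ev b))"
  define P where "P = F (\<lambda>b. if ev b = 0 then 1 else 0)"
  note eqI = matrix_vector_eq_on_spanning[OF B(4)]
  have 1: "M *v (G *v y) = y - P *v y" for y
    using eqI[of "M ** G" "mat 1 - P" y]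
    by (auto simp: M_def P_def F B(5) matrix_vector_mult_scaleR matrix_vector_mul_assoc[symmetric]
        matrix_vector_mult_diff_rdistrib)
  have 2: "P *v (M *v y) = 0" for y
    using eqI[of "P ** M" 0 y]
    by (auto simp: M_def P_def F B(5) matrix_vector_mult_scaleR matrix_vector_mul_assoc[symmetric])
  have 3: "G *v (P *v y) = 0" for y
    using eqI[of "G ** P" 0 y]
    by (auto simp: M_def P_def F B(5) matrix_vector_mult_scaleR matrix_vector_mul_assoc[symmetric])
  show ?thesis
    by (rule that[of M P]) (use 1 2 3 sym in \<open>auto simp: M_def P_def\<close>)
qed

section \<open>Polarity and complementarity of the two cones\<close>

lemma psd_inner_nsd:
  assumes "A \<in> psd_cone" "Z \<in> nsd_cone"
  shows "A \<bullet> Z \<le> 0"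
proof -
  have A: "A \<in> sym_mats" using assms(1) by (simp add: psd_cone_def)
  obtain B ev where "\<And>b. b \<in> B \<Longrightarrow> 0 \<le> ev b"
    "\<And>Z. A \<bullet> Z = (\<Sum>b\<in>B. ev b * (b \<bullet> (Z *v b)))"
    by (rule sym_decomposition[OF A]) (use assms(1) in blast)
  then show ?thesis
    using assms(2) by (auto simp: nsd_cone_def intro!: sum_nonpos mult_nonneg_nonpos)
qed

lemma uminus_nsd_iff: "- Z \<in> nsd_cone \<longleftrightarrow> Z \<in> psd_cone"
proof -
  have "(- Z) *v v = - (Z *v v)" for v
    using matrix_vector_mult_diff_rdistrib[of 0 Z v] by simp
  moreover have "- Z \<in> sym_mats \<longleftrightarrow> Z \<in> sym_mats"
    using subspace_neg[OF subspace_sym_mats] by (metis minus_minus)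
  ultimately show ?thesis
    by (simp add: nsd_cone_def psd_cone_def)
qed

lemma sym_mult_commute_zero:
  assumes "A \<in> sym_mats" "Z \<in> sym_mats" "A ** Z = 0"
  shows "Z ** A = 0"
  using assms unfolding sym_mats_def
  by (metis (mono_tags, lifting) matrix_transpose_mul mem_Collect_eq transpose_mat mat_0)

text \<open>In the spectral sum for \<open>A \<bullet> Z\<close> all summands have the same sign, so
  each is zero. An eigenvector \<open>b\<close> with nonzero eigenvalue is thus a null vector of the
  semidefinite form \<open>- Z\<close>, which gives \<open>Z *v b = 0\<close>. This links the scalar
  complementarity of KKT pairs with the matrix product inside \<open>eta\<close>.\<close>

lemma psd_nsd_complementary:
  assumes A: "A \<in> psd_cone" and Z: "Z \<in> nsd_cone" and "A \<bullet> Z = 0"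
  shows "A ** Z = 0"
proof -
  have As: "A \<in> sym_mats" using A by (simp add: psd_cone_def)
  obtain B ev where B: "finite B" "\<And>b. A \<in> psd_cone \<Longrightarrow> b \<in> B \<Longrightarrow> 0 \<le> ev b"
    "\<And>b. b \<in> B \<Longrightarrow> A *v b = ev b *\<^sub>R b" "(\<Sum>b\<in>B. ev b *\<^sub>R outer b) = A"
    "\<And>Z. A \<bullet> Z = (\<Sum>b\<in>B. ev b * (b \<bullet> (Z *v b)))"
    by (rule sym_decomposition[OF As]) (rule that)
  have Zs: "Z \<in> sym_mats" and Zn: "\<And>v. v \<bullet> (Z *v v) \<le> 0"
    using Z by (auto simp: nsd_cone_def)
  have Zn': "- Z \<in> sym_mats" "0 \<le> v \<bullet> ((- Z) *v v)" "(- Z) *v v = - (Z *v v)" for v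
    using Zn[of v] matrix_vector_mult_diff_rdistrib[of 0 Z v] subspace_neg[OF subspace_sym_mats Zs]
    by simp_all
  have "\<forall>b\<in>B. ev b * (b \<bullet> (Z *v b)) = 0"
    using sum_nonneg_eq_0_iff[OF B(1), of "\<lambda>b. - (ev b * (b \<bullet> (Z *v b)))"] assms(3) B(2)[OF A] B(5) Zn
    by (auto simp: mult_nonneg_nonpos sum_negf)
  then have *: "ev b = 0 \<or> Z *v b = 0" if "b \<in> B" for b
    using that psd_formD[OF Zn'(1) subspace_UNIV Zn'(2), of b "Z *v b"] Zn'(3) by auto
  have "A *v (Z *v x) = 0" for x
  proof -
    have "A *v (Z *v x) = (\<Sum>b\<in>B. ev b *\<^sub>R ((b \<bullet> (Z *v x)) *\<^sub>R b))"
      by (subst B(4)[symmetric]) (simp only: matrix_vector_mult_sum_left[OF B(1)] outer_mult_vec)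
    also have "\<dots> = 0"
      by (intro sum.neutral) (auto simp: sym_mats_inner[OF Zs, of _ x, symmetric] dest!: *)
    finally show ?thesis .
  qed
  then show ?thesis
    by (simp add: matrix_eq matrix_vector_mul_assoc[symmetric])
qed

section \<open>Closedness and convexity of the cones\<close>

lemma closed_sym_mats: "closed sym_mats"
  by (rule closed_subspace[OF subspace_sym_mats])

lemma bounded_linear_matrix_vector_mult_left: "bounded_linear (\<lambda>A::real^'n^'m. A *v x)"
  unfolding linear_conv_bounded_linear[symmetric]
  by (rule linearI) (simp_all add: matrix_vector_mult_add_rdistrib scaleR_matrix_vector_assoc)

lemma closed_psd_cone: "closed (psd_cone :: (real^'n^'n) set)"
proof -
  have eq: "psd_cone = sym_mats \<inter> (\<Inter>v. {A :: real^'n^'n. 0 \<le> v \<bullet> (A *v v)})"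
    by (auto simp: psd_cone_def)
  have "closed {A :: real^'n^'n. 0 \<le> v \<bullet> (A *v v)}" for v
    by (intro closed_Collect_le continuous_intros
        linear_continuous_on[OF bounded_linear_matrix_vector_mult_left])
  then show ?thesis
    unfolding eq by (intro closed_Int closed_INT ballI closed_sym_mats)
qed

lemma closed_nsd_cone: "closed (nsd_cone :: (real^'n^'n) set)"
proof -
  have eq: "nsd_cone = sym_mats \<inter> (\<Inter>v. {A :: real^'n^'n. v \<bullet> (A *v v) \<le> 0})"
    by (auto simp: nsd_cone_def)
  have "closed {A :: real^'n^'n. v \<bullet> (A *v v) \<le> 0}" for v
    by (intro closed_Collect_le continuous_intros
        linear_continuous_on[OF bounded_linear_matrix_vector_mult_left])
  then show ?thesis
    unfolding eq by (intro closed_Int closed_INT ballI closed_sym_mats)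
qed

lemma nsd_cone_add: "A \<in> nsd_cone \<Longrightarrow> B \<in> nsd_cone \<Longrightarrow> A + B \<in> nsd_cone"
  using subspace_add[OF subspace_sym_mats, of A B]
  by (auto simp: nsd_cone_def matrix_vector_mult_add_rdistrib inner_add intro: add_nonpos_nonpos)

lemma nsd_cone_scale: "A \<in> nsd_cone \<Longrightarrow> 0 \<le> c \<Longrightarrow> c *\<^sub>R A \<in> nsd_cone"
  using subspace_scale[OF subspace_sym_mats]
  by (auto simp: nsd_cone_def scaleR_matrix_vector_assoc[symmetric] mult_nonneg_nonpos)

lemma convex_nsd_cone: "convex nsd_cone"
  by (rule convexI) (simp add: nsd_cone_add nsd_cone_scale)

lemma psd_cone_add: "A \<in> psd_cone \<Longrightarrow> B \<in> psd_cone \<Longrightarrow> A + B \<in> psd_cone"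
  using nsd_cone_add[of "- A" "- B"] uminus_nsd_iff[of A] uminus_nsd_iff[of B] uminus_nsd_iff[of "A + B"]
  by simp

lemma psd_cone_scale: "A \<in> psd_cone \<Longrightarrow> 0 \<le> c \<Longrightarrow> c *\<^sub>R A \<in> psd_cone"
  using nsd_cone_scale[of "- A" c] uminus_nsd_iff[of A] uminus_nsd_iff[of "c *\<^sub>R A"]
  by simp

lemma zero_in_psd_cone: "0 \<in> psd_cone"
  using subspace_0[OF subspace_sym_mats] by (simp add: psd_cone_def)

lemma convex_psd_cone: "convex psd_cone"
  by (rule convexI) (simp add: psd_cone_add psd_cone_scale)

lemma outer_psd: "outer v \<in> psd_cone"
proof -
  have "outer v \<in> sym_mats"
    by (rule sym_matsI) (simp add: outer_mult_vec inner_commute)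
  then show ?thesis
    by (simp add: psd_cone_def outer_mult_vec inner_commute)
qed

section \<open>The projection onto the positive semidefinite cone\<close>

lemma psd_part_psd: "psd_part A \<in> psd_cone"
  unfolding psd_part_def
  using closest_point_in_set[OF closed_psd_cone] zero_in_psd_cone by auto

text \<open>Moreau's decomposition, from the variational inequality of the projection: testing with
  0 and with twice the projection gives the two signs needed for orthogonality.\<close>

lemma psd_part_orthogonal: "psd_part A \<bullet> (A - psd_part A) = 0"
  and psd_part_polar: "W \<in> psd_cone \<Longrightarrow> W \<bullet> (A - psd_part A) \<le> 0"
proof -
  have *: "(A - psd_part A) \<bullet> (W - psd_part A) \<le> 0" if "W \<in> psd_cone" for W
    unfolding psd_part_def by (rule closest_point_dot[OF convex_psd_cone closed_psd_cone that])
  show eq: "psd_part A \<bullet> (A - psd_part A) = 0"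
    using *[OF zero_in_psd_cone] *[OF psd_cone_scale[OF psd_part_psd[of A], of 2]]
    by (simp add: inner_commute inner_diff scaleR_2)
  show "W \<bullet> (A - psd_part A) \<le> 0" if "W \<in> psd_cone"
    using *[OF that] eq by (simp add: inner_diff_right inner_commute)
qed

text \<open>Rank one matrices as test elements turn the polar inequality into the sign of the
  quadratic form.\<close>

lemma psd_part_residual_nsd:
  assumes "A \<in> sym_mats"
  shows "A - psd_part A \<in> nsd_cone"
proof -
  have "A - psd_part A \<in> sym_mats"
    using assms psd_part_psd[of A] subspace_diff[OF subspace_sym_mats] by (auto simp: psd_cone_def)
  moreover have "v \<bullet> ((A - psd_part A) *v v) \<le> 0" for v
    using psd_part_polar[OF outer_psd, of v A] by (simp add: outer_inner)
  ultimately show ?thesis by (simp add: nsd_cone_def)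
qed

lemma psd_part_nsd: "A \<in> nsd_cone \<Longrightarrow> psd_part A = 0"
proof -
  assume "A \<in> nsd_cone"
  from psd_inner_nsd[OF psd_part_psd[of A] this]
  have "psd_part A \<bullet> psd_part A \<le> 0"
    using psd_part_orthogonal[of A] by (simp add: inner_diff)
  then show ?thesis
    using inner_eq_zero_iff inner_ge_zero order_antisym by blast
qed

lemma psd_part_zeroD: "A \<in> sym_mats \<Longrightarrow> psd_part A = 0 \<Longrightarrow> A \<in> nsd_cone"
  using psd_part_residual_nsd[of A] by simp

text \<open>The norm of the positive part is the distance to the negative cone. In
  \<open>A - Z = P + (N - Z)\<close> the cross term equals \<open>- (P \<bullet> Z)\<close>, which
  is nonnegative.\<close>

lemma psd_part_norm_le:
  assumes "A \<in> sym_mats" "Z \<in> nsd_cone"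
  shows "norm (psd_part A) \<le> norm (A - Z)"
proof -
  define P N where "P = psd_part A" and "N = A - psd_part A"
  have "P \<bullet> N = 0" and "P \<bullet> Z \<le> 0"
    using psd_part_orthogonal[of A] psd_inner_nsd[OF psd_part_psd assms(2)]
    by (auto simp: P_def N_def)
  then have "(norm (P + (N - Z)))\<^sup>2 \<ge> (norm P)\<^sup>2 + (norm (N - Z))\<^sup>2"
    by (simp add: power2_norm_eq_inner inner_add inner_diff inner_commute)
  then have "(norm P)\<^sup>2 \<le> (norm (P + (N - Z)))\<^sup>2"
    using zero_le_power2[of "norm (N - Z)"] by linarith
  then have "norm P \<le> norm (P + (N - Z))"
    by (simp add: power_mono_iff)
  then show ?thesis by (simp add: P_def N_def)
qed

lemma continuous_on_psd_part: "continuous_on S psd_part"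
  unfolding psd_part_def
  by (rule continuous_on_closest_point)
    (use convex_psd_cone closed_psd_cone zero_in_psd_cone in auto)

section \<open>Tangents of the negative semidefinite cone\<close>

lemma convex_cone_contingent_cone:
  assumes "convex C" "y \<in> C"
  shows "convex_cone (contingent_cone C y)"
proof -
  have zero: "0 \<in> contingent_cone C y"
    unfolding contingent_cone_def
    by (intro CollectI exI[of _ "\<lambda>n. inverse (real (Suc n))"] exI[of _ "\<lambda>_. 0"] conjI
        LIMSEQ_inverse_real_of_nat) (use assms in auto)
  show ?thesis
    unfolding convex_cone_iff
  proof (intro conjI ballI allI impI)
    show "0 \<in> contingent_cone C y" by (rule zero)
  next
    fix u u' assume "u \<in> contingent_cone C y" "u' \<in> contingent_cone C y"
    then obtain t w t' w' where t: "\<And>n::nat. 0 < t n" "t \<longlonglongrightarrow> 0" "w \<longlonglongrightarrow> u" "\<And>n. y + t n *\<^sub>R w n \<in> C"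
      and t': "\<And>n::nat. 0 < t' n" "t' \<longlonglongrightarrow> 0" "w' \<longlonglongrightarrow> u'" "\<And>n. y + t' n *\<^sub>R w' n \<in> C"
      unfolding contingent_cone_def by auto
    \<comment> \<open>The two sequences come with different step sizes. Convexity allows a step to
      be shortened, so both can use the smaller one; the midpoint of the two resulting points then
      has step \<open>s n / 2\<close>.\<close>
    define s where "s n = min (t n) (t' n)" for n
    have s: "0 < s n" for n using t t' by (simp add: s_def)
    have shrink: "y + r *\<^sub>R w \<in> C" if "y + q *\<^sub>R w \<in> C" "0 < r" "r \<le> q" for r q w
    proof -
      have "(1 - r/q) *\<^sub>R y + (r/q) *\<^sub>R (y + q *\<^sub>R w) \<in> C"
        using that assms by (intro convexD) auto
      then show ?thesis using that by (simp add: algebra_simps)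
    qed
    have "y + (s n / 2) *\<^sub>R (w n + w' n) \<in> C" for n
    proof -
      have "y + s n *\<^sub>R w n \<in> C" "y + s n *\<^sub>R w' n \<in> C"
        using shrink[OF t(4) s] shrink[OF t'(4) s] by (auto simp: s_def)
      then have "(1/2) *\<^sub>R (y + s n *\<^sub>R w n) + (1/2) *\<^sub>R (y + s n *\<^sub>R w' n) \<in> C"
        using assms by (intro convexD) auto
      moreover have "(1/2) *\<^sub>R (y + s n *\<^sub>R w n) + (1/2) *\<^sub>R (y + s n *\<^sub>R w' n)
          = ((1/2) *\<^sub>R y + (1/2) *\<^sub>R y) + (s n / 2) *\<^sub>R (w n + w' n)"
        by (simp add: scaleR_right_distrib)
      moreover have "(1/2) *\<^sub>R y + (1/2) *\<^sub>R y = y"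
        by (simp flip: scaleR_left_distrib)
      ultimately show ?thesis by simp
    qed
    moreover have "(\<lambda>n. s n / 2) \<longlonglongrightarrow> 0"
      using tendsto_min[OF t(2) t'(2)] tendsto_divide[of s 0 sequentially "\<lambda>_. 2" 2] by (simp add: s_def)
    moreover have "(\<lambda>n. w n + w' n) \<longlonglongrightarrow> u + u'"
      by (intro tendsto_add t t')
    ultimately show "u + u' \<in> contingent_cone C y"
      unfolding contingent_cone_def using s
      by (auto intro!: exI[of _ "\<lambda>n. s n / 2"] exI[of _ "\<lambda>n. w n + w' n"])
  next
    fix u and c :: real assume u: "u \<in> contingent_cone C y" and c: "c \<ge> 0"
    show "c *\<^sub>R u \<in> contingent_cone C y"
    proof (cases "c = 0")
      case True
      then show ?thesis using zero by simp
    next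
      case False
      then have c: "c > 0" using c by simp
      from u obtain t w where t: "\<And>n::nat. 0 < t n" "t \<longlonglongrightarrow> 0" "w \<longlonglongrightarrow> u" "\<And>n. y + t n *\<^sub>R w n \<in> C"
        unfolding contingent_cone_def by auto
      have "(\<lambda>n. t n / c) \<longlonglongrightarrow> 0"
        using tendsto_divide[OF t(2) tendsto_const[of c]] c by simp
      moreover have "(\<lambda>n. c *\<^sub>R w n) \<longlonglongrightarrow> c *\<^sub>R u"
        by (intro tendsto_intros t)
      ultimately show ?thesis
        unfolding contingent_cone_def using t c
        by (auto intro!: exI[of _ "\<lambda>n. t n / c"] exI[of _ "\<lambda>n. c *\<^sub>R w n"])
    qed
  qed
qed

lemma tendsto_mult_vec [tendsto_intros]:
  fixes A :: "'a \<Rightarrow> real^'n^'m"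
  assumes "(A \<longlongrightarrow> L) F"
  shows "((\<lambda>n. A n *v x) \<longlongrightarrow> L *v x) F"
  by (rule bounded_linear.tendsto[OF bounded_linear_matrix_vector_mult_left assms])

lemma contingent_cone_nsd_sym:
  assumes "G \<in> sym_mats" "W \<in> contingent_cone nsd_cone G"
  shows "W \<in> sym_mats"
proof -
  obtain t w where t: "\<And>n::nat. 0 < t n" "w \<longlonglongrightarrow> W" "\<And>n. G + t n *\<^sub>R w n \<in> nsd_cone"
    using assms(2) unfolding contingent_cone_def by auto
  have "w n \<in> sym_mats" for n
  proof -
    have "(1 / t n) *\<^sub>R ((G + t n *\<^sub>R w n) - G) \<in> sym_mats"
      using t(3)[of n] assms(1)
      by (intro subspace_scale subspace_diff subspace_sym_mats) (auto simp: nsd_cone_def)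
    then show ?thesis using t(1)[of n] by simp
  qed
  with t(2) show ?thesis
    using closed_sequentially[OF closed_sym_mats] by blast
qed

text \<open>On the kernel of \<open>G\<close> the quadratic form of a nearby cone element consists
  of the increment alone.\<close>

lemma contingent_cone_nsd_kernel:
  assumes "W \<in> contingent_cone nsd_cone G" "G *v u = 0"
  shows "u \<bullet> (W *v u) \<le> 0"
proof -
  obtain t w where t: "\<And>n::nat. 0 < t n" "w \<longlonglongrightarrow> W" "\<And>n. G + t n *\<^sub>R w n \<in> nsd_cone"
    using assms(1) unfolding contingent_cone_def by auto
  have "u \<bullet> (w n *v u) \<le> 0" for n
  proof -
    have "t n * (u \<bullet> (w n *v u)) \<le> 0"
      using t(3)[of n] assms(2)
      by (auto simp: nsd_cone_def matrix_vector_mult_add_rdistrib scaleR_matrix_vector_assoc[symmetric]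
          dest: spec[of _ u])
    then show ?thesis using t(1)[of n] by (simp add: mult_le_0_iff)
  qed
  moreover have "(\<lambda>n. u \<bullet> (w n *v u)) \<longlonglongrightarrow> u \<bullet> (W *v u)"
    by (intro tendsto_intros t)
  ultimately show ?thesis
    using LIMSEQ_le_const2 by blast
qed

text \<open>Eigenvectors of \<open>A\<close> with nonzero eigenvalue lie in the kernel of
  \<open>G\<close>, and there the quadratic form of \<open>W\<close> vanishes, because both
  \<open>W\<close> and \<open>- W\<close> are tangent.\<close>

lemma lineality_contingent_nsd_orthogonal:
  assumes G: "G \<in> nsd_cone" and lam: "A \<in> sym_mats" "A ** G = 0"
    and W: "W \<in> lineality (contingent_cone nsd_cone G)"
  shows "A \<bullet> W = 0"
proof -
  have W': "W \<in> contingent_cone nsd_cone G" "- W \<in> contingent_cone nsd_cone G"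
    using W lineality_eq[OF convex_cone_contingent_cone[OF convex_nsd_cone G]] by auto
  have "G ** A = 0"
    using sym_mult_commute_zero[OF lam(1) _ lam(2)] G by (simp add: nsd_cone_def)
  obtain B ev where B: "finite B" "\<And>b. A \<in> psd_cone \<Longrightarrow> b \<in> B \<Longrightarrow> 0 \<le> ev b"
    "\<And>b. b \<in> B \<Longrightarrow> A *v b = ev b *\<^sub>R b" "(\<Sum>b\<in>B. ev b *\<^sub>R outer b) = A"
    "\<And>Z. A \<bullet> Z = (\<Sum>b\<in>B. ev b * (b \<bullet> (Z *v b)))"
    by (rule sym_decomposition[OF lam(1)]) (rule that)
  have "ev b * (b \<bullet> (W *v b)) = 0" if "b \<in> B" for b
  proof (cases "ev b = 0")
    case False
    have "G *v (A *v b) = 0"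
      using \<open>G ** A = 0\<close> by (simp add: matrix_vector_mul_assoc)
    then have "G *v b = 0"
      using False by (simp add: B(3)[OF that] matrix_vector_mult_scaleR)
    from contingent_cone_nsd_kernel[OF W'(1) this] contingent_cone_nsd_kernel[OF W'(2) this]
    show ?thesis
      using matrix_vector_mult_diff_rdistrib[of 0 W b] by simp
  qed simp
  then show ?thesis
    unfolding B(5) by (intro sum.neutral) blast
qed

text \<open>The curvature of the cone: with \<open>M\<close> the pseudoinverse of \<open>G\<close>, the number \<open>s\<close> below is
  \<open>trace (A W M W)\<close>. The matrix \<open>w\<close> shows that it is attained on the second order tangent set,
  and the last clause says that it is the largest second order coefficient of \<open>A \<bullet> Z\<close>
  along curves in the cone which leave \<open>G\<close> in the direction \<open>W\<close>.\<close>

lemma nsd_cone_curvature: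
  fixes G W A :: "real^'n^'n"
  assumes G: "G \<in> nsd_cone" and A: "A \<in> psd_cone" "A ** G = 0"
    and W: "W \<in> contingent_cone nsd_cone G"
  obtains s w where
    "\<And>t. 0 \<le> t \<Longrightarrow> G + t *\<^sub>R W + (t\<^sup>2 / 2) *\<^sub>R w \<in> nsd_cone" "A \<bullet> w = 2 * s"
    "\<And>Z t. (\<And>n::nat. Z n \<in> nsd_cone) \<Longrightarrow> (\<And>n. 0 < t n) \<Longrightarrow> t \<longlonglongrightarrow> 0 \<Longrightarrow>
      (\<lambda>n. (Z n - G) /\<^sub>R t n) \<longlonglongrightarrow> W \<Longrightarrow> \<exists>e. e \<longlonglongrightarrow> s \<and> (\<forall>n. (A \<bullet> Z n) / (t n)\<^sup>2 \<le> e n)"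
proof -
  have Gs: "G \<in> sym_mats" and Gn: "\<And>v. v \<bullet> (G *v v) \<le> 0" and As: "A \<in> sym_mats"
    using G A by (auto simp: nsd_cone_def psd_cone_def)
  have Ws: "W \<in> sym_mats"
    by (rule contingent_cone_nsd_sym[OF Gs W])
  have GA: "G ** A = 0"
    by (rule sym_mult_commute_zero[OF As Gs A(2)])
  obtain B ev where B: "finite B" "\<And>b. A \<in> psd_cone \<Longrightarrow> b \<in> B \<Longrightarrow> 0 \<le> ev b"
    "\<And>b. b \<in> B \<Longrightarrow> A *v b = ev b *\<^sub>R b" "(\<Sum>b\<in>B. ev b *\<^sub>R outer b) = A"
    "\<And>Z. A \<bullet> Z = (\<Sum>b\<in>B. ev b * (b \<bullet> (Z *v b)))"
    by (rule sym_decomposition[OF As]) (rule that)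
  have ker: "ev b = 0 \<or> G *v b = 0" if "b \<in> B" for b
  proof -
    have "G *v (A *v b) = 0"
      using GA by (simp add: matrix_vector_mul_assoc)
    then show ?thesis
      by (simp add: B(3)[OF that] matrix_vector_mult_scaleR)
  qed
  obtain M P where M: "M \<in> sym_mats" "P \<in> sym_mats" and MG: "\<And>y. M *v (G *v y) = y - P *v y"
    and PM: "\<And>y. P *v (M *v y) = 0" and GP: "\<And>y. G *v (P *v y) = 0"
    by (rule sym_pseudoinverse[OF Gs]) (rule that)
  have Pker: "P *v u = u" if "G *v u = 0" for u
    using MG[of u] that by simp
  have GM: "u \<bullet> (G *v (M *v v)) = (u - P *v u) \<bullet> v" for u v
    using sym_mats_inner[OF Gs, of u "M *v v"] sym_mats_inner[OF M(1), of "G *v u" v] MG[of u]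
    by simp
  define m where "m b = M *v (W *v b)" for b
  have mGm: "m b \<bullet> (G *v m b) = m b \<bullet> (W *v b)" for b
    unfolding m_def GM by (simp add: PM)
  define s where "s = (\<Sum>b\<in>B. ev b * (m b \<bullet> (W *v b)))"
  \<comment> \<open>The congruence of \<open>G\<close> by \<open>1 + t X\<close> stays in the cone
    and equals \<open>G + t (X^T G + G X) + t^2 X^T G X\<close>. This \<open>X\<close> solves
    \<open>X^T G + G X = W - P W P\<close>; the factor 1/2 appears because both summands contribute
    the block of \<open>W\<close> on the range of \<open>G\<close>. The remainder
    \<open>t P W P\<close> is negative semidefinite by the kernel lemma, and \<open>w\<close> is
    twice the quadratic coefficient.\<close>
  define X where "X = M ** W ** (P + (1/2) *\<^sub>R (mat 1 - P))"
  have Xv: "X *v y = M *v (W *v (P *v y + (1/2) *\<^sub>R (y - P *v y)))" for y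
    by (simp add: X_def matrix_vector_mul_assoc[symmetric] matrix_vector_mult_add_rdistrib
        scaleR_matrix_vector_assoc[symmetric] matrix_vector_mult_diff_rdistrib)
  define w where "w = 2 *\<^sub>R (transpose X ** G ** X)"
  have wv: "u \<bullet> (w *v y) = 2 * ((X *v u) \<bullet> (G *v (X *v y)))" for u y
  proof -
    have "(transpose X *v z) \<bullet> u = z \<bullet> (X *v u)" for z
      by (simp add: dot_lmul_matrix)
    from this[of "G *v (X *v y)"] show ?thesis
      by (simp add: w_def scaleR_matrix_vector_assoc[symmetric] matrix_vector_mul_assoc[symmetric] inner_commute
          del: transpose_matrix_vector)
  qed
  have ws: "w \<in> sym_mats"
    by (rule sym_matsI) (metis wv inner_commute sym_mats_inner[OF Gs])
  have split: "y \<bullet> (W *v y) = 2 * (y \<bullet> (G *v (X *v y))) + (P *v y) \<bullet> (W *v (P *v y))" for y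
  proof -
    define p q where "p = P *v y" and "q = y - P *v y"
    have y: "y = p + q" by (simp add: p_def q_def)
    have "2 * (y \<bullet> (G *v (X *v y))) = 2 * (q \<bullet> (W *v (p + (1/2) *\<^sub>R q)))"
      by (simp add: Xv GM p_def q_def)
    also have "\<dots> = 2 * (q \<bullet> (W *v p)) + q \<bullet> (W *v q)"
      by (simp add: matrix_vector_right_distrib matrix_vector_mult_scaleR inner_add algebra_simps)
    finally show ?thesis
      unfolding p_def[symmetric]
      using sym_mats_inner[OF Ws, of p q]
      by (simp add: y matrix_vector_right_distrib inner_add inner_commute)
  qed
  show ?thesis
  proof (rule that)
    show "G + t *\<^sub>R W + (t\<^sup>2 / 2) *\<^sub>R w \<in> nsd_cone" if t: "0 \<le> t" for t
    proof -
      have "G + t *\<^sub>R W + (t\<^sup>2 / 2) *\<^sub>R w \<in> sym_mats"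
        using Gs Ws ws by (intro subspace_add subspace_scale subspace_sym_mats)
      moreover have "y \<bullet> ((G + t *\<^sub>R W + (t\<^sup>2 / 2) *\<^sub>R w) *v y) \<le> 0" for y
      proof -
        define x where "x = X *v y"
        have "y \<bullet> ((G + t *\<^sub>R W + (t\<^sup>2 / 2) *\<^sub>R w) *v y)
          = y \<bullet> (G *v y) + t * (y \<bullet> (W *v y)) + t\<^sup>2 * (x \<bullet> (G *v x))"
          by (simp add: matrix_vector_mult_add_rdistrib scaleR_matrix_vector_assoc[symmetric]
              inner_add wv x_def)
        also have "\<dots> = (y + t *\<^sub>R x) \<bullet> (G *v (y + t *\<^sub>R x)) + t * ((P *v y) \<bullet> (W *v (P *v y)))"
          using sym_mats_inner[OF Gs, of x y] split[of y]
          by (simp add: x_def[symmetric] matrix_vector_right_distrib matrix_vector_mult_scaleR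
              inner_add inner_commute power2_eq_square algebra_simps)
        also have "\<dots> \<le> 0"
          using Gn contingent_cone_nsd_kernel[OF W GP[of y]] t
          by (simp add: add_nonpos_nonpos mult_nonneg_nonpos)
        finally show ?thesis .
      qed
      ultimately show ?thesis by (simp add: nsd_cone_def)
    qed
    have "ev b * (b \<bullet> (w *v b)) = ev b * (2 * (m b \<bullet> (W *v b)))" if "b \<in> B" for b
    proof (cases "ev b = 0")
      case False
      then have "X *v b = m b"
        using ker[OF that] by (simp add: Xv Pker m_def)
      then show ?thesis by (simp add: wv mGm)
    qed simp
    then have "A \<bullet> w = (\<Sum>b\<in>B. ev b * (2 * (m b \<bullet> (W *v b))))"
      unfolding B(5) by (rule sum.cong[OF refl])
    then show "A \<bullet> w = 2 * s"
      by (simp add: s_def sum_distrib_left mult.left_commute)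
    show "\<exists>e. e \<longlonglongrightarrow> s \<and> (\<forall>n. (A \<bullet> Z n) / (t n)\<^sup>2 \<le> e n)"
      if Z: "\<And>n::nat. Z n \<in> nsd_cone" and t: "\<And>n. 0 < t n" and t0: "t \<longlonglongrightarrow> 0"
        and lim: "(\<lambda>n. (Z n - G) /\<^sub>R t n) \<longlonglongrightarrow> W" for Z t
    proof -
      define V where "V n = (Z n - G) /\<^sub>R t n" for n
      have V: "V \<longlonglongrightarrow> W" using lim by (simp add: V_def[abs_def])
      have Zeq: "Z n = G + t n *\<^sub>R V n" for n
        using t[of n] by (simp add: V_def)
      define e where "e n = (\<Sum>b\<in>B. ev b * (2 * (m b \<bullet> (V n *v b)) - m b \<bullet> (W *v b)
          - t n * (m b \<bullet> (V n *v m b))))" for n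
      have "e \<longlonglongrightarrow> (\<Sum>b\<in>B. ev b * (2 * (m b \<bullet> (W *v b)) - m b \<bullet> (W *v b) - 0 * (m b \<bullet> (W *v m b))))"
        unfolding e_def by (intro tendsto_intros V t0)
      then have "e \<longlonglongrightarrow> s" by (simp add: s_def)
      moreover have "(A \<bullet> Z n) / (t n)\<^sup>2 \<le> e n" for n
      proof -
        have Vs: "V n \<in> sym_mats"
          unfolding V_def using Z[of n] Gs
          by (intro subspace_scale subspace_diff subspace_sym_mats) (auto simp: nsd_cone_def)
        have "ev b * (b \<bullet> (Z n *v b)) / (t n)\<^sup>2 \<le> ev b * (2 * (m b \<bullet> (V n *v b)) - m b \<bullet> (W *v b)
          - t n * (m b \<bullet> (V n *v m b)))" if b: "b \<in> B" for b
        proof (cases "ev b = 0")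
          case False
          then have Gb: "G *v b = 0" using ker[OF b] by simp
          \<comment> \<open>The test vector of a Schur complement: among shifts \<open>x\<close> in
            the range of \<open>G\<close>, the choice \<open>- m b\<close> maximizes
            \<open>x \<bullet> (G *v x) + 2 * (x \<bullet> (W *v b))\<close>, hence gives the
            sharpest bound on the second order coefficient.\<close>
          define y where "y = b - t n *\<^sub>R m b"
          have ev: "0 \<le> ev b" using B(2) A b by blast
          have "0 \<ge> y \<bullet> (Z n *v y)"
            using Z[of n] by (simp add: nsd_cone_def)
          also have "y \<bullet> (Z n *v y) = y \<bullet> (G *v y) + t n * (y \<bullet> (V n *v y))"
            by (simp add: Zeq matrix_vector_mult_add_rdistrib scaleR_matrix_vector_assoc[symmetric]
              inner_add)
          also have "y \<bullet> (G *v y) = (t n)\<^sup>2 * (m b \<bullet> (W *v b))"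
            using sym_mats_inner[OF Gs, of b "m b"] mGm[of b]
            by (simp add: y_def Gb matrix_vector_mult_diff_distrib matrix_vector_mult_scaleR
              inner_diff power2_eq_square)
          also have "y \<bullet> (V n *v y) = b \<bullet> (V n *v b) - 2 * t n * (m b \<bullet> (V n *v b))
              + (t n)\<^sup>2 * (m b \<bullet> (V n *v m b))"
            using sym_mats_inner[OF Vs, of b "m b"]
            by (simp add: y_def matrix_vector_mult_diff_distrib matrix_vector_mult_scaleR
              inner_diff power2_eq_square inner_commute algebra_simps)
          finally have "t n * (b \<bullet> (V n *v b)) \<le> (t n)\<^sup>2 * (2 * (m b \<bullet> (V n *v b)) - m b \<bullet> (W *v b)
              - t n * (m b \<bullet> (V n *v m b)))"
            by (simp add: power2_eq_square algebra_simps)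
          moreover have "b \<bullet> (Z n *v b) = t n * (b \<bullet> (V n *v b))"
            by (simp add: Zeq matrix_vector_mult_add_rdistrib scaleR_matrix_vector_assoc[symmetric] Gb)
          ultimately have "(b \<bullet> (Z n *v b)) / (t n)\<^sup>2 \<le> 2 * (m b \<bullet> (V n *v b)) - m b \<bullet> (W *v b)
              - t n * (m b \<bullet> (V n *v m b))"
            using t[of n] by (simp add: pos_divide_le_eq mult.commute)
          from mult_left_mono[OF this ev] show ?thesis by simp
        qed simp
        then show ?thesis
          unfolding B(5) e_def sum_divide_distrib by (rule sum_mono)
      qed
      ultimately show ?thesis by blast
    qed
  qed
qed

section \<open>Derivatives and multipliers\<close>

text \<open>The directional derivative may be taken along moving directions. This is needed because
  the normalized differences of a sequence and its limit only converge.\<close>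

lemma has_derivative_sequentially:
  fixes \<phi> :: "'a::real_normed_vector \<Rightarrow> 'b::real_normed_vector"
  assumes D: "(\<phi> has_derivative D) (at x)" and t: "\<And>n::nat. 0 < t n" "t \<longlonglongrightarrow> 0" and v: "v \<longlonglongrightarrow> u"
  shows "(\<lambda>n. (\<phi> (x + t n *\<^sub>R v n) - \<phi> x) /\<^sub>R t n) \<longlonglongrightarrow> D u"
proof -
  have lin: "bounded_linear D" using D by (rule has_derivative_bounded_linear)
  \<comment> \<open>Division by zero gives \<open>r 0 = 0\<close>, so \<open>r\<close> is continuous
    at 0 and vanishing increments need no separate limit argument.\<close>
  define r where "r k = norm (\<phi> (x + k) - \<phi> x - D k) / norm k" for k
  have "r \<midarrow>0\<rightarrow> r 0"
    using D by (simp add: has_derivative_at r_def[abs_def])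
  moreover have tv: "(\<lambda>n. t n *\<^sub>R v n) \<longlonglongrightarrow> 0"
    using tendsto_scaleR[OF t(2) v] by simp
  ultimately have "(\<lambda>n. r (t n *\<^sub>R v n)) \<longlonglongrightarrow> r 0"
    by (intro isCont_tendsto_compose[of 0 r]) (simp_all add: isCont_def)
  then have lim: "(\<lambda>n. r (t n *\<^sub>R v n) * norm (v n)) \<longlonglongrightarrow> 0 * norm u"
    by (intro tendsto_mult tendsto_norm v) (simp add: r_def)
  have eq: "norm ((\<phi> (x + t n *\<^sub>R v n) - \<phi> x) /\<^sub>R t n - D (v n)) = r (t n *\<^sub>R v n) * norm (v n)" for n
  proof (cases "v n = 0")
    case False
    have "(\<phi> (x + t n *\<^sub>R v n) - \<phi> x) /\<^sub>R t n - D (v n)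
      = (\<phi> (x + t n *\<^sub>R v n) - \<phi> x - D (t n *\<^sub>R v n)) /\<^sub>R t n"
      using t(1)[of n] by (simp add: linear_cmul[OF bounded_linear.linear[OF lin]] scaleR_diff_right)
    then show ?thesis
      using False t(1)[of n] by (simp add: r_def divide_inverse)
  qed (simp add: linear_0[OF bounded_linear.linear[OF lin]])
  have "(\<lambda>n. (\<phi> (x + t n *\<^sub>R v n) - \<phi> x) /\<^sub>R t n - D (v n)) \<longlonglongrightarrow> 0"
    by (rule tendsto_norm_zero_cancel, unfold eq) (use lim in simp)
  from tendsto_add[OF this bounded_linear.tendsto[OF lin v]] show ?thesis by simp
qed

lemma C2_fun_has_derivative:
  assumes "C2_fun \<phi>"
  shows "(\<phi> has_derivative frechet_derivative \<phi> (at x)) (at x)"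
  using assms frechet_derivative_at unfolding C2_fun_def by metis

lemma C2_fun_derivative_differentiable:
  assumes "C2_fun \<phi>"
  shows "(\<lambda>x. frechet_derivative \<phi> (at x) v) differentiable (at x)"
proof -
  obtain g' g'' where g: "\<And>x. (\<phi> has_derivative blinfun_apply (g' x)) (at x)"
    "\<And>x. (g' has_derivative blinfun_apply (g'' x)) (at x)"
    using assms unfolding C2_fun_def by blast
  have "frechet_derivative \<phi> (at y) v = blinfun_apply (g' y) v" for y
    using frechet_derivative_at[OF g(1)] by metis
  moreover have "((\<lambda>y. blinfun_apply (g' y) v) has_derivative (\<lambda>k. blinfun_apply (g'' x k) v)) (at x)"
    by (rule bounded_linear.has_derivative[OF blinfun.bounded_linear_left g(2)])
  ultimately show ?thesis
    by (auto simp: differentiable_def)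
qed

lemma bounded_bilinear_matrix_mult:
  "bounded_bilinear ((**) :: real^'n^'m \<Rightarrow> real^'k^'n \<Rightarrow> real^'k^'m)"
  unfolding bilinear_conv_bounded_bilinear[symmetric] bilinear_def
  by (intro conjI allI linearI)
    (simp_all add: matrix_matrix_mult_def vec_eq_iff sum.distrib sum_distrib_left algebra_simps)

lemma subspace_Y_space: "subspace (Y_space :: ((real^'l^'l) \<times> (real^'s)) set)"
  unfolding Y_space_def by (intro subspace_Times subspace_sym_mats subspace_UNIV)

lemma closed_Y_space: "closed (Y_space :: ((real^'l^'l) \<times> (real^'s)) set)"
  by (rule closed_subspace[OF subspace_Y_space])

lemma Y_space_iff: "lam \<in> Y_space \<longleftrightarrow> fst lam \<in> sym_mats"
  by (cases lam) (simp add: Y_space_def)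

lemma pairing_inner: "lam \<in> Y_space \<Longrightarrow> pairing lam y = lam \<bullet> y"
  by (cases lam; cases y) (simp add: pairing_def Y_space_iff trace_mult_sym)

section \<open>Derivatives of the problem data and the residual behind \<open>eta\<close>\<close>

locale nlsdp =
  fixes f :: "real^'d \<Rightarrow> real"
    and G0 :: "real^'d \<Rightarrow> real^'l^'l"
    and h :: "real^'d \<Rightarrow> real^'s"
  assumes G0_sym: "\<And>x. G0 x \<in> sym_mats"
    and f_C2: "C2_fun f"
    and G0_C2: "C2_fun G0"
    and h_C2: "C2_fun h"
begin

abbreviation G :: "real^'d \<Rightarrow> (real^'l^'l) \<times> (real^'s)" where
  "G \<equiv> G_map G0 h"

abbreviation f' :: "real^'d \<Rightarrow> real^'d \<Rightarrow> real" where
  "f' x \<equiv> frechet_derivative f (at x)"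

abbreviation D :: "real^'d \<Rightarrow> (real^'l^'l) \<times> (real^'s) \<Rightarrow> real^'d" where
  "D x lam \<equiv> DxL f G0 h x lam"

lemma f_deriv: "(f has_derivative f' x) (at x)"
  by (rule C2_fun_has_derivative[OF f_C2])

lemma G_deriv: "(G has_derivative DG G0 h x) (at x)"
  and DG_eq: "DG G0 h x v = (frechet_derivative G0 (at x) v, frechet_derivative h (at x) v)"
proof -
  have G: "G = (\<lambda>x. (G0 x, h x))" by (auto simp: G_map_def)
  have *: "(G has_derivative (\<lambda>v. (frechet_derivative G0 (at x) v, frechet_derivative h (at x) v))) (at x)"
    unfolding G by (intro has_derivative_Pair C2_fun_has_derivative G0_C2 h_C2)
  then show "(G has_derivative DG G0 h x) (at x)"
    "DG G0 h x v = (frechet_derivative G0 (at x) v, frechet_derivative h (at x) v)"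
    using frechet_derivative_at[OF *] unfolding DG_def by (auto simp: fun_eq_iff)
qed

lemma isCont_f: "isCont f x" and isCont_G: "isCont G x" and isCont_G0: "isCont G0 x"
  and isCont_h: "isCont h x"
  using has_derivative_continuous[OF f_deriv] has_derivative_continuous[OF G_deriv]
    has_derivative_continuous[OF C2_fun_has_derivative[OF G0_C2]]
    has_derivative_continuous[OF C2_fun_has_derivative[OF h_C2]] by auto

lemma DG_differentiable: "(\<lambda>x. DG G0 h x v) differentiable (at x)"
  unfolding DG_eq
  using C2_fun_derivative_differentiable[OF G0_C2, of v x]
    C2_fun_derivative_differentiable[OF h_C2, of v x]
  by (auto simp: differentiable_def intro: has_derivative_Pair)

lemma isCont_DG: "isCont (\<lambda>x. DG G0 h x v) x"
  by (rule differentiable_imp_continuous_within[OF DG_differentiable])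

lemma isCont_f': "isCont (\<lambda>x. f' x v) x"
  by (rule differentiable_imp_continuous_within[OF C2_fun_derivative_differentiable[OF f_C2]])

lemma Lagr_eq: "lam \<in> Y_space \<Longrightarrow> Lagr f G0 h x lam = f x + lam \<bullet> G x"
  by (cases lam) (simp add: Lagr_def G_map_def Y_space_iff trace_mult_sym)

lemma Lagr_deriv:
  assumes "lam \<in> Y_space"
  shows "((\<lambda>y. f y + lam \<bullet> G y) has_derivative (\<lambda>v. f' x v + lam \<bullet> DG G0 h x v)) (at x)"
  by (intro has_derivative_add f_deriv has_derivative_inner_right G_deriv)

lemma DxL_nth:
  assumes "lam \<in> Y_space"
  shows "D x lam $ i = f' x (axis i 1) + lam \<bullet> DG G0 h x (axis i 1)"
  using frechet_derivative_at[OF Lagr_deriv[OF assms, of x]]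
  by (simp add: DxL_def gradient_def Lagr_eq[OF assms] fun_eq_iff)

lemma DxL_inner:
  assumes "lam \<in> Y_space"
  shows "D x lam \<bullet> v = f' x v + lam \<bullet> DG G0 h x v"
proof -
  have lin: "linear (\<lambda>v. f' x v + lam \<bullet> DG G0 h x v)"
    using has_derivative_linear[OF Lagr_deriv[OF assms]] .
  have "v = (\<Sum>i\<in>UNIV. (v $ i) *\<^sub>R axis i 1)"
    using basis_expansion[of v] by (simp add: scalar_mult_eq_scaleR)
  then have "f' x v + lam \<bullet> DG G0 h x v = (\<Sum>i\<in>UNIV. v $ i * (D x lam $ i))"
    using linear_sum[OF lin, of "\<lambda>i. (v $ i) *\<^sub>R axis i 1" UNIV] linear_cmul[OF lin]
    by (simp add: DxL_nth[OF assms])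
  then show ?thesis by (simp add: inner_vec_def mult.commute)
qed

text \<open>The adjoint of \<open>DG G0 h x\<close>, written in coordinates.\<close>

definition Adj :: "real^'d \<Rightarrow> (real^'l^'l) \<times> (real^'s) \<Rightarrow> real^'d" where
  "Adj x lam = (\<chi> i. lam \<bullet> DG G0 h x (axis i 1))"

text \<open>The part of the residual that is linear in the multiplier; \<open>\<eta>\<close> is the squared norm of
  the residual. Nondegeneracy of \<open>x\<close> makes \<open>T x\<close> injective on symmetric multipliers.\<close>

definition T :: "real^'d \<Rightarrow> (real^'l^'l) \<times> (real^'s) \<Rightarrow> (real^'d) \<times> (real^'l^'l)" where
  "T x lam = (Adj x lam, fst lam ** G0 x)"

lemma DxL_affine: "lam \<in> Y_space \<Longrightarrow> D x lam = gradient f x + Adj x lam"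
  by (simp add: vec_eq_iff DxL_nth gradient_def Adj_def)

lemma linear_T: "linear (T x)"
  by (intro linearI)
    (simp_all add: T_def bounded_bilinear.add_left[OF bounded_bilinear_matrix_mult]
      bounded_bilinear.scaleR_left[OF bounded_bilinear_matrix_mult] Adj_def vec_eq_iff inner_add)

lemma tendsto_gradient:
  assumes "(x \<longlongrightarrow> y) F"
  shows "((\<lambda>n. gradient f (x n)) \<longlongrightarrow> gradient f y) F"
  unfolding gradient_def
  by (rule vec_tendstoI) (simp add: isCont_tendsto_compose[OF isCont_f' assms])

lemma tendsto_T:
  assumes "(x \<longlongrightarrow> y) F" "(lam \<longlongrightarrow> \<mu>) F"
  shows "((\<lambda>n. T (x n) (lam n)) \<longlongrightarrow> T y \<mu>) F"
  unfolding T_def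
proof (rule tendsto_Pair)
  show "((\<lambda>n. Adj (x n) (lam n)) \<longlongrightarrow> Adj y \<mu>) F"
    unfolding Adj_def
    by (rule vec_tendstoI)
      (simp add: tendsto_inner assms(2) isCont_tendsto_compose[OF isCont_DG assms(1)])
  show "((\<lambda>n. fst (lam n) ** G0 (x n)) \<longlongrightarrow> fst \<mu> ** G0 y) F"
    by (intro bounded_bilinear.tendsto[OF bounded_bilinear_matrix_mult] tendsto_fst assms(2)
        isCont_tendsto_compose[OF isCont_G0 assms(1)])
qed

text \<open>By cyclicity of the trace and symmetry of both factors, the trace term is the squared
  norm of \<open>fst lam ** G0 x\<close>. Hence \<open>eta\<close> is a least squares residual that
  is affine in the multiplier.\<close>

lemma eta_eq:
  assumes "lam \<in> Y_space"
  shows "eta f G0 h x lam = (norm ((gradient f x, 0) + T x lam))\<^sup>2"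
proof -
  have s: "fst lam \<in> sym_mats" using assms by (simp add: Y_space_iff)
  have tr: "transpose (fst lam) = fst lam" "transpose (G0 x) = G0 x"
    using s G0_sym by (auto simp: sym_mats_def)
  define B where "B = fst lam ** G0 x"
  have "trace ((fst lam ** fst lam) ** (G0 x ** G0 x)) = trace (fst lam ** (B ** G0 x))"
    by (simp add: B_def matrix_mul_assoc)
  also have "\<dots> = trace ((B ** G0 x) ** fst lam)"
    by (rule trace_mul_sym)
  also have "\<dots> = trace (B ** transpose B)"
    by (simp add: B_def matrix_transpose_mul tr matrix_mul_assoc)
  also have "\<dots> = B \<bullet> B"
    by (simp add: trace_def matrix_matrix_mult_def transpose_def inner_vec_def)
  finally show ?thesis
    using DxL_affine[OF assms, of x]
    by (simp add: eta_def T_def B_def norm_Pair power2_norm_eq_inner)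
qed

lemma eta_nonneg: "lam \<in> Y_space \<Longrightarrow> 0 \<le> eta f G0 h x lam"
  by (simp add: eta_eq)

lemma tendsto_eta:
  assumes "(x \<longlongrightarrow> y) F" "(lam \<longlongrightarrow> \<mu>) F" "\<And>n. lam n \<in> Y_space" "\<mu> \<in> Y_space"
  shows "((\<lambda>n. eta f G0 h (x n) (lam n)) \<longlongrightarrow> eta f G0 h y \<mu>) F"
  unfolding eta_eq[OF assms(3)] eta_eq[OF assms(4)]
  by (intro tendsto_intros tendsto_gradient tendsto_T assms)

lemma DxL_deriv:
  assumes "lam \<in> Y_space"
  shows "((\<lambda>y. D y lam) has_derivative DxxL f G0 h x lam) (at x)"
proof -
  have "(\<lambda>y. lam \<bullet> DG G0 h y v) differentiable (at x)" for v
    using DG_differentiable[of v x]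
    by (auto simp: differentiable_def intro: has_derivative_inner_right)
  then have "(\<lambda>y. D y lam $ i) differentiable (at x)" for i
    unfolding DxL_nth[OF assms]
    by (intro differentiable_add C2_fun_derivative_differentiable[OF f_C2])
  moreover have "\<exists>k. i = axis k 1" if "i \<in> Basis" for i :: "real^'d"
    using that by (simp add: Basis_vec_def)
  ultimately have "\<forall>i\<in>Basis. (\<lambda>y. D y lam \<bullet> i) differentiable (at x)"
    by (metis (no_types, lifting) cart_eq_inner_axis ext)
  then have "(\<lambda>y. D y lam) differentiable (at x)"
    using differentiable_componentwise_within[of "\<lambda>y. D y lam" x UNIV] by blast
  then show ?thesis
    unfolding DxxL_def by (simp add: frechet_derivative_works)
qed

lemma feasible_iff: "x \<in> feasible G0 h \<longleftrightarrow> G0 x \<in> nsd_cone \<and> h x = 0"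
  by (simp add: feasible_def G_map_def K_cone_def)

text \<open>Nondegeneracy splits \<open>lam\<close> itself into a value of the derivative and a
  lineality direction; \<open>T x lam = 0\<close> makes \<open>lam\<close> orthogonal to both, hence
  to itself.\<close>

lemma T_injective:
  assumes "x \<in> feasible G0 h" "nondegenerate G0 h x" "lam \<in> Y_space" "T x lam = 0"
  shows "lam = 0"
proof -
  have 1: "Adj x lam = 0" and 2: "fst lam ** G0 x = 0"
    using assms(4) by (auto simp: T_def zero_prod_def)
  have "lam \<bullet> DG G0 h x v = 0" for v
    using DxL_inner[OF assms(3), of x v] DxL_inner[OF subspace_0[OF subspace_Y_space], of x v]
      DxL_affine[OF assms(3), of x] DxL_affine[OF subspace_0[OF subspace_Y_space], of x] 1
    by (simp add: Adj_def vec_eq_iff)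
  moreover have "lam \<bullet> w = 0" if "w \<in> lineality (contingent_cone nsd_cone (G0 x)) \<times> {0}" for w
    using that lineality_contingent_nsd_orthogonal[of "G0 x" "fst lam" "fst w"] assms(1,3) 2
    by (auto simp: feasible_iff Y_space_iff inner_prod_def)
  moreover have "lam \<in> {u + w | u w. u \<in> range (DG G0 h x) \<and>
                   w \<in> lineality (contingent_cone nsd_cone (G0 x)) \<times> {0}}"
    using assms(2,3) unfolding nondegenerate_def by blast
  ultimately have "lam \<bullet> lam = 0"
    by (smt (verit, best) image_iff inner_add_right mem_Collect_eq)
  then show ?thesis by simp
qed

text \<open>A bound in operator norm, with \<open>K\<close> independent of the multiplier, because
  it will be applied to multiplier sequences not known to be bounded.\<close>

lemma T_perturbation:
  assumes "x \<longlonglongrightarrow> y"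
  obtains K where "K \<longlonglongrightarrow> 0" "\<And>n lam. norm (T (x n) lam - T y lam) \<le> K n * norm lam"
proof -
  obtain C where C0: "0 \<le> C"
    and C: "\<And>(A::real^'l^'l) (B::real^'l^'l). norm (A ** B) \<le> norm A * norm B * C"
    using bounded_bilinear.nonneg_bounded[OF bounded_bilinear_matrix_mult] by blast
  define K where "K n = (\<Sum>i\<in>UNIV. norm (DG G0 h (x n) (axis i 1) - DG G0 h y (axis i 1)))
    + norm (G0 (x n) - G0 y) * C" for n
  have "K \<longlonglongrightarrow> (\<Sum>i\<in>(UNIV::'d set). norm (DG G0 h y (axis i 1) - DG G0 h y (axis i 1)))
    + norm (G0 y - G0 y) * C"
    unfolding K_def
    by (intro tendsto_intros isCont_tendsto_compose[OF isCont_DG assms]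
        isCont_tendsto_compose[OF isCont_G0 assms])
  then have "K \<longlonglongrightarrow> 0" by simp
  moreover have "norm (T (x n) lam - T y lam) \<le> K n * norm lam" for n lam
  proof -
    have "norm (Adj (x n) lam - Adj y lam) \<le> (\<Sum>i\<in>UNIV. \<bar>(Adj (x n) lam - Adj y lam) $ i\<bar>)"
      by (rule norm_le_l1_cart)
    also have "\<dots> \<le> (\<Sum>i\<in>UNIV. norm (DG G0 h (x n) (axis i 1) - DG G0 h y (axis i 1)) * norm lam)"
      by (rule sum_mono)
        (simp add: Adj_def inner_diff_right[symmetric] mult.commute Cauchy_Schwarz_ineq2)
    finally have 1: "norm (Adj (x n) lam - Adj y lam)
      \<le> (\<Sum>i\<in>UNIV. norm (DG G0 h (x n) (axis i 1) - DG G0 h y (axis i 1))) * norm lam"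
      by (simp add: sum_distrib_right)
    have "norm (fst lam ** G0 (x n) - fst lam ** G0 y) = norm (fst lam ** (G0 (x n) - G0 y))"
      by (simp add: bounded_bilinear.diff_right[OF bounded_bilinear_matrix_mult])
    also have "\<dots> \<le> norm (fst lam) * norm (G0 (x n) - G0 y) * C" by (rule C)
    also have "\<dots> \<le> norm lam * norm (G0 (x n) - G0 y) * C"
      using C0 norm_fst_le[of "fst lam" "snd lam"] by (intro mult_right_mono) auto
    finally show ?thesis
      using 1 norm_Pair_le[of "Adj (x n) lam - Adj y lam" "fst lam ** G0 (x n) - fst lam ** G0 y"]
      by (simp add: T_def K_def algebra_simps)
  qed
  ultimately show ?thesis by (rule that)
qed

text \<open>In finite dimension injectivity of \<open>T y\<close> yields a lower bound, and the
  perturbation eventually consumes at most half of it; so one \<open>\<sigma>\<close> serves all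
  symmetric multipliers and all late \<open>n\<close>.\<close>

lemma T_coercive:
  assumes y: "y \<in> feasible G0 h" "nondegenerate G0 h y" and x: "x \<longlonglongrightarrow> y"
  obtains \<sigma> where "\<sigma> > 0" "\<forall>\<^sub>F n in sequentially. \<forall>lam\<in>Y_space. \<sigma> * norm lam \<le> norm (T (x n) lam)"
proof -
  have "bounded_linear (T y)" using linear_T linear_conv_bounded_linear by blast
  then obtain e where e: "e > 0" "\<And>lam. lam \<in> Y_space \<Longrightarrow> e * norm lam \<le> norm (T y lam)"
    using injective_imp_isometric[OF closed_Y_space subspace_Y_space] T_injective[OF y] by metis
  obtain K where K: "K \<longlonglongrightarrow> 0" "\<And>n lam. norm (T (x n) lam - T y lam) \<le> K n * norm lam"
    using T_perturbation[OF x] by blast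
  have "\<forall>\<^sub>F n in sequentially. K n < e / 2"
    using order_tendstoD(2)[OF K(1), of "e / 2"] e(1) by simp
  then have "\<forall>\<^sub>F n in sequentially. \<forall>lam\<in>Y_space. e / 2 * norm lam \<le> norm (T (x n) lam)"
  proof (rule eventually_mono, intro ballI)
    fix n and lam :: "(real^'l^'l) \<times> (real^'s)"
    assume n: "K n < e / 2" and l: "lam \<in> Y_space"
    have "norm (T y lam) \<le> norm (T (x n) lam) + norm (T (x n) lam - T y lam)"
      by (metis norm_minus_commute norm_triangle_sub)
    moreover have "K n * norm lam \<le> e / 2 * norm lam"
      using n by (intro mult_right_mono) auto
    ultimately show "e / 2 * norm lam \<le> norm (T (x n) lam)"
      using e(2)[OF l] K(2)[of n lam] by linarith
  qed
  with e(1) show ?thesis by (intro that[of "e / 2"]) auto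
qed

lemma global_solutionsD:
  assumes "x \<in> global_solutions f G0 h"
  shows "x \<in> feasible G0 h" "f x = optimal_value f G0 h"
    "\<And>y. y \<in> feasible G0 h \<Longrightarrow> optimal_value f G0 h \<le> f y"
proof -
  have x: "x \<in> feasible G0 h" "\<And>y. y \<in> feasible G0 h \<Longrightarrow> f x \<le> f y"
    using assms unfolding global_solutions_def by (auto simp: is_arg_min_linorder)
  then have "optimal_value f G0 h = f x"
    unfolding optimal_value_def by (intro cInf_eq_minimum) auto
  with x show "x \<in> feasible G0 h" "f x = optimal_value f G0 h"
    "\<And>y. y \<in> feasible G0 h \<Longrightarrow> optimal_value f G0 h \<le> f y" by auto
qed

lemma global_solutionsI:
  assumes "z \<in> global_solutions f G0 h" "x \<in> feasible G0 h" "f x \<le> optimal_value f G0 h"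
  shows "x \<in> global_solutions f G0 h"
  using assms global_solutionsD[OF assms(1)]
  unfolding global_solutions_def by (fastforce simp: is_arg_min_linorder)

end

lemma eventually_bounded_convergent_subseq:
  fixes X :: "nat \<Rightarrow> 'a::{heine_borel,real_normed_vector}"
  assumes "\<forall>\<^sub>F n in sequentially. norm (X n) \<le> B"
  obtains l r where "strict_mono r" "(\<lambda>n. X (r n)) \<longlonglongrightarrow> l"
proof -
  obtain N where N: "\<And>n. n \<ge> N \<Longrightarrow> norm (X n) \<le> B"
    using assms unfolding eventually_sequentially by blast
  then have "bounded (range (\<lambda>n. X (n + N)))"
    unfolding bounded_iff by (intro exI[of _ B]) auto
  then obtain l r where r: "strict_mono r" "((\<lambda>n. X (n + N)) \<circ> r) \<longlonglongrightarrow> l"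
    using bounded_imp_convergent_subsequence by blast
  show ?thesis
    by (rule that[of "\<lambda>n. r n + N" l]) (use r in \<open>auto simp: strict_mono_def o_def\<close>)
qed

section \<open>KKT pairs: uniqueness, boundedness and existence of multipliers\<close>

context nlsdp
begin

lemma eta_zero_iff:
  assumes "lam \<in> Y_space"
  shows "eta f G0 h x lam = 0 \<longleftrightarrow> D x lam = 0 \<and> fst lam ** G0 x = 0"
  by (auto simp: eta_eq[OF assms] DxL_affine[OF assms] T_def zero_prod_def)

lemma KKT_pair_iff:
  assumes "x \<in> feasible G0 h" "lam \<in> Y_space"
  shows "KKT_pair f G0 h x lam \<longleftrightarrow> fst lam \<in> psd_cone \<and> eta f G0 h x lam = 0"
proof -
  have x: "G0 x \<in> nsd_cone" "h x = 0" using assms(1) by (simp_all add: feasible_iff)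
  have s: "fst lam \<in> sym_mats" using assms(2) by (simp add: Y_space_iff)
  have p: "pairing lam (G x) = fst lam \<bullet> G0 x"
    by (simp add: pairing_inner[OF assms(2)] G_map_def x inner_prod_def)
  have t: "trace (fst lam ** G0 x) = fst lam \<bullet> G0 x"
    by (rule trace_mult_sym[OF s])
  have "trace (0 :: real^'l^'l) = 0" by (simp add: trace_def)
  then have "fst lam \<bullet> G0 x = 0 \<longleftrightarrow> fst lam ** G0 x = 0" if "fst lam \<in> psd_cone"
    using psd_nsd_complementary[OF that x(1)] t by auto
  moreover have "lam \<in> K_dual \<longleftrightarrow> fst lam \<in> psd_cone"
    by (cases lam) (simp add: K_dual_def)
  moreover have "G x \<in> K_cone"
    using x by (simp add: G_map_def K_cone_def)
  ultimately show ?thesis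
    unfolding KKT_pair_def p eta_zero_iff[OF assms(2)] by blast
qed

text \<open>The residual is affine in the multiplier, so two zeros differ by an element of the
  kernel of \<open>T x\<close>. Uniqueness holds among all symmetric multipliers, whatever their
  sign.\<close>

lemma eta_zero_unique:
  assumes "x \<in> feasible G0 h" "nondegenerate G0 h x"
    and "lam \<in> Y_space" "\<mu> \<in> Y_space" "eta f G0 h x lam = 0" "eta f G0 h x \<mu> = 0"
  shows "lam = \<mu>"
proof -
  have "T x (lam - \<mu>) = 0"
    using assms(5,6) eta_eq[OF assms(3), of x] eta_eq[OF assms(4), of x]
    by (simp add: linear_diff[OF linear_T] add_eq_0_iff)
  then have "lam - \<mu> = 0"
    using T_injective[OF assms(1,2)] subspace_diff[OF subspace_Y_space assms(3,4)] by blast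
  then show ?thesis by simp
qed

lemma norm_T_le_eta:
  assumes "lam \<in> Y_space"
  shows "norm (T x lam) \<le> norm (gradient f x) + sqrt (eta f G0 h x lam)"
proof -
  have "norm (T x lam) \<le> norm ((gradient f x, 0) + T x lam) + norm (gradient f x, 0 :: real^'l^'l)"
    by (metis add_diff_cancel_left' norm_triangle_ineq4)
  then show ?thesis
    by (simp add: eta_eq[OF assms] norm_Pair add.commute)
qed

lemma multipliers_bounded:
  assumes y: "y \<in> feasible G0 h" "nondegenerate G0 h y" and x: "x \<longlonglongrightarrow> y"
    and lam: "\<And>n. lam n \<in> Y_space" and eta: "\<forall>\<^sub>F n in sequentially. eta f G0 h (x n) (lam n) \<le> C"
  obtains B where "\<forall>\<^sub>F n in sequentially. norm (lam n) \<le> B"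
proof -
  obtain \<sigma> where \<sigma>: "\<sigma> > 0" "\<forall>\<^sub>F n in sequentially. \<forall>lam\<in>Y_space. \<sigma> * norm lam \<le> norm (T (x n) lam)"
    by (rule T_coercive[OF y x])
  have "\<forall>\<^sub>F n in sequentially. norm (gradient f (x n)) < norm (gradient f y) + 1"
    using order_tendstoD(2)[OF tendsto_norm[OF tendsto_gradient[OF x]]] by simp
  with \<sigma>(2) eta have "\<forall>\<^sub>F n in sequentially. norm (lam n) \<le> (norm (gradient f y) + 1 + sqrt C) / \<sigma>"
  proof eventually_elim
    case (elim n)
    have "\<sigma> * norm (lam n) \<le> norm (gradient f (x n)) + sqrt (eta f G0 h (x n) (lam n))"
      using elim(1) lam[of n] norm_T_le_eta[OF lam, of "x n" n] by fastforce
    also have "\<dots> \<le> norm (gradient f y) + 1 + sqrt C"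
      using elim(2,3) by (intro add_mono real_sqrt_le_mono) auto
    finally show ?case using \<sigma>(1) by (simp add: pos_le_divide_eq mult.commute)
  qed
  then show ?thesis by (rule that)
qed

text \<open>The multiplier is the limit of the multipliers of a localised quadratic penalty method; at a
  penalty minimizer, \<open>G0\<close> is replaced by its distance to a fixed point of the cone, which touches the
  distance to the cone from above and is differentiable.\<close>

lemma KKT_pair_exists:
  assumes gs: "x \<in> global_solutions f G0 h" and nd: "nondegenerate G0 h x"
  obtains lam where "lam \<in> Y_space" "KKT_pair f G0 h x lam"
proof -
  note x = global_solutionsD[OF gs]
  define V where "V y = (norm (psd_part (G0 y)))\<^sup>2 + (norm (h y))\<^sup>2" for y
  have V0: "0 \<le> V y" for y by (simp add: V_def)
  have Vx: "V x = 0" using x(1) by (simp add: V_def feasible_iff psd_part_nsd)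
  have contV: "isCont V y" for y
    unfolding V_def
    by (intro continuous_intros isCont_h isCont_o2[OF isCont_G0])
      (use continuous_on_psd_part[of "UNIV :: (real^'l^'l) set"] in \<open>simp add: continuous_on_eq_continuous_at\<close>)
  \<comment> \<open>The proximal term singles out \<open>x\<close>: at a feasible cluster point
    \<open>z\<close> in place of \<open>x\<close> it would cost
    \<open>(norm (z - x))\<^sup>2 / 2\<close>, which optimality of \<open>x\<close> does not
    allow.\<close>
  define \<phi> where "\<phi> n y = f y + (norm (y - x))\<^sup>2 / 2 + real (Suc n) / 2 * V y" for n y
  have "\<exists>z\<in>cball x 1. \<forall>y\<in>cball x 1. \<phi> n z \<le> \<phi> n y" for n
  proof (rule continuous_attains_inf)
    show "continuous_on (cball x 1) (\<phi> n)"
      unfolding \<phi>_def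
      by (intro continuous_intros continuous_at_imp_continuous_on ballI isCont_f contV) auto
  qed auto
  then obtain X where X: "\<And>n. X n \<in> cball x 1" "\<And>n y. y \<in> cball x 1 \<Longrightarrow> \<phi> n (X n) \<le> \<phi> n y"
    by metis
  have phi_le: "\<phi> n (X n) \<le> f x" for n
    using X(2)[of x n] Vx by (simp add: \<phi>_def)
  obtain z r where r: "strict_mono r" and z: "(\<lambda>n. X (r n)) \<longlonglongrightarrow> z"
  proof (rule eventually_bounded_convergent_subseq)
    show "\<forall>\<^sub>F n in sequentially. norm (X n) \<le> norm x + 1"
      using X(1) norm_triangle_sub[of "X _" x]
      by (intro always_eventually allI) (smt (verit) dist_norm mem_cball norm_minus_commute)
  qed
  define c where "c n = real (Suc (r n))" for n
  define Y where "Y n = X (r n)" for n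
  have Y: "Y \<longlonglongrightarrow> z" using z by (simp add: Y_def[abs_def])
  have c: "0 < c n" for n by (simp add: c_def)
  have fY: "(\<lambda>n. f (Y n)) \<longlonglongrightarrow> f z"
    by (rule isCont_tendsto_compose[OF isCont_f Y])
  have key: "f (Y n) + (norm (Y n - x))\<^sup>2 / 2 + c n / 2 * V (Y n) \<le> f x" for n
    using phi_le[of "r n"] by (simp add: \<phi>_def Y_def c_def)
  have cV_le: "c n * V (Y n) \<le> 2 * (f x - f (Y n))" for n
  proof -
    define u v where "u = c n * V (Y n)" and "v = (norm (Y n - x))\<^sup>2"
    have "f (Y n) + v / 2 + u / 2 \<le> f x" "0 \<le> v"
      using key[of n] by (simp_all add: u_def v_def)
    then have "u \<le> 2 * (f x - f (Y n))" by argo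
    then show ?thesis by (simp add: u_def)
  qed
  have "f z + (norm (z - x))\<^sup>2 / 2 \<le> f x"
  proof (rule tendsto_upperbound)
    show "(\<lambda>n. f (Y n) + (norm (Y n - x))\<^sup>2 / 2) \<longlonglongrightarrow> f z + (norm (z - x))\<^sup>2 / 2"
      by (intro tendsto_intros fY Y) auto
    show "\<forall>\<^sub>F n in sequentially. f (Y n) + (norm (Y n - x))\<^sup>2 / 2 \<le> f x"
      using key V0 c by (intro always_eventually allI) (smt (verit) divide_pos_pos mult_nonneg_nonneg)
  qed auto
  moreover have "z \<in> feasible G0 h"
  proof -
    have "(\<lambda>n. 2 * (f x - f (Y n)) * inverse (c n)) \<longlonglongrightarrow> 2 * (f x - f z) * 0"
    proof (intro tendsto_intros fY)
      show "(\<lambda>n. inverse (c n)) \<longlonglongrightarrow> 0"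
        using LIMSEQ_subseq_LIMSEQ[OF LIMSEQ_inverse_real_of_nat r] by (simp add: c_def o_def)
    qed
    moreover have "V (Y n) \<le> 2 * (f x - f (Y n)) * inverse (c n)" for n
    proof -
      show ?thesis
        unfolding divide_inverse[symmetric] pos_le_divide_eq[OF c[of n]]
        using cV_le[of n] by (simp only: mult.commute)
    qed
    moreover have "(\<lambda>n. V (Y n)) \<longlonglongrightarrow> V z"
      by (rule isCont_tendsto_compose[OF contV Y])
    ultimately have "V z \<le> 0"
      using LIMSEQ_le by fastforce
    then have "psd_part (G0 z) = 0" "h z = 0"
      by (auto simp: V_def sum_power2_le_zero_iff)
    then show ?thesis using psd_part_zeroD[OF G0_sym] by (simp add: feasible_iff)
  qed
  ultimately have "(norm (z - x))\<^sup>2 \<le> 0"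
    using x(2) x(3)[of z] by linarith
  then have zx: "z = x" by simp
  note Y = Y[unfolded zx] and fY = fY[unfolded zx]
  \<comment> \<open>Even after multiplication by the penalty parameter the violation vanishes, since
    \<open>f (Y n)\<close> tends to \<open>f x\<close>. Complementarity of the limit multiplier
    rests on this.\<close>
  have cV: "(\<lambda>n. c n * V (Y n)) \<longlonglongrightarrow> 0"
  proof (rule tendsto_sandwich)
    show "\<forall>\<^sub>F n in sequentially. 0 \<le> c n * V (Y n)"
      using V0 c by (intro always_eventually allI mult_nonneg_nonneg) (auto simp: less_imp_le)
    show "\<forall>\<^sub>F n in sequentially. c n * V (Y n) \<le> 2 * (f x - f (Y n))"
      using cV_le by simp
    show "(\<lambda>n. 2 * (f x - f (Y n))) \<longlonglongrightarrow> 0"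
      using tendsto_mult_left[OF tendsto_diff[OF tendsto_const[of "f x"] fY], of 2] by simp
  qed auto
  define P where "P n = psd_part (G0 (Y n))" for n
  define Z where "Z n = G0 (Y n) - P n" for n
  \<comment> \<open>The gradient of the penalty term with respect to the constraint value, read as a
    multiplier.\<close>
  define lam where "lam n = c n *\<^sub>R (G (Y n) - (Z n, 0))" for n
  have lam_eq: "lam n = (c n *\<^sub>R P n, c n *\<^sub>R h (Y n))" for n
    by (simp add: lam_def Z_def G_map_def)
  have P: "P n \<in> psd_cone" and Z: "Z n \<in> nsd_cone" for n
    using psd_part_psd psd_part_residual_nsd[OF G0_sym] by (auto simp: P_def Z_def)
  have lam_psd: "fst (lam n) \<in> psd_cone" for n
    using psd_cone_scale[OF P[of n], of "c n"] c[of n] by (simp add: lam_eq)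
  then have lam_Y: "lam n \<in> Y_space" for n
    by (simp add: Y_space_iff psd_cone_def)
  have first_order: "D (Y n) (lam n) = x - Y n" if n: "Y n \<in> ball x 1" for n
  proof -
    define \<psi> where "\<psi> y = f y + ((y - x) \<bullet> (y - x)) / 2 + c n / 2 * ((G y - (Z n, 0)) \<bullet> (G y - (Z n, 0)))" for y
    have "(\<psi> has_derivative (\<lambda>v. f' (Y n) v + ((Y n - x) \<bullet> v + v \<bullet> (Y n - x)) / 2
        + c n / 2 * ((G (Y n) - (Z n, 0)) \<bullet> DG G0 h (Y n) v + DG G0 h (Y n) v \<bullet> (G (Y n) - (Z n, 0))))) (at (Y n))"
      unfolding \<psi>_def
      by (auto intro!: derivative_eq_intros f_deriv G_deriv)
    moreover have "(f' (Y n) v + ((Y n - x) \<bullet> v + v \<bullet> (Y n - x)) / 2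
        + c n / 2 * ((G (Y n) - (Z n, 0)) \<bullet> DG G0 h (Y n) v + DG G0 h (Y n) v \<bullet> (G (Y n) - (Z n, 0))))
        = (D (Y n) (lam n) - (x - Y n)) \<bullet> v" for v
    proof -
      define w e where "w = G (Y n) - (Z n, 0)" and "e = Y n - x"
      have "lam n = c n *\<^sub>R w" "x - Y n = - e"
        by (simp_all add: lam_def w_def e_def)
      then show ?thesis
        unfolding inner_diff_left[of "D (Y n) (lam n)"] DxL_inner[OF lam_Y] w_def[symmetric] e_def[symmetric]
        by (simp add: inner_commute)
    qed
    ultimately have der: "(\<psi> has_derivative (\<lambda>v. (D (Y n) (lam n) - (x - Y n)) \<bullet> v)) (at (Y n))"
      by simp
    have "\<psi> (Y n) \<le> \<psi> y" if y: "y \<in> ball x 1" for y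
    proof -
      have psi: "\<psi> y = f y + (norm (y - x))\<^sup>2 / 2 + c n / 2 * ((norm (G0 y - Z n))\<^sup>2 + (norm (h y))\<^sup>2)" for y
        by (simp add: \<psi>_def G_map_def inner_prod_def power2_norm_eq_inner)
      have "\<psi> (Y n) = \<phi> (r n) (Y n)"
        by (simp add: psi \<phi>_def V_def Z_def P_def c_def)
      also have "\<dots> \<le> \<phi> (r n) y"
        using X(2)[of y "r n"] y by (simp add: Y_def)
      also have "\<dots> \<le> \<psi> y"
        unfolding psi \<phi>_def V_def c_def
        using psd_part_norm_le[OF G0_sym Z, of y n]
        by (intro add_mono mult_left_mono order_refl power_mono) auto
      finally show ?thesis .
    qed
    with differential_zero_maxmin[OF n open_ball der]
    have "(\<lambda>v. (D (Y n) (lam n) - (x - Y n)) \<bullet> v) = (\<lambda>v. 0)" by blast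
    then have "(D (Y n) (lam n) - (x - Y n)) \<bullet> (D (Y n) (lam n) - (x - Y n)) = 0" by meson
    then show ?thesis by simp
  qed
  obtain C where C0: "0 \<le> C"
    and C: "\<And>(A::real^'l^'l) (B::real^'l^'l). norm (A ** B) \<le> norm A * norm B * C"
    using bounded_bilinear.nonneg_bounded[OF bounded_bilinear_matrix_mult] by blast
  \<comment> \<open>As \<open>P n ** Z n = 0\<close>, the product reduces to
    \<open>c n *\<^sub>R (P n ** P n)\<close>, which is of the order of the vanishing penalty
    value.\<close>
  have compl: "norm (fst (lam n) ** G0 (Y n)) \<le> c n * V (Y n) * C" for n
  proof -
    have "P n \<bullet> Z n = 0"
      using psd_part_orthogonal by (simp add: P_def Z_def)
    then have PZ: "P n ** Z n = 0" by (rule psd_nsd_complementary[OF P Z])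
    have "fst (lam n) ** G0 (Y n) = c n *\<^sub>R (P n ** (Z n + P n))"
      by (simp add: lam_eq Z_def bounded_bilinear.scaleR_left[OF bounded_bilinear_matrix_mult])
    also have "\<dots> = c n *\<^sub>R (P n ** P n)"
      by (simp add: matrix_add_ldistrib PZ)
    finally have "norm (fst (lam n) ** G0 (Y n)) \<le> c n * (norm (P n) * norm (P n) * C)"
      using C[of "P n" "P n"] c[of n] by (simp add: mult_left_mono)
    also have "\<dots> \<le> c n * (V (Y n) * C)"
      using c[of n] C0 by (intro mult_left_mono mult_right_mono)
        (auto simp: V_def P_def power2_eq_square)
    finally show ?thesis by (simp add: mult.assoc)
  qed
  have eta0: "(\<lambda>n. eta f G0 h (Y n) (lam n)) \<longlonglongrightarrow> 0"
  proof (rule tendsto_sandwich)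
    show "\<forall>\<^sub>F n in sequentially. 0 \<le> eta f G0 h (Y n) (lam n)"
      by (intro always_eventually allI eta_nonneg lam_Y)
    \<comment> \<open>Late minimizers are interior to the localizing ball, so the stationarity
      condition applies to them.\<close>
    have "\<forall>\<^sub>F n in sequentially. Y n \<in> ball x 1"
      using topological_tendstoD[OF Y, of "ball x 1"] by simp
    then show "\<forall>\<^sub>F n in sequentially. eta f G0 h (Y n) (lam n)
        \<le> (norm (x - Y n))\<^sup>2 + (c n * V (Y n) * C)\<^sup>2"
    proof eventually_elim
      case (elim n)
      have "(gradient f (Y n), 0) + T (Y n) (lam n) = (x - Y n, fst (lam n) ** G0 (Y n))"
        using first_order[OF elim] DxL_affine[OF lam_Y] by (simp add: T_def)
      then show ?case
        using compl[of n] by (simp add: eta_eq[OF lam_Y] norm_Pair power_mono)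
    qed
    have "(\<lambda>n. (norm (x - Y n))\<^sup>2 + (c n * V (Y n) * C)\<^sup>2) \<longlonglongrightarrow> (norm (x - x))\<^sup>2 + (0 * C)\<^sup>2"
      by (intro tendsto_intros Y cV)
    then show "(\<lambda>n. (norm (x - Y n))\<^sup>2 + (c n * V (Y n) * C)\<^sup>2) \<longlonglongrightarrow> 0" by simp
  qed auto
  have "\<forall>\<^sub>F n in sequentially. eta f G0 h (Y n) (lam n) \<le> 1"
    using order_tendstoD(2)[OF eta0, of 1] by (auto elim: eventually_mono)
  then obtain B where "\<forall>\<^sub>F n in sequentially. norm (lam n) \<le> B"
    by (rule multipliers_bounded[OF x(1) nd Y lam_Y]) (rule that)
  then obtain \<mu> q where q: "strict_mono q" and \<mu>: "(\<lambda>n. lam (q n)) \<longlonglongrightarrow> \<mu>"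
    by (rule eventually_bounded_convergent_subseq)
  have \<mu>Y: "\<mu> \<in> Y_space"
    using closed_sequentially[OF closed_Y_space _ \<mu>] lam_Y by blast
  have \<mu>p: "fst \<mu> \<in> psd_cone"
    using closed_sequentially[OF closed_psd_cone _ tendsto_fst[OF \<mu>]] lam_psd by blast
  have "(\<lambda>n. eta f G0 h (Y (q n)) (lam (q n))) \<longlonglongrightarrow> eta f G0 h x \<mu>"
    using LIMSEQ_subseq_LIMSEQ[OF Y q] by (intro tendsto_eta \<mu> \<mu>Y lam_Y) (simp add: o_def)
  moreover have "(\<lambda>n. eta f G0 h (Y (q n)) (lam (q n))) \<longlonglongrightarrow> 0"
    using LIMSEQ_subseq_LIMSEQ[OF eta0 q] by (simp add: o_def)
  ultimately have "eta f G0 h x \<mu> = 0"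
    using LIMSEQ_unique by blast
  with \<mu>Y \<mu>p show ?thesis
    using that KKT_pair_iff[OF x(1) \<mu>Y] by blast
qed

end

section \<open>Second order analysis along a limiting direction\<close>

context nlsdp
begin

text \<open>Taylor's formula at \<open>z\<close> along moving directions, obtained from
  differentiability of the gradient at the single point \<open>z\<close>: the mean value theorem
  reduces it to a gradient increment at an intermediate point, and
  \<open>has_derivative_sequentially\<close> handles that with step
  \<open>\<xi> n * t n\<close>.\<close>

lemma second_order_expansion:
  assumes lam: "lam \<in> Y_space" and D0: "D z lam = 0"
    and t: "\<And>n::nat. 0 < t n" "t \<longlonglongrightarrow> 0" and v: "v \<longlonglongrightarrow> u"
  shows "(\<lambda>n. (f (z + t n *\<^sub>R v n) + lam \<bullet> G (z + t n *\<^sub>R v n) - (f z + lam \<bullet> G z)) / (t n)\<^sup>2)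
    \<longlonglongrightarrow> (u \<bullet> DxxL f G0 h z lam u) / 2"
proof -
  define L where "L y = f y + lam \<bullet> G y" for y
  define H where "H = DxxL f G0 h z lam"
  have linH: "bounded_linear H"
    unfolding H_def by (rule has_derivative_bounded_linear[OF DxL_deriv[OF lam]])
  have "\<exists>\<xi>. 0 < \<xi> \<and> \<xi> < 1 \<and> L (z + t n *\<^sub>R v n) - L z - (t n)\<^sup>2 / 2 * (v n \<bullet> H (v n))
      = t n * (D (z + (\<xi> * t n) *\<^sub>R v n) lam \<bullet> v n) - (t n)\<^sup>2 * (\<xi> * (v n \<bullet> H (v n)))" for n
  proof -
    \<comment> \<open>Subtracting the quadratic model before the mean value theorem leaves an error
      that is \<open>\<xi> n\<close> times a null sequence, so the position of
      \<open>\<xi> n\<close> in the unit interval does not matter.\<close>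
    define \<phi> where "\<phi> s = L (z + s *\<^sub>R (t n *\<^sub>R v n)) - s\<^sup>2 * ((t n)\<^sup>2 / 2 * (v n \<bullet> H (v n)))" for s :: real
    have "(\<phi> has_derivative (\<lambda>r. D (z + s *\<^sub>R (t n *\<^sub>R v n)) lam \<bullet> (r *\<^sub>R (t n *\<^sub>R v n))
        - 2 * s * r * ((t n)\<^sup>2 / 2 * (v n \<bullet> H (v n))))) (at s within {0..1})" for s
    proof -
      have "(L has_derivative (\<lambda>w. D (z + s *\<^sub>R (t n *\<^sub>R v n)) lam \<bullet> w)) (at (z + s *\<^sub>R (t n *\<^sub>R v n)))"
        unfolding L_def DxL_inner[OF lam] by (rule Lagr_deriv[OF lam])
      then have "((\<lambda>s. L (z + s *\<^sub>R (t n *\<^sub>R v n))) has_derivative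
          (\<lambda>r. D (z + s *\<^sub>R (t n *\<^sub>R v n)) lam \<bullet> (r *\<^sub>R (t n *\<^sub>R v n)))) (at s within {0..1})"
        by (rule has_derivative_compose[rotated]) (auto intro!: derivative_eq_intros)
      then show ?thesis
        unfolding \<phi>_def by (auto intro!: derivative_eq_intros simp: algebra_simps)
    qed
    from mvt_simple[of 0 1 \<phi>, OF zero_less_one this]
    obtain \<xi> where \<xi>: "\<xi> \<in> {0<..<1}" and eq: "\<phi> 1 - \<phi> 0 = D (z + \<xi> *\<^sub>R (t n *\<^sub>R v n)) lam \<bullet> ((1 - 0) *\<^sub>R (t n *\<^sub>R v n))
        - 2 * \<xi> * (1 - 0) * ((t n)\<^sup>2 / 2 * (v n \<bullet> H (v n)))"
      by blast
    then show ?thesis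
      by (intro exI[of _ \<xi>]) (simp add: \<phi>_def mult_ac)
  qed
  then obtain \<xi> where \<xi>: "\<And>n. 0 < \<xi> n" "\<And>n. \<xi> n < 1"
    and eq: "\<And>n. L (z + t n *\<^sub>R v n) - L z - (t n)\<^sup>2 / 2 * (v n \<bullet> H (v n))
      = t n * (D (z + (\<xi> n * t n) *\<^sub>R v n) lam \<bullet> v n) - (t n)\<^sup>2 * (\<xi> n * (v n \<bullet> H (v n)))"
    by metis
  have st: "0 < \<xi> n * t n" for n using \<xi> t by simp
  have "(\<lambda>n. \<xi> n * t n) \<longlonglongrightarrow> 0"
  proof (rule tendsto_sandwich[OF _ _ tendsto_const t(2)])
    show "\<forall>\<^sub>F n in sequentially. 0 \<le> \<xi> n * t n"
      using st by (intro always_eventually allI less_imp_le)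
    show "\<forall>\<^sub>F n in sequentially. \<xi> n * t n \<le> t n"
      using \<xi> t by (intro always_eventually allI) (simp add: mult_left_le_one_le less_imp_le)
  qed
  from has_derivative_sequentially[OF DxL_deriv[OF lam, of z] st this v]
  have "(\<lambda>n. D (z + (\<xi> n * t n) *\<^sub>R v n) lam /\<^sub>R (\<xi> n * t n)) \<longlonglongrightarrow> H u"
    by (simp add: D0 H_def)
  then have "(\<lambda>n. (D (z + (\<xi> n * t n) *\<^sub>R v n) lam /\<^sub>R (\<xi> n * t n) - H (v n)) \<bullet> v n) \<longlonglongrightarrow> (H u - H u) \<bullet> u"
    by (intro tendsto_intros v bounded_linear.tendsto[OF linH])
  then have lim0: "(\<lambda>n. (D (z + (\<xi> n * t n) *\<^sub>R v n) lam /\<^sub>R (\<xi> n * t n) - H (v n)) \<bullet> v n) \<longlonglongrightarrow> 0"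
    by simp
  have "(\<lambda>n. \<xi> n * ((D (z + (\<xi> n * t n) *\<^sub>R v n) lam /\<^sub>R (\<xi> n * t n) - H (v n)) \<bullet> v n)) \<longlonglongrightarrow> 0"
  proof (rule Lim_null_comparison[OF _ tendsto_rabs_zero[OF lim0]])
    show "\<forall>\<^sub>F n in sequentially. norm (\<xi> n * ((D (z + (\<xi> n * t n) *\<^sub>R v n) lam /\<^sub>R (\<xi> n * t n) - H (v n)) \<bullet> v n))
      \<le> \<bar>(D (z + (\<xi> n * t n) *\<^sub>R v n) lam /\<^sub>R (\<xi> n * t n) - H (v n)) \<bullet> v n\<bar>"
      using \<xi> by (intro always_eventually allI)
        (simp add: abs_mult mult_left_le_one_le less_imp_le)
  qed
  moreover have "(\<lambda>n. v n \<bullet> H (v n) / 2) \<longlonglongrightarrow> u \<bullet> H u / 2"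
    by (intro tendsto_intros v bounded_linear.tendsto[OF linH]) auto
  ultimately have "(\<lambda>n. \<xi> n * ((D (z + (\<xi> n * t n) *\<^sub>R v n) lam /\<^sub>R (\<xi> n * t n) - H (v n)) \<bullet> v n)
      + v n \<bullet> H (v n) / 2) \<longlonglongrightarrow> 0 + u \<bullet> H u / 2"
    by (rule tendsto_add)
  moreover have "(L (z + t n *\<^sub>R v n) - L z) / (t n)\<^sup>2
      = \<xi> n * ((D (z + (\<xi> n * t n) *\<^sub>R v n) lam /\<^sub>R (\<xi> n * t n) - H (v n)) \<bullet> v n) + v n \<bullet> H (v n) / 2" for n
  proof -
    define d q where "d = D (z + (\<xi> n * t n) *\<^sub>R v n) lam \<bullet> v n" and "q = v n \<bullet> H (v n)"
    have 1: "L (z + t n *\<^sub>R v n) - L z = (t n)\<^sup>2 / 2 * q + t n * d - (t n)\<^sup>2 * (\<xi> n * q)"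
      using eq[of n] by (simp add: d_def q_def)
    have 2: "(D (z + (\<xi> n * t n) *\<^sub>R v n) lam /\<^sub>R (\<xi> n * t n) - H (v n)) \<bullet> v n = d / (\<xi> n * t n) - q"
      by (simp add: d_def q_def inner_diff inner_commute divide_inverse mult.commute)
    show ?thesis
      unfolding 1 2 q_def[symmetric] using t(1)[of n] \<xi>(1)[of n]
      by (simp add: field_simps power2_eq_square)
  qed
  ultimately show ?thesis by (simp add: L_def H_def)
qed

lemma second_order_sufficient_strict:
  assumes "second_order_sufficient f G0 h x lam" "v \<noteq> 0"
    "DG G0 h x v \<in> contingent_cone K_cone (G x)" "pairing lam (DG G0 h x v) = 0"
    "w \<in> second_order_tangent_set K_cone (G x) (DG G0 h x v)"
  shows "pairing lam w < v \<bullet> DxxL f G0 h x lam v"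
proof (rule ccontr)
  define S where "S = (SUP w \<in> second_order_tangent_set K_cone (G x) (DG G0 h x v). ereal (pairing lam w))"
  assume "\<not> ?thesis"
  then have "ereal (v \<bullet> DxxL f G0 h x lam v) \<le> ereal (pairing lam w)" by simp
  also have "\<dots> \<le> S"
    unfolding S_def using assms(5) by (rule SUP_upper)
  finally have "ereal (v \<bullet> DxxL f G0 h x lam v) - S \<le> 0"
    by (cases S) auto
  moreover have "ereal (v \<bullet> DxxL f G0 h x lam v) - S > 0"
    using assms unfolding second_order_sufficient_def S_def by blast
  ultimately show False by simp
qed

text \<open>For the penalized model of the objective, a sequence of
  points approaching \<open>z\<close> along \<open>v\<close> with values not above the optimal one would make \<open>v\<close> a critical
  direction along which the second order condition fails.\<close>

lemma no_descent_along_critical_direction: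
  assumes z: "z \<in> global_solutions f G0 h" and kkt: "KKT_pair f G0 h z lam"
    and sosc: "second_order_sufficient f G0 h z lam"
    and t: "\<And>n::nat. 0 < t n" "t \<longlonglongrightarrow> 0" and v: "v \<longlonglongrightarrow> u" and u: "u \<noteq> 0"
    and Z: "\<And>n. Z n \<in> nsd_cone" and C: "filterlim C at_top sequentially" "\<And>n. 0 < C n" and k: "k \<longlonglongrightarrow> 0"
    and low: "\<And>n. f (z + t n *\<^sub>R v n) + lam \<bullet> (G (z + t n *\<^sub>R v n) - (Z n, 0))
      + C n * (norm (G (z + t n *\<^sub>R v n) - (Z n, 0)))\<^sup>2 - k n * eta f G0 h (z + t n *\<^sub>R v n) lam
      \<le> optimal_value f G0 h"
  shows False
proof -
  note gs = global_solutionsD[OF z]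
  have Gz: "G0 z \<in> nsd_cone" "h z = 0" using gs(1) by (simp_all add: feasible_iff)
  have psd: "fst lam \<in> psd_cone"
    using kkt by (cases lam) (simp add: KKT_pair_def K_dual_def)
  then have Y: "lam \<in> Y_space" by (simp add: Y_space_iff psd_cone_def)
  have eta: "eta f G0 h z lam = 0" using KKT_pair_iff[OF gs(1) Y] kkt by blast
  then have D0: "D z lam = 0" and compl: "fst lam ** G0 z = 0"
    using eta_zero_iff[OF Y] by auto
  have lamG: "lam \<bullet> G z = 0"
    using kkt pairing_inner[OF Y] by (simp add: KKT_pair_def)
  define X where "X n = z + t n *\<^sub>R v n" for n
  define e where "e n = G (X n) - (Z n, 0)" for n
  define dL where "dL n = (f (X n) + lam \<bullet> G (X n) - f z) / (t n)\<^sup>2" for n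
  define H where "H = u \<bullet> DxxL f G0 h z lam u / 2"
  have dL: "dL \<longlonglongrightarrow> H"
    using second_order_expansion[OF Y D0 t v] lamG by (simp add: dL_def[abs_def] X_def H_def)
  \<comment> \<open>\<open>eta\<close> at the fixed multiplier is the squared norm of
    \<open>R\<close>, which is differentiable and zero at \<open>z\<close>. Hence \<open>eta\<close>
    is of order \<open>(t n)\<^sup>2\<close>, and the factor \<open>k n\<close> makes it
    negligible.\<close>
  define R where "R y = (gradient f y, 0 :: real^'l^'l) + T y lam" for y
  have R_eq: "R = (\<lambda>y. (D y lam, fst lam ** G0 y))"
    by (simp add: R_def T_def DxL_affine[OF Y] fun_eq_iff)
  have Rz: "R z = 0" using eta by (simp add: R_def eta_eq[OF Y])
  obtain R' where "(R has_derivative R') (at z)"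
    unfolding R_eq
    using has_derivative_Pair[OF DxL_deriv[OF Y, of z]
        bounded_linear.has_derivative[OF bounded_bilinear.bounded_linear_right[OF bounded_bilinear_matrix_mult]
          C2_fun_has_derivative[OF G0_C2]]] by blast
  from has_derivative_sequentially[OF this t v] have "(\<lambda>n. R (X n) /\<^sub>R t n) \<longlonglongrightarrow> R' u"
    by (simp add: Rz X_def)
  then have "(\<lambda>n. (norm (R (X n) /\<^sub>R t n))\<^sup>2) \<longlonglongrightarrow> (norm (R' u))\<^sup>2"
    by (intro tendsto_intros)
  moreover have "(norm (R (X n) /\<^sub>R t n))\<^sup>2 = eta f G0 h (X n) lam / (t n)\<^sup>2" for n
  proof -
    have "eta f G0 h (X n) lam = (norm (R (X n)))\<^sup>2" by (simp add: eta_eq[OF Y] R_def)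
    then show ?thesis
      using t(1)[of n] by (simp add: power_mult_distrib power_inverse divide_inverse mult.commute)
  qed
  ultimately have "(\<lambda>n. k n * (eta f G0 h (X n) lam / (t n)\<^sup>2)) \<longlonglongrightarrow> 0 * (norm (R' u))\<^sup>2"
    using k by (intro tendsto_mult) simp_all
  then have "(\<lambda>n. k n * (eta f G0 h (X n) lam / (t n)\<^sup>2)) \<longlonglongrightarrow> 0" by simp
  note \<beta>_lim = tendsto_diff[OF this dL]
  define \<beta> where "\<beta> n = k n * (eta f G0 h (X n) lam / (t n)\<^sup>2) - dL n" for n
  have \<beta>: "\<beta> \<longlonglongrightarrow> - H"
    using \<beta>_lim unfolding \<beta>_def[abs_def] by simp
  have lamZ: "fst lam \<bullet> Z n \<le> 0" for n by (rule psd_inner_nsd[OF psd Z])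
  \<comment> \<open>The hypothesis divided by \<open>(t n)\<^sup>2\<close>: both terms on the left
    are nonnegative, and the smooth terms are collected in the convergent sequence
    \<open>\<beta>\<close>.\<close>
  have main: "C n * ((norm (e n))\<^sup>2 / (t n)\<^sup>2) - fst lam \<bullet> Z n / (t n)\<^sup>2 \<le> \<beta> n" for n
  proof -
    have "(f (X n) + lam \<bullet> G (X n) - f z) + C n * (norm (e n))\<^sup>2 - fst lam \<bullet> Z n
        - k n * eta f G0 h (X n) lam \<le> 0"
      using low[of n] gs(2) by (simp add: X_def[symmetric] e_def inner_diff_right inner_prod_def)
    from divide_right_mono[OF this zero_le_power2[of "t n"]] show ?thesis
      by (simp add: \<beta>_def dL_def diff_divide_distrib add_divide_distrib)
  qed
  \<comment> \<open>Since \<open>\<beta>\<close> is bounded and \<open>C n\<close> tends to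
    infinity, the residual is of smaller order than \<open>t n\<close>. The difference quotients of
    the slack therefore inherit the limit of those of the constraint.\<close>
  have e: "(\<lambda>n. e n /\<^sub>R t n) \<longlonglongrightarrow> 0"
  proof -
    have "(\<lambda>n. inverse (C n) * \<beta> n) \<longlonglongrightarrow> 0 * - H"
      by (intro tendsto_mult \<beta> tendsto_inverse_0_at_top C)
    then have lim: "(\<lambda>n. inverse (C n) * \<beta> n) \<longlonglongrightarrow> 0" by simp
    have le: "(norm (e n /\<^sub>R t n))\<^sup>2 \<le> inverse (C n) * \<beta> n" for n
    proof -
      have "fst lam \<bullet> Z n / (t n)\<^sup>2 \<le> 0"
        using lamZ[of n] by (simp add: divide_nonpos_nonneg)
      then have "C n * ((norm (e n))\<^sup>2 / (t n)\<^sup>2) \<le> \<beta> n"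
        using main[of n] by linarith
      then have "(norm (e n))\<^sup>2 / (t n)\<^sup>2 \<le> \<beta> n / C n"
        using C(2)[of n] by (simp add: pos_le_divide_eq mult.commute)
      moreover have "(norm (e n /\<^sub>R t n))\<^sup>2 = (norm (e n))\<^sup>2 / (t n)\<^sup>2"
        using t(1)[of n] by (simp add: power_mult_distrib power_inverse divide_inverse mult.commute)
      ultimately show ?thesis by (simp add: divide_inverse mult.commute)
    qed
    have "(\<lambda>n. (norm (e n /\<^sub>R t n))\<^sup>2) \<longlonglongrightarrow> 0"
      by (rule tendsto_sandwich[OF always_eventually always_eventually tendsto_const lim])
        (intro allI le zero_le_power2)+
    then have "(\<lambda>n. sqrt ((norm (e n /\<^sub>R t n))\<^sup>2)) \<longlonglongrightarrow> sqrt 0"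
      by (rule tendsto_real_sqrt)
    then have "(\<lambda>n. norm (e n /\<^sub>R t n)) \<longlonglongrightarrow> 0"
      by (simp only: real_sqrt_abs abs_norm_cancel real_sqrt_zero)
    then show ?thesis by (rule tendsto_norm_zero_cancel)
  qed
  have "(\<lambda>n. (G (X n) - G z) /\<^sub>R t n - e n /\<^sub>R t n) \<longlonglongrightarrow> DG G0 h z u - 0"
    using has_derivative_sequentially[OF G_deriv t v, of z]
    by (intro tendsto_diff e) (simp add: X_def)
  moreover have "(G (X n) - G z) /\<^sub>R t n - e n /\<^sub>R t n = ((Z n - G0 z) /\<^sub>R t n, 0)" for n
  proof -
    have "G (X n) - G z - e n = (Z n - G0 z, 0)"
      by (simp add: e_def G_map_def Gz(2))
    then show ?thesis by (simp flip: scaleR_diff_right)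
  qed
  ultimately have lim: "(\<lambda>n. ((Z n - G0 z) /\<^sub>R t n, 0 :: real^'s)) \<longlonglongrightarrow> DG G0 h z u" by simp
  define W where "W = fst (DG G0 h z u)"
  have limW: "(\<lambda>n. (Z n - G0 z) /\<^sub>R t n) \<longlonglongrightarrow> W"
    using tendsto_fst[OF lim] by (simp add: W_def)
  have "snd (DG G0 h z u) = 0"
    using tendsto_snd[OF lim] by (simp add: LIMSEQ_const_iff)
  then have DGu: "DG G0 h z u = (W, 0)"
    by (simp add: W_def prod_eq_iff)
  have tZ: "G0 z + t n *\<^sub>R ((Z n - G0 z) /\<^sub>R t n) = Z n" for n
    using t(1)[of n] by simp
  have W: "W \<in> contingent_cone nsd_cone (G0 z)"
    unfolding contingent_cone_def
    using t limW Z tZ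
    by (intro CollectI exI[of _ t] exI[of _ "\<lambda>n. (Z n - G0 z) /\<^sub>R t n"]) simp
  have crit1: "DG G0 h z u \<in> contingent_cone K_cone (G z)"
    unfolding contingent_cone_def
  proof (intro CollectI exI conjI allI)
    show "0 < t n" for n by (rule t(1))
    show "t \<longlonglongrightarrow> 0" by (rule t(2))
    show "(\<lambda>n. ((Z n - G0 z) /\<^sub>R t n, 0)) \<longlonglongrightarrow> DG G0 h z u" by (rule lim)
    show "G z + t n *\<^sub>R ((Z n - G0 z) /\<^sub>R t n, 0) \<in> K_cone" for n
      using tZ[of n] Z[of n] by (simp add: G_map_def K_cone_def Gz(2))
  qed
  have lamG0: "fst lam \<bullet> G0 z = 0"
    using lamG Gz(2) by (simp add: G_map_def inner_prod_def)
  have limlam: "(\<lambda>n. fst lam \<bullet> Z n / t n) \<longlonglongrightarrow> fst lam \<bullet> W"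
  proof -
    have "(\<lambda>n. fst lam \<bullet> ((Z n - G0 z) /\<^sub>R t n)) \<longlonglongrightarrow> fst lam \<bullet> W"
      by (intro tendsto_intros limW)
    then show ?thesis
      by (simp add: inner_diff_right lamG0 divide_inverse mult.commute)
  qed
  have Zb: "- \<beta> n \<le> fst lam \<bullet> Z n / (t n)\<^sup>2" for n
  proof -
    have "0 \<le> C n * ((norm (e n))\<^sup>2 / (t n)\<^sup>2)"
      using C(2)[of n] by (simp add: less_imp_le)
    then show ?thesis using main[of n] by linarith
  qed
  \<comment> \<open>Polarity gives this sign. The opposite one holds because
    \<open>- \<beta> n\<close> bounds the quotient by \<open>(t n)\<^sup>2\<close> from below, so
    \<open>- \<beta> n * t n\<close>, a null sequence, bounds the quotient by
    \<open>t n\<close>.\<close>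
  have "fst lam \<bullet> W \<le> 0"
    using lamZ t(1) by (intro LIMSEQ_le_const2[OF limlam] exI[of _ 0] allI impI)
      (simp add: divide_nonpos_pos)
  moreover have "0 \<le> fst lam \<bullet> W"
  proof (rule LIMSEQ_le[OF _ limlam])
    show "(\<lambda>n. - \<beta> n * t n) \<longlonglongrightarrow> 0"
      using tendsto_mult[OF tendsto_minus[OF \<beta>] t(2)] by simp
    have "- \<beta> n * t n \<le> fst lam \<bullet> Z n / t n" for n
      using mult_right_mono[OF Zb[of n], of "t n"] t(1)[of n] by (simp add: power2_eq_square)
    then show "\<exists>N. \<forall>n\<ge>N. - \<beta> n * t n \<le> fst lam \<bullet> Z n / t n" by blast
  qed
  ultimately have lamW: "fst lam \<bullet> W = 0" by simp
  have crit2: "pairing lam (DG G0 h z u) = 0"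
    by (simp add: pairing_inner[OF Y] DGu inner_prod_def lamW)
  show False
  proof (rule nsd_cone_curvature[OF Gz(1) psd compl W])
    fix s w
    assume w: "\<And>t. 0 \<le> t \<Longrightarrow> G0 z + t *\<^sub>R W + (t\<^sup>2 / 2) *\<^sub>R w \<in> nsd_cone" "fst lam \<bullet> w = 2 * s"
      and s: "\<And>Z t. (\<And>n::nat. Z n \<in> nsd_cone) \<Longrightarrow> (\<And>n. 0 < t n) \<Longrightarrow> t \<longlonglongrightarrow> 0 \<Longrightarrow>
        (\<lambda>n. (Z n - G0 z) /\<^sub>R t n) \<longlonglongrightarrow> W \<Longrightarrow> \<exists>e. e \<longlonglongrightarrow> s \<and> (\<forall>n. (fst lam \<bullet> Z n) / (t n)\<^sup>2 \<le> e n)"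
    obtain b where b: "b \<longlonglongrightarrow> s" "\<And>n. (fst lam \<bullet> Z n) / (t n)\<^sup>2 \<le> b n"
      using s[OF Z t limW] by blast
    \<comment> \<open>\<open>H\<close> is half the Hessian form and \<open>s\<close> is half of
      \<open>fst lam \<bullet> w\<close>, so this is the reverse of the second order condition at
      \<open>w\<close>.\<close>
    have "H \<le> s"
    proof (rule LIMSEQ_le[OF _ b(1)])
      show "(\<lambda>n. - \<beta> n) \<longlonglongrightarrow> H"
        using tendsto_minus[OF \<beta>] by simp
      show "\<exists>N. \<forall>n\<ge>N. - \<beta> n \<le> b n"
        using Zb b(2) order_trans by blast
    qed
    \<comment> \<open>The parabola through \<open>w\<close> lies in the cone itself, so the distance
      is exactly zero and any positive null sequence will do.\<close>
    have "(w, 0) \<in> second_order_tangent_set K_cone (G z) (DG G0 h z u)"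
      unfolding second_order_tangent_set_def
    proof (intro CollectI exI conjI allI)
      define \<tau> where "\<tau> n = inverse (real (Suc n))" for n
      show "0 < \<tau> n" for n by (simp add: \<tau>_def)
      show "\<tau> \<longlonglongrightarrow> 0" unfolding \<tau>_def by (rule LIMSEQ_inverse_real_of_nat)
      have "G z + \<tau> n *\<^sub>R DG G0 h z u + ((\<tau> n)\<^sup>2 / 2) *\<^sub>R (w, 0) \<in> K_cone" for n
        using w(1)[of "\<tau> n"] by (simp add: G_map_def Gz(2) DGu K_cone_def \<tau>_def)
      then show "(\<lambda>n. infdist (G z + \<tau> n *\<^sub>R DG G0 h z u + ((\<tau> n)\<^sup>2 / 2) *\<^sub>R (w, 0)) K_cone) \<in> o(\<lambda>n. (\<tau> n)\<^sup>2)"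
        by simp
    qed
    from second_order_sufficient_strict[OF sosc u crit1 crit2 this]
    have "2 * s < u \<bullet> DxxL f G0 h z lam u"
      using w(2) by (simp add: pairing_inner[OF Y] inner_prod_def)
    with \<open>H \<le> s\<close> show False by (simp add: H_def)
  qed
qed

end

section \<open>The penalized augmented Lagrangian\<close>

text \<open>Applied with \<open>r\<close> the squared norm of a multiplier part. The last bound
  makes the cost of the multiplier terms independent of the size of the multiplier.\<close>

lemma damping_factor:
  fixes a r \<alpha> :: real
  assumes "0 < a" "a \<le> \<alpha>" "0 \<le> r"
  shows "0 < a / (1 + r)" "a / (1 + r) \<le> \<alpha>" "a / (1 + r) * r \<le> \<alpha>"
proof -
  show "0 < a / (1 + r)" using assms by simp
  have "a * 1 \<le> \<alpha> * (1 + r)" "a * r \<le> \<alpha> * (1 + r)"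
    using assms by (intro mult_mono; simp)+
  then show "a / (1 + r) \<le> \<alpha>" "a / (1 + r) * r \<le> \<alpha>"
    using assms by (simp_all add: pos_divide_le_eq)
qed

text \<open>Completing the square. The coefficient \<open>c / (4 * p)\<close> is half of that in the
  penalty, so the other half remains available to control the residual.\<close>

lemma young_inner:
  fixes d e :: "'a::real_inner"
  assumes "0 < c" "0 < p"
  shows "- (p * (norm d)\<^sup>2 / c) \<le> d \<bullet> e + c / (4 * p) * (norm e)\<^sup>2"
proof -
  have "0 \<le> c / (4 * p) * (norm (e + (2 * p / c) *\<^sub>R d))\<^sup>2"
    using assms by simp
  also have "(norm (e + (2 * p / c) *\<^sub>R d))\<^sup>2
    = (norm e)\<^sup>2 + (4 * p / c) * (d \<bullet> e) + (4 * p\<^sup>2 / c\<^sup>2) * (norm d)\<^sup>2"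
    unfolding power2_norm_eq_inner
    by (simp add: inner_add inner_commute power2_eq_square)
  also have "c / (4 * p) * \<dots> = d \<bullet> e + c / (4 * p) * (norm e)\<^sup>2 + p * (norm d)\<^sup>2 / c"
    using assms by (simp add: field_simps power2_eq_square)
  finally show ?thesis by simp
qed

locale nlsdp_penalty = nlsdp f G0 h
  for f :: "real^'d \<Rightarrow> real" and G0 :: "real^'d \<Rightarrow> real^'l^'l" and h :: "real^'d \<Rightarrow> real^'s" +
  fixes \<alpha> \<kappa> :: real
  assumes alpha_pos: "0 < \<alpha>"
begin

abbreviation p where "p \<equiv> p_fun G0 \<alpha> \<kappa>"
abbreviation q where "q \<equiv> q_fun h \<alpha>"
abbreviation pen where "pen \<equiv> pen_aug_Lagr f G0 h \<alpha> \<kappa>"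
abbreviation \<Omega> where "\<Omega> \<equiv> Omega_alpha G0 h \<alpha> \<kappa>"

lemma p_bounds:
  assumes "x \<in> \<Omega>" "lam \<in> Y_space"
  shows "0 < p x lam" "p x lam \<le> \<alpha>" "p x lam * (norm (fst lam))\<^sup>2 \<le> \<alpha>"
proof -
  have "trace (fst lam ** fst lam) = (norm (fst lam))\<^sup>2"
    using assms(2) by (simp add: Y_space_iff trace_mult_sym power2_norm_eq_inner)
  moreover have "0 < a_fun G0 \<alpha> \<kappa> x" "a_fun G0 \<alpha> \<kappa> x \<le> \<alpha>"
    using assms(1) by (auto simp: Omega_alpha_def a_fun_def)
  ultimately show "0 < p x lam" "p x lam \<le> \<alpha>" "p x lam * (norm (fst lam))\<^sup>2 \<le> \<alpha>"
    using damping_factor[of "a_fun G0 \<alpha> \<kappa> x" \<alpha> "(norm (fst lam))\<^sup>2"] by (simp_all add: p_fun_def)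
qed

lemma q_bounds:
  assumes "x \<in> \<Omega>"
  shows "0 < q x lam" "q x lam \<le> \<alpha>" "q x lam * (norm (snd lam))\<^sup>2 \<le> \<alpha>"
proof -
  have "0 < b_fun h \<alpha> x" "b_fun h \<alpha> x \<le> \<alpha>"
    using assms by (auto simp: Omega_alpha_def b_fun_def)
  then show "0 < q x lam" "q x lam \<le> \<alpha>" "q x lam * (norm (snd lam))\<^sup>2 \<le> \<alpha>"
    using damping_factor[of "b_fun h \<alpha> x" \<alpha> "(norm (snd lam))\<^sup>2"] by (simp_all add: q_fun_def)
qed

text \<open>By Moreau's decomposition the penalized augmented Lagrangian is the minimum of this function
  over \<open>Z\<close> in the cone, the slack variable of the constraint.\<close>

definition slack_model :: "real^'d \<Rightarrow> (real^'l^'l) \<times> (real^'s) \<Rightarrow> real \<Rightarrow> real^'l^'l \<Rightarrow> real" where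
  "slack_model x lam c Z = f x + lam \<bullet> (G x - (Z, 0)) + c / (2 * p x lam) * (norm (G0 x - Z))\<^sup>2
     + c / (2 * q x lam) * (norm (h x))\<^sup>2 + eta f G0 h x lam"

text \<open>One identity valid for every \<open>Z\<close>: the correction term compares the positive
  part of the shifted matrix with its distance to \<open>c *\<^sub>R Z\<close>. It yields both the
  upper bound for slacks in the cone and equality at the optimal slack.\<close>

lemma pen_eq_slack_form:
  assumes x: "x \<in> \<Omega>" and lam: "lam \<in> Y_space" and c: "0 < c"
  shows "pen x lam c = ereal (slack_model x lam c Z + 1 / (2 * c * p x lam) *
    ((norm (psd_part (c *\<^sub>R G0 x + p x lam *\<^sub>R fst lam)))\<^sup>2
      - (norm (c *\<^sub>R G0 x + p x lam *\<^sub>R fst lam - c *\<^sub>R Z))\<^sup>2))"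
proof -
  define A where "A = c *\<^sub>R G0 x + p x lam *\<^sub>R fst lam"
  define e where "e = G0 x - Z"
  note p = p_bounds(1)[OF x lam]
  have tr: "trace (psd_part A ** psd_part A) = (norm (psd_part A))\<^sup>2"
    "trace (fst lam ** fst lam) = (norm (fst lam))\<^sup>2"
    using lam psd_part_psd[of A] by (auto simp: Y_space_iff psd_cone_def trace_mult_sym power2_norm_eq_inner)
  have "A - c *\<^sub>R Z = c *\<^sub>R e + p x lam *\<^sub>R fst lam"
    by (simp add: A_def e_def algebra_simps)
  then have "(norm (A - c *\<^sub>R Z))\<^sup>2 = c\<^sup>2 * (norm e)\<^sup>2 + 2 * c * p x lam * (fst lam \<bullet> e) + (p x lam)\<^sup>2 * (norm (fst lam))\<^sup>2"
    unfolding power2_norm_eq_inner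
    by (simp add: inner_add inner_commute power2_eq_square algebra_simps)
  then have "1 / (2 * c * p x lam) * ((norm (A - c *\<^sub>R Z))\<^sup>2 - (p x lam)\<^sup>2 * (norm (fst lam))\<^sup>2)
    = fst lam \<bullet> e + c / (2 * p x lam) * (norm e)\<^sup>2"
    using c p by (simp add: field_simps power2_eq_square)
  moreover have "1 / (2 * c * p x lam) * ((norm (psd_part A))\<^sup>2 - (p x lam)\<^sup>2 * (norm (fst lam))\<^sup>2)
    = 1 / (2 * c * p x lam) * ((norm (A - c *\<^sub>R Z))\<^sup>2 - (p x lam)\<^sup>2 * (norm (fst lam))\<^sup>2)
      + 1 / (2 * c * p x lam) * ((norm (psd_part A))\<^sup>2 - (norm (A - c *\<^sub>R Z))\<^sup>2)"
    by (simp add: right_diff_distrib)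
  moreover have "lam \<bullet> (G x - (Z, 0)) = fst lam \<bullet> e + snd lam \<bullet> h x"
    by (simp add: e_def G_map_def inner_prod_def)
  ultimately show ?thesis
    using x by (simp add: pen_aug_Lagr_def Let_def slack_model_def A_def[symmetric] e_def[symmetric] tr)
qed

lemma pen_le_slack_model:
  assumes x: "x \<in> \<Omega>" and lam: "lam \<in> Y_space" and c: "0 < c" and Z: "Z \<in> nsd_cone"
  shows "pen x lam c \<le> ereal (slack_model x lam c Z)"
proof -
  define A where "A = c *\<^sub>R G0 x + p x lam *\<^sub>R fst lam"
  have "A \<in> sym_mats"
    unfolding A_def using lam G0_sym
    by (intro subspace_add subspace_scale subspace_sym_mats) (auto simp: Y_space_iff)
  then have "(norm (psd_part A))\<^sup>2 \<le> (norm (A - c *\<^sub>R Z))\<^sup>2"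
    using psd_part_norm_le nsd_cone_scale[OF Z, of c] c by (intro power_mono) auto
  then have "1 / (2 * c * p x lam) * ((norm (psd_part A))\<^sup>2 - (norm (A - c *\<^sub>R Z))\<^sup>2) \<le> 0"
    using c p_bounds(1)[OF x lam] by (intro mult_nonneg_nonpos) auto
  then show ?thesis
    using pen_eq_slack_form[OF x lam c, of Z]
    by (simp add: A_def)
qed

lemma pen_attains_slack_model:
  assumes x: "x \<in> \<Omega>" and lam: "lam \<in> Y_space" and c: "0 < c"
  obtains Z where "Z \<in> nsd_cone" "pen x lam c = ereal (slack_model x lam c Z)"
proof -
  define A where "A = c *\<^sub>R G0 x + p x lam *\<^sub>R fst lam"
  \<comment> \<open>The negative part of \<open>A\<close>, rescaled; it makes the correction term of
    \<open>pen_eq_slack_form\<close> vanish.\<close>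
  define Z where "Z = (1 / c) *\<^sub>R (A - psd_part A)"
  have "A \<in> sym_mats"
    unfolding A_def using lam G0_sym
    by (intro subspace_add subspace_scale subspace_sym_mats) (auto simp: Y_space_iff)
  then have "Z \<in> nsd_cone"
    unfolding Z_def using c by (intro nsd_cone_scale psd_part_residual_nsd) auto
  moreover have "A - c *\<^sub>R Z = psd_part A"
    using c by (simp add: Z_def)
  then have "pen x lam c = ereal (slack_model x lam c Z)"
    using pen_eq_slack_form[OF x lam c, of Z] by (simp add: A_def)
  ultimately show ?thesis by (rule that)
qed

lemma pen_finiteD: "pen x lam c < ereal r \<Longrightarrow> x \<in> \<Omega>" "pen x lam c \<le> ereal r \<Longrightarrow> x \<in> \<Omega>"
  by (auto simp: pen_aug_Lagr_def split: if_splits)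

text \<open>Exchanges the multiplier for an arbitrary \<open>\<mu>\<close>. Half of each quadratic
  penalty pays for the difference, and the other half survives with the uniform weight
  \<open>c / (4 * \<alpha>)\<close>. Taking \<open>\<mu> = 0\<close> gives limits of the points,
  taking the KKT multiplier gives the second order argument.\<close>

lemma slack_model_lower:
  assumes x: "x \<in> \<Omega>" and lam: "lam \<in> Y_space" and c: "0 < c"
  shows "f x + \<mu> \<bullet> (G x - (Z, 0)) + c / (4 * \<alpha>) * (norm (G x - (Z, 0)))\<^sup>2 + eta f G0 h x lam
    - (p x lam * (norm (fst (lam - \<mu>)))\<^sup>2 + q x lam * (norm (snd (lam - \<mu>)))\<^sup>2) / c
    \<le> slack_model x lam c Z"
proof -
  note p = p_bounds(1,2)[OF x lam] and q = q_bounds(1,2)[OF x, of lam]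
  define e where "e = G0 x - Z"
  define P Q where "P = c / (4 * p x lam)" and "Q = c / (4 * q x lam)"
  have "c / (4 * \<alpha>) \<le> P" "c / (4 * \<alpha>) \<le> Q"
    using p q c alpha_pos by (auto simp: P_def Q_def intro!: divide_left_mono)
  then have 1: "c / (4 * \<alpha>) * (norm e)\<^sup>2 \<le> P * (norm e)\<^sup>2" "c / (4 * \<alpha>) * (norm (h x))\<^sup>2 \<le> Q * (norm (h x))\<^sup>2"
    by (intro mult_right_mono; simp)+
  have 2: "- (p x lam * (norm (fst (lam - \<mu>)))\<^sup>2 / c) \<le> fst (lam - \<mu>) \<bullet> e + P * (norm e)\<^sup>2"
    unfolding P_def by (rule young_inner[OF c p(1)])
  have 3: "- (q x lam * (norm (snd (lam - \<mu>)))\<^sup>2 / c) \<le> snd (lam - \<mu>) \<bullet> h x + Q * (norm (h x))\<^sup>2"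
    unfolding Q_def by (rule young_inner[OF c q(1)])
  have 4: "lam \<bullet> (G x - (Z, 0)) = \<mu> \<bullet> (G x - (Z, 0)) + fst (lam - \<mu>) \<bullet> e + snd (lam - \<mu>) \<bullet> h x"
    by (simp add: e_def G_map_def inner_prod_def inner_diff_left)
  have 5: "(norm (G x - (Z, 0)))\<^sup>2 = (norm e)\<^sup>2 + (norm (h x))\<^sup>2"
    by (simp add: e_def G_map_def norm_Pair)
  have 6: "c / (2 * p x lam) * (norm e)\<^sup>2 = P * (norm e)\<^sup>2 + P * (norm e)\<^sup>2"
    "c / (2 * q x lam) * (norm (h x))\<^sup>2 = Q * (norm (h x))\<^sup>2 + Q * (norm (h x))\<^sup>2"
    by (simp_all add: P_def Q_def)
  show ?thesis
    unfolding slack_model_def e_def[symmetric] 4 5 6 add_divide_distrib distrib_left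
    using 1 2 3 by linarith
qed

lemma slack_model_lower_0:
  assumes x: "x \<in> \<Omega>" and lam: "lam \<in> Y_space" and c: "0 < c"
  shows "f x + c / (4 * \<alpha>) * (norm (G x - (Z, 0)))\<^sup>2 + eta f G0 h x lam - 2 * \<alpha> / c \<le> slack_model x lam c Z"
proof -
  have "(p x lam * (norm (fst lam))\<^sup>2 + q x lam * (norm (snd lam))\<^sup>2) / c \<le> 2 * \<alpha> / c"
    using p_bounds(3)[OF x lam] q_bounds(3)[OF x, of lam] c by (intro divide_right_mono) auto
  then show ?thesis
    using slack_model_lower[OF x lam c, of 0 Z] by simp
qed

text \<open>For fixed \<open>Z\<close> the model is affine in \<open>c\<close>, and \<open>p\<close>
  and \<open>q\<close> being at most \<open>\<alpha>\<close> bounds its slope from below by a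
  multiple of the squared residual. This serves both monotonicity and the feasibility of
  minimizers.\<close>

lemma slack_model_diff:
  assumes x: "x \<in> \<Omega>" and lam: "lam \<in> Y_space" and "c1 \<le> c"
  shows "slack_model x lam c1 Z + (c - c1) / (2 * \<alpha>) * (norm (G x - (Z, 0)))\<^sup>2 \<le> slack_model x lam c Z"
proof -
  note p = p_bounds(1,2)[OF x lam] and q = q_bounds(1,2)[OF x, of lam]
  define P Q where "P = (c - c1) / (2 * p x lam)" and "Q = (c - c1) / (2 * q x lam)"
  have "(c - c1) / (2 * \<alpha>) \<le> P" "(c - c1) / (2 * \<alpha>) \<le> Q"
    using p q assms(3) alpha_pos by (auto simp: P_def Q_def intro!: divide_left_mono)
  then have 1: "(c - c1) / (2 * \<alpha>) * (norm (G0 x - Z))\<^sup>2 \<le> P * (norm (G0 x - Z))\<^sup>2"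
      "(c - c1) / (2 * \<alpha>) * (norm (h x))\<^sup>2 \<le> Q * (norm (h x))\<^sup>2"
    by (intro mult_right_mono; simp)+
  have 2: "c / (2 * p x lam) = c1 / (2 * p x lam) + P" "c / (2 * q x lam) = c1 / (2 * q x lam) + Q"
    by (simp_all add: P_def Q_def add_divide_distrib[symmetric])
  have 5: "(norm (G x - (Z, 0)))\<^sup>2 = (norm (G0 x - Z))\<^sup>2 + (norm (h x))\<^sup>2"
    by (simp add: G_map_def norm_Pair)
  show ?thesis
    unfolding slack_model_def 2 5 distrib_left distrib_right using 1 by linarith
qed

text \<open>The slack that is optimal for the larger parameter is a competitor for the smaller
  one.\<close>

lemma pen_mono:
  assumes lam: "lam \<in> Y_space" and c: "0 < c1" "c1 \<le> c"
  shows "pen x lam c1 \<le> pen x lam c"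
proof (cases "x \<in> \<Omega>")
  case True
  obtain Z where Z: "Z \<in> nsd_cone" "pen x lam c = ereal (slack_model x lam c Z)"
    using pen_attains_slack_model[OF True lam, of c] c by auto
  have "0 \<le> (c - c1) / (2 * \<alpha>) * (norm (G x - (Z, 0)))\<^sup>2"
    using c alpha_pos by simp
  then have "slack_model x lam c1 Z \<le> slack_model x lam c Z"
    using slack_model_diff[OF True lam c(2), of Z] by linarith
  then show ?thesis
    using pen_le_slack_model[OF True lam c(1) Z(1)] Z(2) order_trans by fastforce
qed (simp add: pen_aug_Lagr_def)

lemma feasible_Omega: "x \<in> feasible G0 h \<Longrightarrow> x \<in> \<Omega>"
  using alpha_pos by (simp add: feasible_iff Omega_alpha_def a_fun_def b_fun_def psd_part_nsd trace_def)

text \<open>By uniqueness a zero of \<open>eta\<close> at a solution is the KKT multiplier, so its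
  matrix part is positive semidefinite. The slack \<open>G0 x\<close> then yields the optimal value,
  and polarity shows that no slack does better.\<close>

lemma pen_at_solution:
  assumes gs: "x \<in> global_solutions f G0 h" and nd: "nondegenerate G0 h x"
    and lam: "lam \<in> Y_space" "eta f G0 h x lam = 0" and c: "0 < c"
  shows "pen x lam c = ereal (optimal_value f G0 h)"
proof -
  note x = global_solutionsD[OF gs]
  have x': "G0 x \<in> nsd_cone" "h x = 0" using x(1) by (simp_all add: feasible_iff)
  have xO: "x \<in> \<Omega>" by (rule feasible_Omega[OF x(1)])
  obtain \<mu> where \<mu>: "\<mu> \<in> Y_space" "KKT_pair f G0 h x \<mu>" by (rule KKT_pair_exists[OF gs nd])
  then have "eta f G0 h x \<mu> = 0" using KKT_pair_iff[OF x(1)] by blast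
  then have kkt: "KKT_pair f G0 h x lam"
    using eta_zero_unique[OF x(1) nd lam(1) \<mu>(1) lam(2)] \<mu> by simp
  then have psd: "fst lam \<in> psd_cone" and lamG: "lam \<bullet> G x = 0"
    using KKT_pair_iff[OF x(1) lam(1)] pairing_inner[OF lam(1)] by (auto simp: KKT_pair_def)
  have "slack_model x lam c (G0 x) = optimal_value f G0 h"
    using x' x(2) lam(2) by (simp add: slack_model_def G_map_def inner_prod_def)
  then have "pen x lam c \<le> ereal (optimal_value f G0 h)"
    using pen_le_slack_model[OF xO lam(1) c x'(1)] by simp
  moreover obtain Z where Z: "Z \<in> nsd_cone" "pen x lam c = ereal (slack_model x lam c Z)"
    by (rule pen_attains_slack_model[OF xO lam(1) c])
  have "lam \<bullet> (G x - (Z, 0)) = - (fst lam \<bullet> Z)"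
    using lamG by (simp add: inner_diff_right inner_prod_def)
  then have "0 \<le> lam \<bullet> (G x - (Z, 0))"
    using psd_inner_nsd[OF psd Z(1)] by simp
  moreover have "0 \<le> c / (2 * p x lam) * (norm (G0 x - Z))\<^sup>2"
    using c p_bounds(1)[OF xO lam(1)] by simp
  ultimately show ?thesis
    using Z(2) x(2) x'(2) lam(2) by (simp add: slack_model_def)
qed

end

section \<open>No values below the optimal one for large penalty parameters\<close>

locale nlsdp_nondegenerate = nlsdp_penalty f G0 h \<alpha> \<kappa>
  for f :: "real^'d \<Rightarrow> real" and G0 :: "real^'d \<Rightarrow> real^'l^'l" and h :: "real^'d \<Rightarrow> real^'s"
    and \<alpha> \<kappa> :: real +
  assumes solution_exists: "global_solutions f G0 h \<noteq> {}"
    and nondeg: "\<And>x. x \<in> global_solutions f G0 h \<Longrightarrow> nondegenerate G0 h x"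
    and sosc: "\<And>x lam. x \<in> global_solutions f G0 h \<Longrightarrow> KKT_pair f G0 h x lam \<Longrightarrow>
                 second_order_sufficient f G0 h x lam"
begin

abbreviation opt :: real where "opt \<equiv> optimal_value f G0 h"

text \<open>Whatever the multipliers do, they lower the model by at most
  \<open>2 * \<alpha> / c n\<close>. As \<open>f (x n)\<close> converges, the quadratic term drives
  the residual to zero, and closedness of the cone passes to the limit.\<close>

lemma slack_limit:
  assumes x: "\<And>n. x n \<in> \<Omega>" and lam: "\<And>n::nat. lam n \<in> Y_space" and c: "\<And>n. 0 < c n"
    and clim: "filterlim c at_top sequentially" and z: "x \<longlonglongrightarrow> z" and Z: "\<And>n. Z n \<in> nsd_cone"
    and low: "\<And>n. slack_model (x n) (lam n) (c n) (Z n) \<le> opt"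
  shows "z \<in> global_solutions f G0 h"
proof -
  obtain z0 where z0: "z0 \<in> global_solutions f G0 h"
    using solution_exists by blast
  define E where "E n = G (x n) - (Z n, 0)" for n
  have ic: "(\<lambda>n. inverse (c n)) \<longlonglongrightarrow> 0"
    by (rule tendsto_inverse_0_at_top[OF clim])
  have fx: "(\<lambda>n. f (x n)) \<longlonglongrightarrow> f z"
    by (rule isCont_tendsto_compose[OF isCont_f z])
  have main: "f (x n) + c n / (4 * \<alpha>) * (norm (E n))\<^sup>2 \<le> opt + 2 * \<alpha> * inverse (c n)" for n
  proof -
    have "2 * \<alpha> / c n = 2 * \<alpha> * inverse (c n)" by (simp add: divide_inverse)
    then show ?thesis
      using slack_model_lower_0[OF x[of n] lam[of n] c[of n], of "Z n"] low[of n]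
        eta_nonneg[OF lam[of n], of "x n"]
      unfolding E_def by linarith
  qed
  have fle: "f z \<le> opt + 2 * \<alpha> * 0"
  proof (rule LIMSEQ_le[OF fx])
    show "(\<lambda>n. opt + 2 * \<alpha> * inverse (c n)) \<longlonglongrightarrow> opt + 2 * \<alpha> * 0"
      by (intro tendsto_intros ic)
    have "f (x n) \<le> opt + 2 * \<alpha> * inverse (c n)" for n
    proof -
      have "0 \<le> c n / (4 * \<alpha>) * (norm (E n))\<^sup>2"
        using c[of n] alpha_pos by simp
      then show ?thesis using main[of n] by linarith
    qed
    then show "\<exists>N. \<forall>n\<ge>N. f (x n) \<le> opt + 2 * \<alpha> * inverse (c n)" by blast
  qed
  have Ele: "(norm (E n))\<^sup>2 \<le> 4 * \<alpha> * inverse (c n) * (opt + 2 * \<alpha> * inverse (c n) - f (x n))" for n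
  proof -
    have "c n / (4 * \<alpha>) * (norm (E n))\<^sup>2 \<le> opt + 2 * \<alpha> * inverse (c n) - f (x n)"
      using main[of n] by linarith
    then have "4 * \<alpha> * inverse (c n) * (c n / (4 * \<alpha>) * (norm (E n))\<^sup>2)
      \<le> 4 * \<alpha> * inverse (c n) * (opt + 2 * \<alpha> * inverse (c n) - f (x n))"
      using c[of n] alpha_pos by (intro mult_left_mono) auto
    moreover have "4 * \<alpha> * inverse (c n) * (c n / (4 * \<alpha>) * (norm (E n))\<^sup>2) = (norm (E n))\<^sup>2"
      using c[of n] alpha_pos by simp
    ultimately show ?thesis by argo
  qed
  have "(\<lambda>n. 4 * \<alpha> * inverse (c n) * (opt + 2 * \<alpha> * inverse (c n) - f (x n)))
      \<longlonglongrightarrow> 4 * \<alpha> * 0 * (opt + 2 * \<alpha> * 0 - f z)"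
    by (intro tendsto_intros ic fx)
  then have lim0: "(\<lambda>n. 4 * \<alpha> * inverse (c n) * (opt + 2 * \<alpha> * inverse (c n) - f (x n))) \<longlonglongrightarrow> 0"
    by simp
  have "(\<lambda>n. (norm (E n))\<^sup>2) \<longlonglongrightarrow> 0"
    by (rule tendsto_sandwich[OF always_eventually always_eventually tendsto_const lim0])
      (intro allI Ele zero_le_power2)+
  then have "(\<lambda>n. sqrt ((norm (E n))\<^sup>2)) \<longlonglongrightarrow> sqrt 0"
    by (rule tendsto_real_sqrt)
  then have "(\<lambda>n. norm (E n)) \<longlonglongrightarrow> 0"
    by (simp only: real_sqrt_abs abs_norm_cancel real_sqrt_zero)
  then have "E \<longlonglongrightarrow> 0"
    by (rule tendsto_norm_zero_cancel)
  then have "(\<lambda>n. G (x n) - E n) \<longlonglongrightarrow> G z - 0"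
    by (intro tendsto_diff isCont_tendsto_compose[OF isCont_G z])
  then have lim: "(\<lambda>n. (Z n, 0 :: real^'s)) \<longlonglongrightarrow> G z"
    by (simp add: E_def)
  have "Z \<longlonglongrightarrow> G0 z"
    using tendsto_fst[OF lim] by (simp add: G_map_def)
  then have "G0 z \<in> nsd_cone"
    using closed_sequentially[OF closed_nsd_cone] Z by blast
  moreover have "h z = 0"
    using tendsto_snd[OF lim] by (simp add: LIMSEQ_const_iff G_map_def)
  ultimately have "z \<in> feasible G0 h" by (simp add: feasible_iff)
  then show ?thesis
    using global_solutionsI[OF z0] fle by simp
qed

lemma multiplier_distance:
  assumes z: "z \<in> global_solutions f G0 h" and x: "x \<longlonglongrightarrow> z" and \<mu>: "\<mu> \<in> Y_space"
    and lam: "\<And>n::nat. lam n \<in> Y_space"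
  obtains \<sigma> where "0 < \<sigma>" "\<forall>\<^sub>F n in sequentially.
    (norm (lam n - \<mu>))\<^sup>2 \<le> \<sigma> * (eta f G0 h (x n) (lam n) + eta f G0 h (x n) \<mu>)"
proof -
  obtain \<sigma> where \<sigma>: "\<sigma> > 0" "\<forall>\<^sub>F n in sequentially. \<forall>lam\<in>Y_space. \<sigma> * norm lam \<le> norm (T (x n) lam)"
    by (rule T_coercive[OF global_solutionsD(1)[OF z] nondeg[OF z] x])
  have "\<forall>\<^sub>F n in sequentially. (norm (lam n - \<mu>))\<^sup>2
    \<le> 2 / \<sigma>\<^sup>2 * (eta f G0 h (x n) (lam n) + eta f G0 h (x n) \<mu>)"
    using \<sigma>(2)
  proof eventually_elim
    case (elim n)
    define a b where "a = (gradient f (x n), 0 :: real^'l^'l) + T (x n) (lam n)"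
      and "b = (gradient f (x n), 0 :: real^'l^'l) + T (x n) \<mu>"
    have "T (x n) (lam n - \<mu>) = a - b"
      by (simp add: a_def b_def linear_diff[OF linear_T])
    then have "\<sigma> * norm (lam n - \<mu>) \<le> norm (a - b)"
      using elim subspace_diff[OF subspace_Y_space lam[of n] \<mu>] by metis
    then have "(\<sigma> * norm (lam n - \<mu>))\<^sup>2 \<le> (norm (a - b))\<^sup>2"
      using \<sigma>(1) by (intro power_mono) auto
    \<comment> \<open>Adding this square prepares the parallelogram law, the source of the factor 2
      in \<open>2 / \<sigma>\<^sup>2\<close>.\<close>
    also have "\<dots> \<le> (norm (a - b))\<^sup>2 + (norm (a + b))\<^sup>2" by simp
    also have "\<dots> = 2 * ((norm a)\<^sup>2 + (norm b)\<^sup>2)"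
      by (simp add: power2_norm_eq_inner inner_add inner_diff inner_commute)
    finally show ?case
      using \<sigma>(1) by (simp add: eta_eq[OF lam] eta_eq[OF \<mu>] a_def b_def power_mult_distrib field_simps)
  qed
  with \<sigma>(1) show ?thesis by (intro that[of "2 / \<sigma>\<^sup>2"]) auto
qed

lemma no_low_sequence:
  assumes bdd: "bounded (range x)" and lam: "\<And>n::nat. lam n \<in> Y_space" and c: "\<And>n. 0 < c n"
    and clim: "filterlim c at_top sequentially"
    and low: "\<And>n. pen (x n) (lam n) (c n) < ereal opt"
  shows False
proof -
  obtain z r where r: "strict_mono r" and "(x \<circ> r) \<longlonglongrightarrow> z"
    using bounded_imp_convergent_subsequence[OF bdd] by blast
  define y l b where "y n = x (r n)" and "l n = lam (r n)" and "b n = c (r n)" for n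
  have y: "y \<longlonglongrightarrow> z" using \<open>(x \<circ> r) \<longlonglongrightarrow> z\<close> by (simp add: y_def[abs_def] o_def)
  have lY: "l n \<in> Y_space" and b: "0 < b n" and lowy: "pen (y n) (l n) (b n) < ereal opt" for n
    using lam c low by (simp_all add: l_def b_def y_def)
  have blim: "filterlim b at_top sequentially"
    using filterlim_compose[OF clim filterlim_subseq[OF r]] by (simp add: b_def[abs_def])
  have yO: "y n \<in> \<Omega>" for n using pen_finiteD(1)[OF lowy] .
  have "\<exists>Z. Z \<in> nsd_cone \<and> slack_model (y n) (l n) (b n) Z < opt" for n
    using pen_attains_slack_model[OF yO[of n] lY[of n] b[of n]] lowy[of n]
    by (metis less_ereal.simps(1))
  then obtain Z where Z: "\<And>n. Z n \<in> nsd_cone" and Zlow: "\<And>n. slack_model (y n) (l n) (b n) (Z n) < opt"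
    by metis
  have z: "z \<in> global_solutions f G0 h"
    by (rule slack_limit[OF yO lY b blim y Z less_imp_le[OF Zlow]])
  note gs = global_solutionsD[OF z]
  obtain \<mu> where \<mu>: "\<mu> \<in> Y_space" "KKT_pair f G0 h z \<mu>"
    by (rule KKT_pair_exists[OF z nondeg[OF z]])
  have eta\<mu>: "eta f G0 h z \<mu> = 0" and psd: "fst \<mu> \<in> psd_cone"
    using KKT_pair_iff[OF gs(1) \<mu>(1)] \<mu>(2) by auto
  have \<mu>G: "\<mu> \<bullet> G z = 0"
    using \<mu> pairing_inner[OF \<mu>(1)] by (simp add: KKT_pair_def)
  obtain \<sigma> where \<sigma>: "0 < \<sigma>" "\<forall>\<^sub>F n in sequentially.
    (norm (l n - \<mu>))\<^sup>2 \<le> \<sigma> * (eta f G0 h (y n) (l n) + eta f G0 h (y n) \<mu>)"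
    by (rule multiplier_distance[OF z y \<mu>(1) lY])
  \<comment> \<open>The cost of exchanging \<open>l n\<close> for \<open>\<mu>\<close> is at most
    \<open>k n\<close> times the sum of \<open>eta\<close> at both multipliers. Once
    \<open>k n < 1\<close>, the part at \<open>l n\<close> is absorbed by the \<open>eta\<close> in
    the model.\<close>
  define k where "k n = \<alpha> * \<sigma> * inverse (b n)" for n
  have k: "k \<longlonglongrightarrow> 0"
    using tendsto_mult_left[OF tendsto_inverse_0_at_top[OF blim], of "\<alpha> * \<sigma>"] by (simp add: k_def[abs_def])
  have "\<forall>\<^sub>F n in sequentially. k n < 1"
    using order_tendstoD(2)[OF k] by simp
  with \<sigma>(2) have "\<forall>\<^sub>F n in sequentially. y n \<noteq> z \<and>
    f (y n) + \<mu> \<bullet> (G (y n) - (Z n, 0)) + b n / (4 * \<alpha>) * (norm (G (y n) - (Z n, 0)))\<^sup>2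
      - k n * eta f G0 h (y n) \<mu> < opt"
  proof eventually_elim
    case (elim n)
    define d where "d = l n - \<mu>"
    have d: "(norm d)\<^sup>2 = (norm (fst d))\<^sup>2 + (norm (snd d))\<^sup>2"
      by (cases d) (simp add: norm_Pair)
    have "p (y n) (l n) * (norm (fst d))\<^sup>2 + q (y n) (l n) * (norm (snd d))\<^sup>2 \<le> \<alpha> * (norm d)\<^sup>2"
      unfolding d distrib_left
      by (intro add_mono mult_right_mono p_bounds(2)[OF yO lY] q_bounds(2)[OF yO] zero_le_power2)
    also have "\<dots> \<le> \<alpha> * (\<sigma> * (eta f G0 h (y n) (l n) + eta f G0 h (y n) \<mu>))"
      using elim(1) alpha_pos by (intro mult_left_mono) (auto simp: d_def)
    finally have "(p (y n) (l n) * (norm (fst d))\<^sup>2 + q (y n) (l n) * (norm (snd d))\<^sup>2) / b n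
      \<le> \<alpha> * (\<sigma> * (eta f G0 h (y n) (l n) + eta f G0 h (y n) \<mu>)) / b n"
      using b[of n] by (intro divide_right_mono) auto
    also have "\<dots> = k n * eta f G0 h (y n) (l n) + k n * eta f G0 h (y n) \<mu>"
      by (simp add: k_def divide_inverse algebra_simps)
    also have "k n * eta f G0 h (y n) (l n) \<le> eta f G0 h (y n) (l n)"
      using elim(2) eta_nonneg[OF lY, of "y n" n] by (intro mult_left_le_one_le)
        (use \<sigma>(1) alpha_pos b[of n] in \<open>auto simp: k_def\<close>)
    finally have low: "f (y n) + \<mu> \<bullet> (G (y n) - (Z n, 0)) + b n / (4 * \<alpha>) * (norm (G (y n) - (Z n, 0)))\<^sup>2
      - k n * eta f G0 h (y n) \<mu> < opt"
      using slack_model_lower[OF yO[of n] lY[of n] b[of n], of \<mu> "Z n"] Zlow[of n]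
      unfolding d_def by linarith
    \<comment> \<open>At \<open>z\<close> the \<open>eta\<close> term vanishes and the multiplier
      and penalty terms are nonnegative, so the strict inequality excludes \<open>z\<close>. This
      permits normalizing \<open>y n - z\<close>.\<close>
    moreover have "y n \<noteq> z"
    proof
      assume yz: "y n = z"
      have "0 \<le> \<mu> \<bullet> (G z - (Z n, 0))"
        using \<mu>G psd_inner_nsd[OF psd Z[of n]] by (simp add: inner_diff_right inner_prod_def)
      moreover have "0 \<le> b n / (4 * \<alpha>) * (norm (G z - (Z n, 0)))\<^sup>2"
        using b[of n] alpha_pos by simp
      ultimately show False
        using low gs(2) eta\<mu> by (simp add: yz)
    qed
    ultimately show ?case by simp
  qed
  then obtain N where N: "\<And>n. N \<le> n \<Longrightarrow> y n \<noteq> z"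
    "\<And>n. N \<le> n \<Longrightarrow> f (y n) + \<mu> \<bullet> (G (y n) - (Z n, 0)) + b n / (4 * \<alpha>) * (norm (G (y n) - (Z n, 0)))\<^sup>2
      - k n * eta f G0 h (y n) \<mu> < opt"
    unfolding eventually_sequentially by blast
  define v where "v n = (y (n + N) - z) /\<^sub>R norm (y (n + N) - z)" for n
  have nv: "norm (v n) = 1" for n using N(1)[of "n + N"] by (simp add: v_def)
  then have "\<forall>\<^sub>F n in sequentially. norm (v n) \<le> 1" by simp
  then obtain u s where s: "strict_mono s" and vs: "(\<lambda>n. v (s n)) \<longlonglongrightarrow> u"
    by (rule eventually_bounded_convergent_subseq)
  have "norm u = 1"
    using tendsto_norm[OF vs] by (simp add: nv LIMSEQ_const_iff)
  then have u: "u \<noteq> 0" by auto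
  define m where "m n = s n + N" for n
  have m: "strict_mono m" using s by (simp add: m_def strict_mono_def)
  have mN: "N \<le> m n" for n by (simp add: m_def)
  define t where "t n = norm (y (m n) - z)" for n
  have t: "0 < t n" for n using N(1)[OF mN] by (simp add: t_def)
  have "(\<lambda>n. y (m n)) \<longlonglongrightarrow> z" using LIMSEQ_subseq_LIMSEQ[OF y m] by (simp add: o_def)
  then have "(\<lambda>n. norm (y (m n) - z)) \<longlonglongrightarrow> norm (z - z)"
    by (intro tendsto_norm tendsto_diff tendsto_const)
  then have t0: "t \<longlonglongrightarrow> 0" by (simp add: t_def[abs_def])
  have yeq: "z + t n *\<^sub>R v (s n) = y (m n)" for n
    using t[of n] by (simp add: t_def v_def m_def)
  show False
  proof (rule no_descent_along_critical_direction[OF z \<mu>(2) sosc[OF z \<mu>(2)] t t0 vs u,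
        where Z = "\<lambda>n. Z (m n)" and C = "\<lambda>n. b (m n) / (4 * \<alpha>)" and k = "\<lambda>n. k (m n)"])
    show "Z (m n) \<in> nsd_cone" for n by (rule Z)
    show "0 < b (m n) / (4 * \<alpha>)" for n using b alpha_pos by simp
    show "filterlim (\<lambda>n. b (m n) / (4 * \<alpha>)) at_top sequentially"
      unfolding divide_inverse
      using filterlim_compose[OF blim filterlim_subseq[OF m]] alpha_pos
      by (intro filterlim_at_top_mult_tendsto_pos[OF tendsto_const]) auto
    show "(\<lambda>n. k (m n)) \<longlonglongrightarrow> 0"
      using LIMSEQ_subseq_LIMSEQ[OF k m] by (simp add: o_def)
    show "f (z + t n *\<^sub>R v (s n)) + \<mu> \<bullet> (G (z + t n *\<^sub>R v (s n)) - (Z (m n), 0))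
        + b (m n) / (4 * \<alpha>) * (norm (G (z + t n *\<^sub>R v (s n)) - (Z (m n), 0)))\<^sup>2
        - k (m n) * eta f G0 h (z + t n *\<^sub>R v (s n)) \<mu> \<le> opt" for n
      unfolding yeq using N(2)[OF mN[of n]] by (rule less_imp_le)
  qed
qed

text \<open>If low points existed for each \<open>c0 + real n\<close>, their \<open>x\<close>
  components would stay in \<open>S\<close> and contradict \<open>no_low_sequence\<close>.
  Boundedness is asked of these components alone.\<close>

lemma no_low_points_for_large_penalty:
  assumes c0: "0 < c0" and S: "bounded S"
    and low: "\<And>c x lam. c0 \<le> c \<Longrightarrow> lam \<in> Y_space \<Longrightarrow> pen x lam c < ereal opt \<Longrightarrow> x \<in> S"
  obtains c where "0 < c" "\<And>x lam. lam \<in> Y_space \<Longrightarrow> ereal opt \<le> pen x lam c"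
proof (rule ccontr)
  assume "\<not> thesis"
  with that have "\<exists>x lam. lam \<in> Y_space \<and> pen x lam (c0 + real n) < ereal opt" for n
    using c0 by (metis add_pos_nonneg not_le of_nat_0_le_iff)
  then obtain x lam where xl: "\<And>n. lam n \<in> Y_space" "\<And>n. pen (x n) (lam n) (c0 + real n) < ereal opt"
    by metis
  have "bounded (range x)"
    using low[OF _ xl] by (intro bounded_subset[OF S]) auto
  moreover have "filterlim (\<lambda>n. c0 + real n) at_top sequentially"
    by (intro filterlim_tendsto_add_at_top[OF tendsto_const] filterlim_real_sequentially)
  ultimately show False
    using no_low_sequence[OF _ xl(1) _ _ xl(2)] c0 by (simp add: add_pos_nonneg)
qed

section \<open>From the absence of low values to global exactness\<close>

lemma solution_multiplier:
  obtains x lam where "x \<in> global_solutions f G0 h" "lam \<in> Y_space" "eta f G0 h x lam = 0"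
proof -
  obtain x where x: "x \<in> global_solutions f G0 h" using solution_exists by blast
  obtain lam where lam: "lam \<in> Y_space" "KKT_pair f G0 h x lam"
    by (rule KKT_pair_exists[OF x nondeg[OF x]])
  then have "eta f G0 h x lam = 0"
    using KKT_pair_iff[OF global_solutionsD(1)[OF x]] by blast
  with x lam(1) show ?thesis by (rule that)
qed

lemma KKT_iff_eta_zero:
  assumes x: "x \<in> global_solutions f G0 h" and lam: "lam \<in> Y_space"
  shows "KKT_pair f G0 h x lam \<longleftrightarrow> eta f G0 h x lam = 0"
proof -
  note xf = global_solutionsD(1)[OF x]
  obtain \<mu> where \<mu>: "\<mu> \<in> Y_space" "KKT_pair f G0 h x \<mu>"
    by (rule KKT_pair_exists[OF x nondeg[OF x]])
  then show ?thesis
    using KKT_pair_iff[OF xf] eta_zero_unique[OF xf nondeg[OF x] lam \<mu>(1)] lam by blast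
qed

lemma global_minimizer_iff:
  "global_minimizer f G0 h \<alpha> \<kappa> c x lam \<longleftrightarrow>
    lam \<in> Y_space \<and> (\<forall>y. \<forall>\<nu>\<in>Y_space. pen x lam c \<le> pen y \<nu> c)"
  unfolding global_minimizer_def is_arg_min_linorder by auto

lemma globally_exact_if_no_low_points:
  assumes c1: "0 < c1" and nolow: "\<And>x lam. lam \<in> Y_space \<Longrightarrow> ereal opt \<le> pen x lam c1"
  shows "globally_exact f G0 h \<alpha> \<kappa>"
  unfolding globally_exact_def
\<comment> \<open>The threshold lies strictly above \<open>c1\<close> because the feasibility of
  minimizers comes from a positive gap \<open>c - c1\<close>.\<close>
proof (intro exI[of _ "c1 + 1"] conjI allI impI)
  show "0 < c1 + 1" using c1 by simp
  fix c assume c: "c1 + 1 \<le> c"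
  have c0: "0 < c" using c c1 by simp
  have ge: "ereal opt \<le> pen x lam c" if "lam \<in> Y_space" for x lam
    using nolow[OF that] pen_mono[OF that c1, of c] c order_trans by fastforce
  have min: "global_minimizer f G0 h \<alpha> \<kappa> c x lam"
    if "x \<in> global_solutions f G0 h" "eta f G0 h x lam = 0" "lam \<in> Y_space" for x lam
    unfolding global_minimizer_iff
    using pen_at_solution[OF that(1) nondeg[OF that(1)] that(3,2) c0] ge that(3) by simp
  obtain x0 l0 where x0: "x0 \<in> global_solutions f G0 h" "l0 \<in> Y_space" "eta f G0 h x0 l0 = 0"
    by (rule solution_multiplier)
  show "\<exists>x lam. global_minimizer f G0 h \<alpha> \<kappa> c x lam"
    using min x0 by blast
  show "\<forall>lam\<in>Y_space. global_minimizer f G0 h \<alpha> \<kappa> c x lam \<longleftrightarrow>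
    x \<in> global_solutions f G0 h \<and> eta f G0 h x lam = 0" for x
  proof (intro ballI iffI)
    fix lam :: "(real^'l^'l) \<times> (real^'s)" assume lam: "lam \<in> Y_space"
    show "global_minimizer f G0 h \<alpha> \<kappa> c x lam"
      if "x \<in> global_solutions f G0 h \<and> eta f G0 h x lam = 0"
      using min lam that by blast
    assume "global_minimizer f G0 h \<alpha> \<kappa> c x lam"
    then have "pen x lam c \<le> pen x0 l0 c"
      using x0(2) by (simp add: global_minimizer_iff)
    then have le: "pen x lam c \<le> ereal opt"
      using pen_at_solution[OF x0(1) nondeg[OF x0(1)] x0(2,3) c0] by simp
    then have x: "x \<in> \<Omega>" by (rule pen_finiteD(2))
    obtain Z where Z: "Z \<in> nsd_cone" "pen x lam c = ereal (slack_model x lam c Z)"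
      by (rule pen_attains_slack_model[OF x lam c0])
    have m: "slack_model x lam c Z \<le> opt" using le Z(2) by simp
    have m1: "opt \<le> slack_model x lam c1 Z"
      using nolow[OF lam, of x] pen_le_slack_model[OF x lam c1 Z(1)] order_trans by fastforce
    \<comment> \<open>The slack optimal at \<open>c\<close> is inserted at \<open>c1\<close>, where
      the model is still at least \<open>opt\<close>. The growth between the two parameters must
      then be zero, and with it the residual.\<close>
    have "(c - c1) / (2 * \<alpha>) * (norm (G x - (Z, 0)))\<^sup>2 \<le> 0"
      using slack_model_diff[OF x lam, of c1 c Z] c m m1 by simp
    moreover have "0 < (c - c1) / (2 * \<alpha>)" using c alpha_pos by simp
    ultimately have "(norm (G x - (Z, 0)))\<^sup>2 \<le> 0"
      by (simp only: mult_le_0_iff) auto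
    then have "G x = (Z, 0)" by simp
    then have eq: "G0 x = Z" "h x = 0" by (simp_all add: G_map_def)
    then have xf: "x \<in> feasible G0 h" using Z(1) by (simp add: feasible_iff)
    have "f x + eta f G0 h x lam \<le> opt"
      using m eq by (simp add: slack_model_def G_map_def zero_prod_def[symmetric])
    moreover have "opt \<le> f x" using global_solutionsD(3)[OF x0(1) xf] .
    ultimately show "x \<in> global_solutions f G0 h \<and> eta f G0 h x lam = 0"
      using eta_nonneg[OF lam, of x] global_solutionsI[OF x0(1) xf] by auto
  qed
qed

theorem globally_exact_iff_no_low_points:
  "globally_exact f G0 h \<alpha> \<kappa> \<longleftrightarrow> (\<exists>c>0. \<forall>x. \<forall>lam\<in>Y_space. ereal opt \<le> pen x lam c)"
proof
  assume "globally_exact f G0 h \<alpha> \<kappa>"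
  then obtain c where c: "0 < c" and min: "\<exists>x lam. global_minimizer f G0 h \<alpha> \<kappa> c x lam"
    and iff: "\<And>x lam. lam \<in> Y_space \<Longrightarrow> global_minimizer f G0 h \<alpha> \<kappa> c x lam \<Longrightarrow>
      x \<in> global_solutions f G0 h \<and> eta f G0 h x lam = 0"
    unfolding globally_exact_def by blast
  obtain x lam where m: "global_minimizer f G0 h \<alpha> \<kappa> c x lam" using min by blast
  then have lam: "lam \<in> Y_space" and le: "\<And>y \<nu>. \<nu> \<in> Y_space \<Longrightarrow> pen x lam c \<le> pen y \<nu> c"
    by (simp_all add: global_minimizer_iff)
  have x: "x \<in> global_solutions f G0 h" "eta f G0 h x lam = 0"
    using iff[OF lam m] by auto
  have "pen x lam c = ereal opt"
    by (rule pen_at_solution[OF x(1) nondeg[OF x(1)] lam x(2) c])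
  with c le show "\<exists>c>0. \<forall>x. \<forall>lam\<in>Y_space. ereal opt \<le> pen x lam c" by auto
qed (use globally_exact_if_no_low_points in blast)

text \<open>By monotonicity in \<open>c\<close> all low points for larger parameters lie in the set
  for \<open>c0\<close>, whose projection to the \<open>x\<close> component provides the bounded set
  needed.\<close>

theorem globally_exact_iff_bounded_or_empty:
  "globally_exact f G0 h \<alpha> \<kappa> \<longleftrightarrow>
    (\<exists>c>0. bounded {(x, lam). lam \<in> Y_space \<and> pen x lam c < ereal opt} \<or>
      {(x, lam). lam \<in> Y_space \<and> pen x lam c < ereal opt} = {})"
proof
  assume "globally_exact f G0 h \<alpha> \<kappa>"
  then show "\<exists>c>0. bounded {(x, lam). lam \<in> Y_space \<and> pen x lam c < ereal opt} \<or>
      {(x, lam). lam \<in> Y_space \<and> pen x lam c < ereal opt} = {}"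
    unfolding globally_exact_iff_no_low_points by (fastforce simp: not_less)
next
  assume "\<exists>c>0. bounded {(x, lam). lam \<in> Y_space \<and> pen x lam c < ereal opt} \<or>
      {(x, lam). lam \<in> Y_space \<and> pen x lam c < ereal opt} = {}"
  then obtain c0 where c0: "0 < c0" and "bounded {(x, lam). lam \<in> Y_space \<and> pen x lam c0 < ereal opt} \<or>
      {(x, lam). lam \<in> Y_space \<and> pen x lam c0 < ereal opt} = {}"
    by (elim exE conjE)
  then have "bounded {(x, lam). lam \<in> Y_space \<and> pen x lam c0 < ereal opt}"
    by (elim disjE) (simp_all only: bounded_empty)
  then have S: "bounded (fst ` {(x, lam). lam \<in> Y_space \<and> pen x lam c0 < ereal opt})"
    by (intro bounded_fst)
  have low: "x \<in> fst ` {(x, lam). lam \<in> Y_space \<and> pen x lam c0 < ereal opt}"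
    if "c0 \<le> c" "lam \<in> Y_space" "pen x lam c < ereal opt" for c x lam
    using le_less_trans[OF pen_mono[OF that(2) c0 that(1), of x] that(3)] that(2)
    by (intro image_eqI[of _ _ "(x, lam)"]) simp_all
  show "globally_exact f G0 h \<alpha> \<kappa>"
    by (rule no_low_points_for_large_penalty[OF c0 S low]) (use globally_exact_if_no_low_points in blast)+
qed

theorem globally_exact_if_bounded_sublevel:
  assumes \<gamma>: "0 < \<gamma>" and S: "bounded {x. f x < opt + \<gamma> \<and> a_fun G0 \<alpha> \<kappa> x > 0 \<and> b_fun h \<alpha> x > 0}"
  shows "globally_exact f G0 h \<alpha> \<kappa>"
proof -
  \<comment> \<open>The threshold \<open>2 * \<alpha> / \<gamma>\<close> is where the largest
    possible multiplier gain \<open>2 * \<alpha> / c\<close> drops to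
    \<open>\<gamma>\<close>.\<close>
  have low: "x \<in> {x. f x < opt + \<gamma> \<and> a_fun G0 \<alpha> \<kappa> x > 0 \<and> b_fun h \<alpha> x > 0}"
    if "2 * \<alpha> / \<gamma> \<le> c" and lam: "lam \<in> Y_space" and low: "pen x lam c < ereal opt" for c x lam
  proof -
    have c: "0 < c" using that(1) \<gamma> alpha_pos by (metis divide_pos_pos less_le_trans mult_pos_pos zero_less_numeral)
    have x: "x \<in> \<Omega>" using pen_finiteD(1)[OF low] .
    obtain Z where "pen x lam c = ereal (slack_model x lam c Z)"
      by (rule pen_attains_slack_model[OF x lam c])
    then have "slack_model x lam c Z < opt" using low by simp
    moreover have "0 \<le> c / (4 * \<alpha>) * (norm (G x - (Z, 0)))\<^sup>2" using c alpha_pos by simp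
    moreover have "2 * \<alpha> / c \<le> \<gamma>" using that(1) \<gamma> c by (simp add: field_simps)
    ultimately have "f x < opt + \<gamma>"
      using slack_model_lower_0[OF x lam c, of Z] eta_nonneg[OF lam, of x] by linarith
    then show ?thesis using x by (simp add: Omega_alpha_def)
  qed
  have "0 < 2 * \<alpha> / \<gamma>" using \<gamma> alpha_pos by simp
  then show ?thesis
    by (rule no_low_points_for_large_penalty[OF _ S low]) (use globally_exact_if_no_low_points in blast)+
qed

end

theorem theorem13:
  fixes f :: "real^'d \<Rightarrow> real"
    and G0 :: "real^'d \<Rightarrow> real^'l^'l"
    and h :: "real^'d \<Rightarrow> real^'s"
    and \<alpha> \<kappa> :: real
  assumes G0_sym: "\<And>x. G0 x \<in> sym_mats"
    and alpha_pos: "\<alpha> > 0"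
    and kappa_gt_1: "\<kappa> > 1"
    and solution_exists: "global_solutions f G0 h \<noteq> {}"
    and f_C2: "C2_fun f"
    and G0_C2: "C2_fun G0"
    and h_C2: "C2_fun h"
    and nondeg: "\<And>x. x \<in> global_solutions f G0 h \<Longrightarrow> nondegenerate G0 h x"
    and sosc: "\<And>x lam. x \<in> global_solutions f G0 h \<Longrightarrow> KKT_pair f G0 h x lam \<Longrightarrow>
                 second_order_sufficient f G0 h x lam"
  shows "(globally_exact f G0 h \<alpha> \<kappa> \<longleftrightarrow>
           (\<exists>c0>0.
              bounded {(x, lam). lam \<in> Y_space \<and>
                 pen_aug_Lagr f G0 h \<alpha> \<kappa> x lam c0 < ereal (optimal_value f G0 h)} \<or>
              {(x, lam). lam \<in> Y_space \<and>
                 pen_aug_Lagr f G0 h \<alpha> \<kappa> x lam c0 < ereal (optimal_value f G0 h)} = {})) \<and>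
         ((\<exists>\<gamma>>0. bounded {x. f x < optimal_value f G0 h + \<gamma> \<and>
                             a_fun G0 \<alpha> \<kappa> x > 0 \<and> b_fun h \<alpha> x > 0}) \<longrightarrow>
           globally_exact f G0 h \<alpha> \<kappa> \<and>
           (\<exists>c0>0. \<forall>c\<ge>c0. \<forall>x. \<forall>lam\<in>Y_space. global_minimizer f G0 h \<alpha> \<kappa> c x lam \<longleftrightarrow>
              x \<in> global_solutions f G0 h \<and> KKT_pair f G0 h x lam))"
proof -
  interpret nlsdp_nondegenerate f G0 h \<alpha> \<kappa>
    by unfold_locales
      (use G0_sym f_C2 G0_C2 h_C2 alpha_pos solution_exists nondeg sosc in blast)+
  \<comment> \<open>At a global solution the zeros of \<open>eta\<close> are exactly the KKT
    multipliers, so exactness with respect to \<open>eta\<close> can be restated for KKT pairs with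
    the same threshold.\<close>
  have KKT: "\<exists>c0>0. \<forall>c\<ge>c0. \<forall>x. \<forall>lam\<in>Y_space. global_minimizer f G0 h \<alpha> \<kappa> c x lam \<longleftrightarrow>
      x \<in> global_solutions f G0 h \<and> KKT_pair f G0 h x lam" if "globally_exact f G0 h \<alpha> \<kappa>"
    using that KKT_iff_eta_zero unfolding globally_exact_def by meson
  show ?thesis
  proof (intro conjI impI)
    show "globally_exact f G0 h \<alpha> \<kappa> \<longleftrightarrow>
      (\<exists>c0>0. bounded {(x, lam). lam \<in> Y_space \<and>
          pen_aug_Lagr f G0 h \<alpha> \<kappa> x lam c0 < ereal (optimal_value f G0 h)} \<or>
        {(x, lam). lam \<in> Y_space \<and>
          pen_aug_Lagr f G0 h \<alpha> \<kappa> x lam c0 < ereal (optimal_value f G0 h)} = {})"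
      by (rule globally_exact_iff_bounded_or_empty)
    assume "\<exists>\<gamma>>0. bounded {x. f x < optimal_value f G0 h + \<gamma> \<and>
      a_fun G0 \<alpha> \<kappa> x > 0 \<and> b_fun h \<alpha> x > 0}"
    then show exact: "globally_exact f G0 h \<alpha> \<kappa>"
      using globally_exact_if_bounded_sublevel by blast
    show "\<exists>c0>0. \<forall>c\<ge>c0. \<forall>x. \<forall>lam\<in>Y_space. global_minimizer f G0 h \<alpha> \<kappa> c x lam \<longleftrightarrow>
      x \<in> global_solutions f G0 h \<and> KKT_pair f G0 h x lam"
      by (rule KKT[OF exact])
  qed
qed

end
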